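(* For every integer $n\ge 3$, the $\mathbb{Z}$-graded Lie superalgebra $SHO(n,n)$ has no non-trivial filtered deformations; that is, every filtered deformation of $SHO(n,n)$ is trivial.
   Context: All vector spaces and algebras are over $\mathbb{C}$. Filtered deformations. Let $\mathfrak{g}=\bigoplus_{j\ge -h}\mathfrak{g}_j$ ($h$ a positive integer) be a Lie superalgebra with a $\mathbb{Z}$-gradation compatible with its $\mathbb{Z}_2$-gradation, $[\mathfrak{g}_i,\mathfrak{g}_j]\subset\mathfrak{g}_{i+j}$, $\dim\mathfrak{g}_j<\infty$. Its completion is $\bar{\mathfrak{g}}=\prod_j\mathfrak{g}_j$, filtered by $\prod_{i\ge j}\mathfrak{g}_i$. A filtered Lie superalgebra of depth $h$ is a Lie superalgebra $L=L_{-h}\supset L_{-h+1}\supset\cdots\supset L_0\supset L_1\supset\cdots$ with $L_i$ subspaces compatible with the $\mathbb{Z}_2$-gradation, $[L_i,L_j]\subset L_{i+j}$, $\dim L_j/L_{j+1}<\infty$; it is assumed complete (and separated) in the topology defined by the filtration. A filtered deformation of $\mathfrak{g}$ is such an $L$ whose associated graded Lie superalgebra $\bigoplus_j L_j/L_{j+1}$ is isomorphic to $\mathfrak{g}$. It is trivial if it is isomorphic to $\bar{\mathfrak{g}}$ (as a filtered Lie superalgebra, i.e. one can choose complements $V_j$ of $L_{j+1}$ in $L_j$, identified with $\mathfrak{g}_j$, so that under $L=\prod_jV_j=\bar{\mathfrak{g}}$ the bracket of $L$ is that of $\bar{\mathfrak{g}}$). The algebra. Let $\Lambda(n,n)=\mathbb{C}[x_1,\dots,x_n]\otimes\Lambda(\xi_1,\dots,\xi_n)$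 with $x_i$ even and $\xi_i$ odd, with the Buttin bracket $$[f,g]=\sum_{i=1}^n\Big(\frac{\partial f}{\partial x_i}\frac{\partial g}{\partial\xi_i}+(-1)^{p(f)}\frac{\partial f}{\partial\xi_i}\frac{\partial g}{\partial x_i}\Big),$$ where $p(f)$ is the parity in $\Lambda(n,n)$. With reversed parity, $\Lambda(n,n)$ is a Lie superalgebra with center $\mathbb{C}1$, and $HO(n,n)=\Lambda(n,n)/\mathbb{C}1$ (with reversed parity). Put $\Delta=\sum_i\frac{\partial^2}{\partial x_i\partial\xi_i}$, $SHO'(n,n)=\{f\in\Lambda(n,n)/\mathbb{C}1:\Delta f=0\}$, and $SHO(n,n)=[SHO'(n,n),SHO'(n,n)]$, which is the subspace of elements of $SHO'(n,n)$ not containing the monomial $\xi_1\xi_2\cdots\xi_n$. The $\mathbb{Z}$-gradation (of depth $1$) gives a polynomial homogeneous of total degree $d$ in the $x_i,\xi_i$ the degree $d-2$. *)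

theory Defs
  imports Complex_Main "HOL-Library.Z2" "HOL-Library.Poly_Mapping" "HOL-Library.Function_Algebras"
begin

section \<open>Graded and filtered Lie superalgebras\<close>

text \<open>The underlying vector space is a subset \<open>lie_carrier\<close> of an ambient complex vector space
  (a type of class \<open>ab_group_add\<close> with the scalar multiplication \<open>lie_scale\<close>).  The parity is
  an element of \<open>\<int>/2\<close>, i.e. of the type \<open>bit\<close>.\<close>

record 'a superalgebra =
  lie_carrier :: "'a set"
  lie_scale :: "complex \<Rightarrow> 'a \<Rightarrow> 'a"
  lie_part :: "bit \<Rightarrow> 'a set"
  lie_bracket :: "'a \<Rightarrow> 'a \<Rightarrow> 'a"

record 'a graded_superalgebra = "'a superalgebra" +
  grade :: "int \<Rightarrow> 'a set"

record 'a filtered_superalgebra = "'a superalgebra" +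
  filt :: "int \<Rightarrow> 'a set"

definition parity_sign :: "bit \<Rightarrow> bit \<Rightarrow> complex" where
  "parity_sign a b = (if a = 1 \<and> b = 1 then - 1 else 1)"

definition parity_compatible :: "('a::ab_group_add, 'b) superalgebra_scheme \<Rightarrow> 'a set \<Rightarrow> bool" where
  "parity_compatible L W \<longleftrightarrow>
     (\<forall>w\<in>W. \<exists>u\<in>W \<inter> lie_part L 0. \<exists>v\<in>W \<inter> lie_part L 1. w = u + v)"

definition lie_superalgebra :: "('a::ab_group_add, 'b) superalgebra_scheme \<Rightarrow> bool" where
  "lie_superalgebra L \<longleftrightarrow>
     vector_space (lie_scale L) \<and>
     module.subspace (lie_scale L) (lie_carrier L) \<and>
     (\<forall>a. module.subspace (lie_scale L) (lie_part L a) \<and> lie_part L a \<subseteq> lie_carrier L) \<and>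
     lie_part L 0 \<inter> lie_part L 1 = {0} \<and>
     parity_compatible L (lie_carrier L) \<and>
     (\<forall>x\<in>lie_carrier L. \<forall>y\<in>lie_carrier L. \<forall>z\<in>lie_carrier L.
        lie_bracket L (x + y) z = lie_bracket L x z + lie_bracket L y z \<and>
        lie_bracket L z (x + y) = lie_bracket L z x + lie_bracket L z y) \<and>
     (\<forall>c. \<forall>x\<in>lie_carrier L. \<forall>y\<in>lie_carrier L.
        lie_bracket L (lie_scale L c x) y = lie_scale L c (lie_bracket L x y) \<and>
        lie_bracket L x (lie_scale L c y) = lie_scale L c (lie_bracket L x y)) \<and>
     (\<forall>a b. \<forall>x\<in>lie_part L a. \<forall>y\<in>lie_part L b.
        lie_bracket L x y \<in> lie_part L (a + b) \<and>
        lie_bracket L x y = - lie_scale L (parity_sign a b) (lie_bracket L y x)) \<and>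
     (\<forall>a b. \<forall>x\<in>lie_part L a. \<forall>y\<in>lie_part L b. \<forall>z\<in>lie_carrier L.
        lie_bracket L x (lie_bracket L y z) =
          lie_bracket L (lie_bracket L x y) z
          + lie_scale L (parity_sign a b) (lie_bracket L y (lie_bracket L x z)))"

definition filt_complete :: "('a::ab_group_add) filtered_superalgebra \<Rightarrow> bool" where
  "filt_complete L \<longleftrightarrow>
     (\<Inter>j. filt L j) = {0} \<and>
     (\<forall>x :: nat \<Rightarrow> 'a. range x \<subseteq> lie_carrier L \<longrightarrow>
        (\<forall>j. \<exists>N. \<forall>m\<ge>N. \<forall>k\<ge>N. x m - x k \<in> filt L j) \<longrightarrow>
        (\<exists>l\<in>lie_carrier L. \<forall>j. \<exists>N. \<forall>m\<ge>N. x m - l \<in> filt L j))"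

text \<open>A complete filtered Lie superalgebra of depth \<open>h\<close>.  The filtration is indexed by all
  integers, with the convention \<open>L\<^sub>j = L\<close> for \<open>j \<le> -h\<close>.  The next-to-last clause says that
  \<open>L\<^sub>j / L\<^sub>j\<^sub>+\<^sub>1\<close> is spanned by finitely many classes.\<close>

definition filtered_lie_superalgebra :: "nat \<Rightarrow> ('a::ab_group_add) filtered_superalgebra \<Rightarrow> bool" where
  "filtered_lie_superalgebra h L \<longleftrightarrow>
     lie_superalgebra L \<and>
     (\<forall>j \<le> - int h. filt L j = lie_carrier L) \<and>
     (\<forall>j. filt L (j + 1) \<subseteq> filt L j) \<and>
     (\<forall>j. module.subspace (lie_scale L) (filt L j) \<and> parity_compatible L (filt L j)) \<and>
     (\<forall>i j. \<forall>x\<in>filt L i. \<forall>y\<in>filt L j. lie_bracket L x y \<in> filt L (i + j)) \<and>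
     (\<forall>j. \<exists>B. finite B \<and> B \<subseteq> filt L j \<and>
        (\<forall>x\<in>filt L j. \<exists>b\<in>module.span (lie_scale L) B. x - b \<in> filt L (j + 1))) \<and>
     filt_complete L"

text \<open>The class of \<open>x\<close> in the component \<open>L\<^sub>j / L\<^sub>j\<^sub>+\<^sub>1\<close> of the associated graded Lie superalgebra.
  The operations on classes are those induced by representatives.\<close>

definition gr_class :: "('a::ab_group_add) filtered_superalgebra \<Rightarrow> int \<Rightarrow> 'a \<Rightarrow> 'a set" where
  "gr_class L j x = (+) x ` filt L (j + 1)"

definition gr_component :: "('a::ab_group_add) filtered_superalgebra \<Rightarrow> int \<Rightarrow> 'a set set" where
  "gr_component L j = gr_class L j ` filt L j"

text \<open>\<open>\<phi>\<close> is an isomorphism of \<open>\<int>\<close>-graded Lie superalgebras from the associated graded of \<open>L\<close>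
  to \<open>G\<close>, given by its homogeneous components.\<close>

definition gr_isomorphism ::
  "('a::ab_group_add) filtered_superalgebra \<Rightarrow> ('g::ab_group_add) graded_superalgebra
    \<Rightarrow> (int \<Rightarrow> 'a set \<Rightarrow> 'g) \<Rightarrow> bool" where
  "gr_isomorphism L G \<phi> \<longleftrightarrow>
     (\<forall>j. bij_betw (\<phi> j) (gr_component L j) (grade G j)) \<and>
     (\<forall>j. \<forall>x\<in>filt L j. \<forall>y\<in>filt L j.
        \<phi> j (gr_class L j (x + y)) = \<phi> j (gr_class L j x) + \<phi> j (gr_class L j y)) \<and>
     (\<forall>j c. \<forall>x\<in>filt L j.
        \<phi> j (gr_class L j (lie_scale L c x)) = lie_scale G c (\<phi> j (gr_class L j x))) \<and>
     (\<forall>j a. \<phi> j ` gr_class L j ` (filt L j \<inter> lie_part L a) = grade G j \<inter> lie_part G a) \<and>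
     (\<forall>i j. \<forall>x\<in>filt L i. \<forall>y\<in>filt L j.
        \<phi> (i + j) (gr_class L (i + j) (lie_bracket L x y)) =
          lie_bracket G (\<phi> i (gr_class L i x)) (\<phi> j (gr_class L j y)))"

definition filtered_deformation ::
  "nat \<Rightarrow> ('g::ab_group_add) graded_superalgebra \<Rightarrow> ('a::ab_group_add) filtered_superalgebra \<Rightarrow> bool" where
  "filtered_deformation h G L \<longleftrightarrow>
     filtered_lie_superalgebra h L \<and> (\<exists>\<phi>. gr_isomorphism L G \<phi>)"

text \<open>The completion \<open>\<Prod>\<^sub>j G\<^sub>j\<close> of a graded Lie superalgebra of depth \<open>h\<close>.  Since
  \<open>G\<^sub>j = 0\<close> for \<open>j < -h\<close>, only \<open>-h \<le> i \<le> k + h\<close> contribute to the component of degree \<open>k\<close>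
  of a bracket.\<close>

definition completion ::
  "nat \<Rightarrow> ('g::ab_group_add) graded_superalgebra \<Rightarrow> (int \<Rightarrow> 'g) filtered_superalgebra" where
  "completion h G =
     \<lparr> lie_carrier = {f. \<forall>j. f j \<in> grade G j},
       lie_scale = (\<lambda>c f j. lie_scale G c (f j)),
       lie_part = (\<lambda>a. {f. \<forall>j. f j \<in> grade G j \<inter> lie_part G a}),
       lie_bracket = (\<lambda>f g k. \<Sum>i\<in>{- int h .. k + int h}. lie_bracket G (f i) (g (k - i))),
       filt = (\<lambda>j. {f. (\<forall>i. f i \<in> grade G i) \<and> (\<forall>i<j. f i = 0)}) \<rparr>"

definition filtered_isomorphism ::
  "('a::ab_group_add) filtered_superalgebra \<Rightarrow> ('b::ab_group_add) filtered_superalgebra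
    \<Rightarrow> ('a \<Rightarrow> 'b) \<Rightarrow> bool" where
  "filtered_isomorphism L M \<Phi> \<longleftrightarrow>
     bij_betw \<Phi> (lie_carrier L) (lie_carrier M) \<and>
     (\<forall>x\<in>lie_carrier L. \<forall>y\<in>lie_carrier L. \<Phi> (x + y) = \<Phi> x + \<Phi> y) \<and>
     (\<forall>c. \<forall>x\<in>lie_carrier L. \<Phi> (lie_scale L c x) = lie_scale M c (\<Phi> x)) \<and>
     (\<forall>a. \<Phi> ` lie_part L a = lie_part M a) \<and>
     (\<forall>x\<in>lie_carrier L. \<forall>y\<in>lie_carrier L.
        \<Phi> (lie_bracket L x y) = lie_bracket M (\<Phi> x) (\<Phi> y)) \<and>
     (\<forall>j. \<Phi> ` filt L j = filt M j)"

definition trivial_deformation ::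
  "nat \<Rightarrow> ('g::ab_group_add) graded_superalgebra \<Rightarrow> ('a::ab_group_add) filtered_superalgebra \<Rightarrow> bool" where
  "trivial_deformation h G L \<longleftrightarrow> (\<exists>\<Phi>. filtered_isomorphism L (completion h G) \<Phi>)"


section \<open>The Buttin bracket\<close>

text \<open>The pair \<open>(a, I)\<close> stands for the monomial \<open>x\<^sup>a \<xi>\<^sub>I\<close>, where \<open>\<xi>\<^sub>I\<close> is the product of the
  \<open>\<xi>\<^sub>i\<close>, \<open>i \<in> I\<close>, in increasing order of the indices.  The variables have indices in \<open>\<nat>\<close>;
  \<open>Lam n\<close> below is the subspace of polynomials in the variables with indices \<open>1, \<dots>, n\<close>.\<close>

type_synonym super_mono = "(nat \<Rightarrow>\<^sub>0 nat) \<times> nat set"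
type_synonym super_poly = "super_mono \<Rightarrow>\<^sub>0 complex"

definition x_degree :: "(nat \<Rightarrow>\<^sub>0 nat) \<Rightarrow> nat" where
  "x_degree a = (\<Sum>i\<in>Poly_Mapping.keys a. Poly_Mapping.lookup a i)"

definition Lam :: "nat \<Rightarrow> super_poly set" where
  "Lam n = {f. \<forall>(a, I)\<in>Poly_Mapping.keys f. Poly_Mapping.keys a \<subseteq> {1..n} \<and> I \<subseteq> {1..n}}"

definition sp_scale :: "complex \<Rightarrow> super_poly \<Rightarrow> super_poly" where
  "sp_scale c f = Poly_Mapping.map ((*) c) f"

text \<open>The sign in \<open>\<xi>\<^sub>I \<xi>\<^sub>J = \<plusminus> \<xi>\<^sub>I\<^sub>\<union>\<^sub>J\<close> for disjoint \<open>I\<close>, \<open>J\<close> counts the inversions.\<close>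

definition sp_mult :: "super_poly \<Rightarrow> super_poly \<Rightarrow> super_poly" where
  "sp_mult f g =
     (\<Sum>(a, I)\<in>Poly_Mapping.keys f. \<Sum>(b, J)\<in>Poly_Mapping.keys g.
        if I \<inter> J = {}
        then Poly_Mapping.single (a + b, I \<union> J)
               ((- 1) ^ card {(i, j). i \<in> I \<and> j \<in> J \<and> j < i}
                 * Poly_Mapping.lookup f (a, I) * Poly_Mapping.lookup g (b, J))
        else 0)"

definition d_x :: "nat \<Rightarrow> super_poly \<Rightarrow> super_poly" where
  "d_x i f =
     (\<Sum>(a, I)\<in>Poly_Mapping.keys f.
        Poly_Mapping.single (a - Poly_Mapping.single i 1, I)
          (of_nat (Poly_Mapping.lookup a i) * Poly_Mapping.lookup f (a, I)))"

text \<open>The left derivative with respect to \<open>\<xi>\<^sub>i\<close>.\<close>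

definition d_xi :: "nat \<Rightarrow> super_poly \<Rightarrow> super_poly" where
  "d_xi i f =
     (\<Sum>(a, I)\<in>Poly_Mapping.keys f.
        if i \<in> I
        then Poly_Mapping.single (a, I - {i})
               ((- 1) ^ card {j \<in> I. j < i} * Poly_Mapping.lookup f (a, I))
        else 0)"

text \<open>The linear map \<open>f \<mapsto> (-1)\<^sup>p\<^sup>(\<^sup>f\<^sup>) f\<close>.\<close>

definition parity_twist :: "super_poly \<Rightarrow> super_poly" where
  "parity_twist f =
     (\<Sum>(a, I)\<in>Poly_Mapping.keys f.
        Poly_Mapping.single (a, I) ((- 1) ^ card I * Poly_Mapping.lookup f (a, I)))"

definition buttin :: "nat \<Rightarrow> super_poly \<Rightarrow> super_poly \<Rightarrow> super_poly" where
  "buttin n f g =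
     (\<Sum>i\<in>{1..n}. sp_mult (d_x i f) (d_xi i g) + sp_mult (d_xi i (parity_twist f)) (d_x i g))"

definition Delta :: "nat \<Rightarrow> super_poly \<Rightarrow> super_poly" where
  "Delta n f = (\<Sum>i\<in>{1..n}. d_x i (d_xi i f))"


section \<open>The quotient by the constants\<close>

definition const_sp :: "complex \<Rightarrow> super_poly" where
  "const_sp c = Poly_Mapping.single (0, {}) c"

definition const_rel :: "super_poly \<Rightarrow> super_poly \<Rightarrow> bool" where
  "const_rel f g \<longleftrightarrow> (\<exists>c. f = g + const_sp c)"

lemma const_sp_add: "const_sp (c + d) = const_sp c + const_sp d"
  by (simp add: const_sp_def single_add)

lemma const_sp_minus: "const_sp (- c) = - const_sp c"
  by (simp add: const_sp_def single_uminus)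

lemma const_sp_zero: "const_sp 0 = 0"
  by (simp add: const_sp_def)

lemma equivp_const_rel: "equivp const_rel"
proof (rule equivpI)
  show "reflp const_rel"
    by (rule reflpI) (metis add.right_neutral const_rel_def const_sp_zero)
  show "symp const_rel"
    unfolding symp_def const_rel_def by (metis add.assoc add.right_inverse add.right_neutral const_sp_minus)
  show "transp const_rel"
    unfolding transp_def const_rel_def by (metis add.assoc const_sp_add)
qed

lemma sum_keys_superset:
  assumes "finite K" "Poly_Mapping.keys f \<subseteq> K" "\<And>m. F m 0 = 0"
  shows "(\<Sum>m\<in>Poly_Mapping.keys f. F m (Poly_Mapping.lookup f m))
       = (\<Sum>m\<in>K. F m (Poly_Mapping.lookup f m))"
  by (rule sum.mono_neutral_left) (use assms in \<open>auto simp: in_keys_iff\<close>)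

lemma sum_keys_add_const:
  fixes f :: super_poly and F :: "super_mono \<Rightarrow> complex \<Rightarrow> super_poly"
  assumes "\<And>m. F m 0 = 0" and "\<And>c. F (0, {}) c = 0"
  shows "(\<Sum>m\<in>Poly_Mapping.keys (f + const_sp c). F m (Poly_Mapping.lookup (f + const_sp c) m))
       = (\<Sum>m\<in>Poly_Mapping.keys f. F m (Poly_Mapping.lookup f m))"
proof -
  let ?K = "insert (0, {}) (Poly_Mapping.keys f)"
  have sub: "Poly_Mapping.keys (f + const_sp c) \<subseteq> ?K"
    using Poly_Mapping.keys_add[of f "const_sp c"] by (auto simp: const_sp_def split: if_splits)
  have "(\<Sum>m\<in>?K. F m (Poly_Mapping.lookup (f + const_sp c) m)) = (\<Sum>m\<in>?K. F m (Poly_Mapping.lookup f m))"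
    by (rule sum.cong[OF refl])
       (use assms(2) in \<open>auto simp: lookup_add const_sp_def lookup_single when_def\<close>)
  moreover have "(\<Sum>m\<in>Poly_Mapping.keys (f + const_sp c). F m (Poly_Mapping.lookup (f + const_sp c) m))
      = (\<Sum>m\<in>?K. F m (Poly_Mapping.lookup (f + const_sp c) m))"
    by (rule sum_keys_superset) (use sub assms in auto)
  moreover have "(\<Sum>m\<in>Poly_Mapping.keys f. F m (Poly_Mapping.lookup f m))
      = (\<Sum>m\<in>?K. F m (Poly_Mapping.lookup f m))"
    by (rule sum_keys_superset) (use assms in auto)
  ultimately show ?thesis by simp
qed

lemma d_x_add_const: "d_x i (f + const_sp c) = d_x i f"
  using sum_keys_add_const[of "\<lambda>(a, I) r. Poly_Mapping.single (a - Poly_Mapping.single i 1, I)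
          (of_nat (Poly_Mapping.lookup a i) * r)" f c]
  by (simp add: d_x_def case_prod_unfold)

lemma d_xi_add_const: "d_xi i (f + const_sp c) = d_xi i f"
proof -
  define F where "F = (\<lambda>m r. if i \<in> snd m then Poly_Mapping.single (fst m, snd m - {i})
          ((- 1) ^ card {j \<in> snd m. j < i} * r) else (0 :: super_poly))"
  have "d_xi i g = (\<Sum>m\<in>Poly_Mapping.keys g. F m (Poly_Mapping.lookup g m))" for g
    by (simp add: d_xi_def F_def case_prod_unfold cong: if_cong)
  then show ?thesis
    by (simp only:) (rule sum_keys_add_const; simp add: F_def)
qed

lemma lookup_parity_twist:
  "Poly_Mapping.lookup (parity_twist f) (a, I) = (- 1) ^ card I * Poly_Mapping.lookup f (a, I)"
proof -
  have "Poly_Mapping.lookup (parity_twist f) (a, I) =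
      (\<Sum>m\<in>Poly_Mapping.keys f. if m = (a, I) then (- 1) ^ card I * Poly_Mapping.lookup f (a, I) else 0)"
    unfolding parity_twist_def lookup_sum
    by (intro sum.cong refl) (auto simp: lookup_single when_def simp del: Pair_inject split: prod.split; simp)
  then show ?thesis
    by (simp add: sum.delta in_keys_iff)
qed

lemma parity_twist_add_const: "parity_twist (f + const_sp c) = parity_twist f + const_sp c"
  by (rule poly_mapping_eqI)
     (auto simp: lookup_parity_twist lookup_add const_sp_def lookup_single when_def distrib_left split: if_splits)

text \<open>Polynomials modulo constants.  The bracket descends because all derivatives of constants
  vanish.\<close>

quotient_type super_poly_mod = super_poly / const_rel
  by (rule equivp_const_rel)

instantiation super_poly_mod :: ab_group_add
begin

lift_definition zero_super_poly_mod :: super_poly_mod is "0 :: super_poly" .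

lift_definition plus_super_poly_mod :: "super_poly_mod \<Rightarrow> super_poly_mod \<Rightarrow> super_poly_mod"
  is "(+) :: super_poly \<Rightarrow> super_poly \<Rightarrow> super_poly"
proof -
  fix f f' g g' :: super_poly
  assume "const_rel f f'" "const_rel g g'"
  then obtain c d where "f = f' + const_sp c" "g = g' + const_sp d"
    by (auto simp: const_rel_def)
  then have "f + g = (f' + g') + const_sp (c + d)"
    by (simp add: const_sp_add algebra_simps)
  then show "const_rel (f + g) (f' + g')"
    unfolding const_rel_def by blast
qed

lift_definition uminus_super_poly_mod :: "super_poly_mod \<Rightarrow> super_poly_mod"
  is "uminus :: super_poly \<Rightarrow> super_poly"
proof -
  fix f f' :: super_poly
  assume "const_rel f f'"
  then obtain c where "f = f' + const_sp c"
    by (auto simp: const_rel_def)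
  then have "- f = - f' + const_sp (- c)"
    by (simp add: const_sp_minus)
  then show "const_rel (- f) (- f')"
    unfolding const_rel_def by blast
qed

definition minus_super_poly_mod :: "super_poly_mod \<Rightarrow> super_poly_mod \<Rightarrow> super_poly_mod" where
  "minus_super_poly_mod u v = u + - v"

instance
proof
  fix u v w :: super_poly_mod
  show "u + v + w = u + (v + w)"
    by transfer (metis add.assoc equivp_const_rel equivp_reflp)
  show "u + v = v + u"
    by transfer (metis add.commute equivp_const_rel equivp_reflp)
  show "0 + u = u"
    by transfer (metis add_0 equivp_const_rel equivp_reflp)
  show "- u + u = 0"
    by transfer (metis add.left_inverse equivp_const_rel equivp_reflp)
  show "u - v = u + - v"
    by (rule minus_super_poly_mod_def)
qed

end

definition mod_class :: "super_poly \<Rightarrow> super_poly_mod" where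
  "mod_class = abs_super_poly_mod"

lemma lookup_sp_scale: "Poly_Mapping.lookup (sp_scale c f) m = c * Poly_Mapping.lookup f m"
  by (simp add: sp_scale_def Poly_Mapping.map.rep_eq when_def)

lift_definition mod_scale :: "complex \<Rightarrow> super_poly_mod \<Rightarrow> super_poly_mod" is sp_scale
proof -
  fix c and f f' :: super_poly
  assume "const_rel f f'"
  then obtain d where d: "f = f' + const_sp d"
    by (auto simp: const_rel_def)
  have "sp_scale c f = sp_scale c f' + const_sp (c * d)"
    unfolding d const_sp_def
    by (rule poly_mapping_eqI)
       (auto simp: lookup_sp_scale lookup_add lookup_single when_def distrib_left)
  then show "const_rel (sp_scale c f) (sp_scale c f')"
    unfolding const_rel_def by blast
qed

lemma vector_space_mod_scale: "vector_space mod_scale"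
proof
  fix a b and u v :: super_poly_mod
  have eqI: "const_rel f g" if "f = g" for f g
    using that equivp_reflp[OF equivp_const_rel] by simp
  show "mod_scale a (u + v) = mod_scale a u + mod_scale a v"
    by transfer (intro eqI poly_mapping_eqI, simp add: lookup_sp_scale lookup_add distrib_left)
  show "mod_scale (a + b) u = mod_scale a u + mod_scale b u"
    by transfer (intro eqI poly_mapping_eqI, simp add: lookup_sp_scale lookup_add distrib_right)
  show "mod_scale a (mod_scale b u) = mod_scale (a * b) u"
    by transfer (intro eqI poly_mapping_eqI, simp add: lookup_sp_scale mult.assoc)
  show "mod_scale 1 u = u"
    by transfer (intro eqI poly_mapping_eqI, simp add: lookup_sp_scale)
qed

lift_definition mod_buttin :: "nat \<Rightarrow> super_poly_mod \<Rightarrow> super_poly_mod \<Rightarrow> super_poly_mod" is buttin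
proof -
  fix n and f f' g g' :: super_poly
  assume "const_rel f f'" "const_rel g g'"
  then obtain c d where "f = f' + const_sp c" "g = g' + const_sp d"
    by (auto simp: const_rel_def)
  then have "buttin n f g = buttin n f' g'"
    by (simp add: buttin_def d_x_add_const d_xi_add_const parity_twist_add_const)
  then show "const_rel (buttin n f g) (buttin n f' g')"
    by (metis equivp_const_rel equivp_reflp)
qed


section \<open>The Lie superalgebra \<open>SHO(n,n)\<close>\<close>

definition SHO' :: "nat \<Rightarrow> super_poly_mod set" where
  "SHO' n = mod_class ` {f \<in> Lam n. Delta n f = 0}"

definition SHO_space :: "nat \<Rightarrow> super_poly_mod set" where
  "SHO_space n = module.span mod_scale {mod_buttin n u v | u v. u \<in> SHO' n \<and> v \<in> SHO' n}"

text \<open>The parity is reversed: \<open>x\<^sup>a \<xi>\<^sub>I\<close> has parity \<open>|I| + 1\<close>; its degree is \<open>|a| + |I| - 2\<close>.\<close>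

definition SHO :: "nat \<Rightarrow> super_poly_mod graded_superalgebra" where
  "SHO n =
     \<lparr> lie_carrier = SHO_space n,
       lie_scale = mod_scale,
       lie_part = (\<lambda>p. SHO_space n \<inter>
         mod_class ` {f \<in> Lam n. \<forall>(a, I)\<in>Poly_Mapping.keys f. of_nat (card I) + 1 = p}),
       lie_bracket = mod_buttin n,
       grade = (\<lambda>j. SHO_space n \<inter>
         mod_class ` {f \<in> Lam n. \<forall>(a, I)\<in>Poly_Mapping.keys f.
           int (x_degree a) + int (card I) - 2 = j}) \<rparr>"

end

theory Submission
  imports Defs
begin

text \<open>Let \<open>L\<close> be a filtered deformation of \<open>G = SHO(n,n)\<close>, and choose an even linear section \<open>\<sigma>\<close> of the
  projections of \<open>L\<^sub>j\<close> onto \<open>L\<^sub>j / L\<^sub>j\<^sub>+\<^sub>1 = G\<^sub>j\<close>.  The defect \<open>[\<sigma> y, \<sigma> z] - \<sigma> [y, z]\<close> of \<open>\<sigma>\<close> raises the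
  degree, and its leading term, of degree \<open>k > 0\<close>, is an even 2-cocycle of \<open>G\<close> with values in \<open>G\<close>
  (\<open>defect_symbol_cocycle\<close>).  If this cocycle is the coboundary of \<open>\<psi>\<close>, then the defect of
  \<open>\<sigma> - \<sigma> \<circ> \<psi>\<close> starts in a degree larger than \<open>k\<close> (\<open>improve_section\<close>).  So if all even cocycles of
  positive degree are coboundaries, the corrected sections converge by completeness to a section
  without defect, and the expansion of the elements of \<open>L\<close> into series of values of that section
  identifies \<open>L\<close> with the completion of \<open>G\<close>
  (\<open>trivial_deformation_if_no_cohomology\<close>).

  It remains to show that an even cocycle \<open>m\<close> of degree \<open>k > 0\<close> is a coboundary
  (\<open>SHO_no_cohomology\<close>).  The elements of degree \<open>-1\<close> are the coordinates, and they act by the partial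
  derivatives.  Hence the restriction \<open>c\<close> of \<open>m\<close> to degree \<open>-1\<close> is a differential 2-form with polynomial
  coefficients on the superspace of dimension \<open>n|n\<close>, and the cocycle identity says that \<open>c\<close> is closed up
  to the constants, which are divided out in \<open>SHO(n,n)\<close>.  A constant 3-form \<open>dc\<close> can occur only for
  \<open>k = 1\<close>; it is invariant under the elements \<open>x\<^sub>i \<xi>\<^sub>j\<close>, \<open>i \<noteq> j\<close>, and \<open>x\<^sub>i \<xi>\<^sub>i - x\<^sub>j \<xi>\<^sub>j\<close> of degree 0, that is, under
  \<open>sl\<^sub>n\<close>, and for \<open>n \<ge> 3\<close> it has to vanish: by weights it could only pair three of the odd coordinates, for
  \<open>n = 3\<close>, but it is symmetric in these, and the third symmetric power of the standard representation has
  no invariants (\<open>three_form_zero\<close>).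

  By the Poincare lemma \<open>c = dP\<close> for a 1-form \<open>P\<close>.  Its coefficients need not be annihilated by the odd
  Laplacian \<open>\<Delta>\<close>, but the 1-form of the \<open>\<Delta> P\<^sub>v\<close> is closed, hence it is \<open>d\<phi>\<close>, up to signs.  Outside the line
  spanned by \<open>\<xi>\<^sub>1 \<dots> \<xi>\<^sub>n\<close> the complex of \<open>\<Delta>\<close> is exact (\<open>Delta_exact\<close>), so \<open>\<phi> = \<Delta> f\<close>, and subtracting \<open>df\<close>
  from \<open>P\<close> makes all coefficients elements of the kernel of \<open>\<Delta>\<close> (\<open>harmonic_potential_exists\<close>).  This defines
  the desired 1-cochain \<open>\<psi>\<close> in degree \<open>-1\<close>.  In higher degrees the coboundary equation prescribes the
  derivatives of \<open>\<psi> y\<close>; they form a closed 1-form, so that Euler's identity yields \<open>\<psi> y\<close> by induction on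
  the degree of \<open>y\<close> (\<open>prim_correct\<close>).  Finally the difference of \<open>m\<close> and the coboundary of \<open>\<psi>\<close> is a cocycle
  that vanishes if one argument has degree \<open>-1\<close>.  Its values then have zero derivatives, by induction on the
  degree of the arguments, and so it is zero (\<open>remainder_zero\<close>).\<close>

section \<open>Even cochains of a graded Lie superalgebra\<close>

definition grade_linear ::
  "('g::ab_group_add) graded_superalgebra \<Rightarrow> (complex \<Rightarrow> 'b \<Rightarrow> 'b) \<Rightarrow> (int \<Rightarrow> 'g \<Rightarrow> 'b::ab_group_add) \<Rightarrow> bool" where
  "grade_linear G sc T \<longleftrightarrow>
     (\<forall>j. \<forall>x\<in>grade G j. \<forall>y\<in>grade G j. T j (x + y) = T j x + T j y) \<and>
     (\<forall>j c. \<forall>x\<in>grade G j. T j (lie_scale G c x) = sc c (T j x))"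

definition even_1_cochain ::
  "('g::ab_group_add) graded_superalgebra \<Rightarrow> int \<Rightarrow> (int \<Rightarrow> 'g \<Rightarrow> 'g) \<Rightarrow> bool" where
  "even_1_cochain G k \<psi> \<longleftrightarrow>
     grade_linear G (lie_scale G) \<psi> \<and>
     (\<forall>j a. \<forall>y\<in>grade G j \<inter> lie_part G a. \<psi> j y \<in> grade G (j + k) \<inter> lie_part G a)"

text \<open>A cochain of degree \<open>k\<close> is given by its components on \<open>G\<^sub>i \<times> G\<^sub>j\<close>.  The last clause is the
  linearization of the Jacobi identity in Leibniz form, so that no signs other than that of
  exchanging \<open>x\<close> and \<open>y\<close> occur.\<close>

definition even_2_cocycle ::
  "('g::ab_group_add) graded_superalgebra \<Rightarrow> int \<Rightarrow> (int \<Rightarrow> int \<Rightarrow> 'g \<Rightarrow> 'g \<Rightarrow> 'g) \<Rightarrow> bool" where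
  "even_2_cocycle G k \<mu> \<longleftrightarrow>
     (\<forall>i j. \<forall>x\<in>grade G i. \<forall>y\<in>grade G i. \<forall>z\<in>grade G j.
        \<mu> i j (x + y) z = \<mu> i j x z + \<mu> i j y z \<and> \<mu> j i z (x + y) = \<mu> j i z x + \<mu> j i z y) \<and>
     (\<forall>i j c. \<forall>x\<in>grade G i. \<forall>y\<in>grade G j.
        \<mu> i j (lie_scale G c x) y = lie_scale G c (\<mu> i j x y) \<and>
        \<mu> i j x (lie_scale G c y) = lie_scale G c (\<mu> i j x y)) \<and>
     (\<forall>i j a b. \<forall>x\<in>grade G i \<inter> lie_part G a. \<forall>y\<in>grade G j \<inter> lie_part G b.
        \<mu> i j x y \<in> grade G (i + j + k) \<inter> lie_part G (a + b) \<and>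
        \<mu> i j x y = - lie_scale G (parity_sign a b) (\<mu> j i y x)) \<and>
     (\<forall>i j l a b c. \<forall>x\<in>grade G i \<inter> lie_part G a. \<forall>y\<in>grade G j \<inter> lie_part G b.
        \<forall>z\<in>grade G l \<inter> lie_part G c.
        lie_bracket G x (\<mu> j l y z) + \<mu> i (j + l) x (lie_bracket G y z) =
          lie_bracket G (\<mu> i j x y) z + \<mu> (i + j) l (lie_bracket G x y) z
          + lie_scale G (parity_sign a b)
              (lie_bracket G y (\<mu> i l x z) + \<mu> j (i + l) y (lie_bracket G x z)))"

definition is_coboundary_of ::
  "('g::ab_group_add) graded_superalgebra \<Rightarrow> (int \<Rightarrow> int \<Rightarrow> 'g \<Rightarrow> 'g \<Rightarrow> 'g) \<Rightarrow> (int \<Rightarrow> 'g \<Rightarrow> 'g) \<Rightarrow> bool" where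
  "is_coboundary_of G \<mu> \<psi> \<longleftrightarrow>
     (\<forall>i j a b. \<forall>x\<in>grade G i \<inter> lie_part G a. \<forall>y\<in>grade G j \<inter> lie_part G b.
        \<mu> i j x y = lie_bracket G x (\<psi> j y) + lie_bracket G (\<psi> i x) y - \<psi> (i + j) (lie_bracket G x y))"

text \<open>The Jacobi identity of \<open>G\<close> alone; for the associated graded algebra of a filtered Lie
  superalgebra it is inherited, see \<open>G_jacobi\<close> below.\<close>

definition graded_jacobi :: "('g::ab_group_add) graded_superalgebra \<Rightarrow> bool" where
  "graded_jacobi G \<longleftrightarrow>
     (\<forall>i j l a b c. \<forall>x\<in>grade G i \<inter> lie_part G a. \<forall>y\<in>grade G j \<inter> lie_part G b.
        \<forall>z\<in>grade G l \<inter> lie_part G c.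
        lie_bracket G x (lie_bracket G y z) =
          lie_bracket G (lie_bracket G x y) z
          + lie_scale G (parity_sign a b) (lie_bracket G y (lie_bracket G x z)))"

section \<open>Deformations of a graded Lie superalgebra without positive cohomology\<close>

locale graded_deformation =
  fixes h :: nat and G :: "('g::ab_group_add) graded_superalgebra"
    and L :: "('a::ab_group_add) filtered_superalgebra" and \<phi> :: "int \<Rightarrow> 'a set \<Rightarrow> 'g"
  assumes filtered: "filtered_lie_superalgebra h L"
    and iso: "gr_isomorphism L G \<phi>"
    and vsG: "vector_space (lie_scale G)"
begin

abbreviation "F \<equiv> filt L"
abbreviation "bl \<equiv> lie_bracket L"
abbreviation "bg \<equiv> lie_bracket G"
abbreviation "sL \<equiv> lie_scale L"
abbreviation "sG \<equiv> lie_scale G"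
abbreviation "gr \<equiv> grade G"
abbreviation "gp j a \<equiv> grade G j \<inter> lie_part G a"
abbreviation "Fp j a \<equiv> filt L j \<inter> lie_part L a"

lemma lieL: "lie_superalgebra L"
  using filtered by (simp add: filtered_lie_superalgebra_def)

lemma vsL: "vector_space (lie_scale L)"
  using lieL by (simp add: lie_superalgebra_def)

sublocale VG: vector_space "lie_scale G" by (rule vsG)
sublocale VL: vector_space "lie_scale L" by (rule vsL)
sublocale VGL: vector_space_pair "lie_scale G" "lie_scale L" ..

definition symbol :: "int \<Rightarrow> 'a \<Rightarrow> 'g" where
  "symbol j x = \<phi> j (gr_class L j x)"

subsection \<open>The filtration and the symbol maps\<close>

lemma F_subspace: "VL.subspace (F j)" and F_parity: "parity_compatible L (F j)"
  using filtered by (auto simp: filtered_lie_superalgebra_def)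

lemmas F_closed = VL.subspace_add[OF F_subspace] VL.subspace_diff[OF F_subspace]
  VL.subspace_scale[OF F_subspace] VL.subspace_0[OF F_subspace] VL.subspace_neg[OF F_subspace]
  VL.subspace_sum[OF F_subspace]

lemma F_step: "F (j + 1) \<subseteq> F j"
  using filtered by (auto simp: filtered_lie_superalgebra_def)

lemma F_antimono: "i \<le> j \<Longrightarrow> F j \<subseteq> F i"
  by (induction j rule: int_ge_induct) (use F_step in auto)

lemma F_low: "j \<le> - int h \<Longrightarrow> F j = lie_carrier L"
  using filtered by (auto simp: filtered_lie_superalgebra_def)

lemma F_carrier: "x \<in> F j \<Longrightarrow> x \<in> lie_carrier L"
  using F_antimono[of "min j (- int h)" j] F_low[of "min j (- int h)"] by auto

lemma F_bracket: "x \<in> F i \<Longrightarrow> y \<in> F j \<Longrightarrow> m = i + j \<Longrightarrow> bl x y \<in> F m"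
  using filtered by (auto simp: filtered_lie_superalgebra_def)

lemmas L_axioms = lieL[unfolded lie_superalgebra_def]

lemma L_part_subspace: "VL.subspace (lie_part L a)"
  and L_part_carrier: "x \<in> lie_part L a \<Longrightarrow> x \<in> lie_carrier L"
  using L_axioms[THEN conjunct2, THEN conjunct2, THEN conjunct1] by auto

lemma L_part_disjoint: "x \<in> lie_part L 0 \<Longrightarrow> x \<in> lie_part L 1 \<Longrightarrow> x = 0"
  using L_axioms[THEN conjunct2, THEN conjunct2, THEN conjunct2, THEN conjunct1] by auto

lemma L_add:
  assumes "x \<in> lie_carrier L" "y \<in> lie_carrier L" "z \<in> lie_carrier L"
  shows "bl (x + y) z = bl x z + bl y z" "bl z (x + y) = bl z x + bl z y"
  using L_axioms[THEN conjunct2, THEN conjunct2, THEN conjunct2, THEN conjunct2, THEN conjunct2,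
      THEN conjunct1, rule_format, OF assms] by simp_all

lemma L_scale:
  assumes "x \<in> lie_carrier L" "y \<in> lie_carrier L"
  shows "bl (sL c x) y = sL c (bl x y)" "bl x (sL c y) = sL c (bl x y)"
  using L_axioms[THEN conjunct2, THEN conjunct2, THEN conjunct2, THEN conjunct2, THEN conjunct2,
      THEN conjunct2, THEN conjunct1, rule_format, OF assms] by simp_all

lemma
  assumes "x \<in> lie_part L a" "y \<in> lie_part L b"
  shows L_part_bracket: "bl x y \<in> lie_part L (a + b)"
    and L_skew: "bl x y = - sL (parity_sign a b) (bl y x)"
  using L_axioms[THEN conjunct2, THEN conjunct2, THEN conjunct2, THEN conjunct2, THEN conjunct2,
      THEN conjunct2, THEN conjunct2, THEN conjunct1, rule_format, OF assms] by blast+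

lemma L_jacobi:
  assumes "x \<in> lie_part L a" "y \<in> lie_part L b" "z \<in> lie_carrier L"
  shows "bl x (bl y z) = bl (bl x y) z + sL (parity_sign a b) (bl y (bl x z))"
  using L_axioms[THEN conjunct2, THEN conjunct2, THEN conjunct2, THEN conjunct2, THEN conjunct2,
      THEN conjunct2, THEN conjunct2, THEN conjunct2, rule_format, OF assms] .

lemmas L_part_closed = VL.subspace_add[OF L_part_subspace] VL.subspace_diff[OF L_part_subspace]
  VL.subspace_scale[OF L_part_subspace] VL.subspace_0[OF L_part_subspace]
  VL.subspace_neg[OF L_part_subspace]

lemma carrier_subspace: "VL.subspace (lie_carrier L)"
  using F_subspace[of "- int h"] F_low[of "- int h"] by simp

lemmas carrier_closed = VL.subspace_add[OF carrier_subspace] VL.subspace_diff[OF carrier_subspace]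
  VL.subspace_scale[OF carrier_subspace] VL.subspace_0[OF carrier_subspace]
  VL.subspace_sum[OF carrier_subspace]

lemma carrier_bracket: "x \<in> lie_carrier L \<Longrightarrow> y \<in> lie_carrier L \<Longrightarrow> bl x y \<in> lie_carrier L"
  using F_bracket[of x "- int h" y "- int h" "- int h - int h"] F_low[OF order.refl]
    F_carrier[of "bl x y" "- int h - int h"] by simp

lemma L_diff:
  assumes "x \<in> lie_carrier L" "y \<in> lie_carrier L" "z \<in> lie_carrier L"
  shows "bl (x - y) z = bl x z - bl y z" "bl z (x - y) = bl z x - bl z y"
  using L_add[of "x - y" y z] assms carrier_closed(2)[of x y] by (simp_all add: eq_diff_eq)

lemma L_zero: "x \<in> lie_carrier L \<Longrightarrow> bl 0 x = 0" "x \<in> lie_carrier L \<Longrightarrow> bl x 0 = 0"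
  using L_diff[of x x x] by simp_all

lemma separated: "(\<And>j. x \<in> F j) \<Longrightarrow> x = 0"
  using filtered by (auto simp: filtered_lie_superalgebra_def filt_complete_def)

lemma F_decompose: "x \<in> F j \<Longrightarrow> \<exists>u\<in>Fp j 0. \<exists>v\<in>Fp j 1. x = u + v"
  using F_parity[of j] unfolding parity_compatible_def by blast

text \<open>As \<open>F j\<close> is the sum of its even and its odd part and the decomposition is unique, it contains the
  components of its elements.\<close>

lemma F_part_of_sum:
  assumes "u + v \<in> F j" "u \<in> lie_part L a" "v \<in> lie_part L (a + 1)"
  shows "u \<in> F j" "v \<in> F j"
proof -
  obtain u' v' where uv: "u' \<in> F j" "u' \<in> lie_part L 0" "v' \<in> F j" "v' \<in> lie_part L 1" "u + v = u' + v'"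
    using F_decompose[OF assms(1)] by auto
  have "u \<in> F j \<and> v \<in> F j"
  proof (cases "a = 0")
    case True
    have "u - u' = v' - v" using uv(5) by (simp add: algebra_simps)
    moreover have "u \<in> lie_part L 0" "v \<in> lie_part L 1"
      using assms True by simp_all
    ultimately have "u - u' = 0"
      using L_part_disjoint[of "u - u'"] L_part_closed(2) uv by metis
    then show ?thesis using uv by auto
  next
    case False
    have "v - u' = v' - u" using uv(5) by (simp add: algebra_simps)
    moreover have "v \<in> lie_part L 0" "u \<in> lie_part L 1"
      using assms False by simp_all
    ultimately have "v - u' = 0"
      using L_part_disjoint[of "v - u'"] L_part_closed(2) uv by metis
    then show ?thesis using uv by auto
  qed
  then show "u \<in> F j" "v \<in> F j" by auto
qed

lemma symbol_add: "x \<in> F j \<Longrightarrow> y \<in> F j \<Longrightarrow> symbol j (x + y) = symbol j x + symbol j y"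
  and symbol_scale: "x \<in> F j \<Longrightarrow> symbol j (sL c x) = sG c (symbol j x)"
  and symbol_bracket: "x \<in> F i \<Longrightarrow> y \<in> F j \<Longrightarrow> m = i + j \<Longrightarrow> symbol m (bl x y) = bg (symbol i x) (symbol j y)"
  and symbol_parts: "symbol j ` Fp j a = gp j a"
  using iso by (auto simp: gr_isomorphism_def symbol_def image_image)

lemma symbol_surj: "symbol j ` F j = gr j"
proof -
  have "bij_betw (\<phi> j) (gr_component L j) (gr j)"
    using iso by (auto simp: gr_isomorphism_def)
  then show ?thesis
    by (auto simp: bij_betw_def gr_component_def symbol_def image_image)
qed

lemma symbol_0: "symbol j 0 = 0"
  using symbol_add[of 0 j 0] F_closed(4) by simp

lemma symbol_diff: "x \<in> F j \<Longrightarrow> y \<in> F j \<Longrightarrow> symbol j (x - y) = symbol j x - symbol j y"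
  using symbol_add[of "x - y" j y] F_closed(2)[of x j y] by (simp add: algebra_simps)

lemma symbol_eq_0_iff:
  assumes "x \<in> F j"
  shows "symbol j x = 0 \<longleftrightarrow> x \<in> F (j + 1)"
proof
  assume "symbol j x = 0"
  moreover have "inj_on (\<phi> j) (gr_component L j)"
    using iso by (auto simp: gr_isomorphism_def bij_betw_def)
  ultimately have "gr_class L j x = gr_class L j 0"
    using assms F_closed(4) symbol_0[of j] unfolding symbol_def gr_component_def inj_on_def by force
  moreover have "x \<in> gr_class L j x"
    using F_closed(4)[of "j + 1"] by (force simp: gr_class_def)
  ultimately show "x \<in> F (j + 1)"
    by (simp add: gr_class_def)
next
  assume x: "x \<in> F (j + 1)"
  have "gr_class L j x = gr_class L j 0"
  proof
    show "gr_class L j x \<subseteq> gr_class L j 0"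
      using x F_closed(1) by (auto simp: gr_class_def)
    show "gr_class L j 0 \<subseteq> gr_class L j x"
    proof
      fix y assume "y \<in> gr_class L j 0"
      then have "y - x \<in> F (j + 1)" using x F_closed(2) by (auto simp: gr_class_def)
      then show "y \<in> gr_class L j x" unfolding gr_class_def by (intro image_eqI[of _ _ "y - x"]) auto
    qed
  qed
  then show "symbol j x = 0" using symbol_0[of j] by (simp add: symbol_def)
qed

text \<open>The following properties of \<open>G\<close> as a graded Lie superalgebra are inherited from \<open>L\<close>
  through the symbol maps.\<close>

lemma gr_subspace: "VG.subspace (gr j)"
  unfolding VG.subspace_def
proof (intro conjI ballI allI)
  show "0 \<in> gr j" using symbol_surj[of j] symbol_0[of j] F_closed(4)[of j] by (metis imageI)
  fix x assume "x \<in> gr j"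
  then obtain x' where x': "x = symbol j x'" "x' \<in> F j" using symbol_surj[of j] by auto
  show "sG c x \<in> gr j" for c
    using symbol_scale[OF x'(2)] x' symbol_surj[of j] F_closed(3) by (metis imageI)
  fix y assume "y \<in> gr j"
  then obtain y' where y': "y = symbol j y'" "y' \<in> F j" using symbol_surj[of j] by auto
  show "x + y \<in> gr j"
    using symbol_add[OF x'(2) y'(2)] x' y' symbol_surj[of j] F_closed(1) by (metis imageI)
qed

lemma gp_subspace: "VG.subspace (gp j a)"
  unfolding VG.subspace_def
proof (intro conjI ballI allI)
  have *: "symbol j z \<in> gp j a" if "z \<in> Fp j a" for z
    using symbol_parts[of j a] that by auto
  show "0 \<in> gp j a" using *[of 0] F_closed(4) L_part_closed(4) symbol_0 by auto
  fix x assume "x \<in> gp j a"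
  then obtain x' where x': "x = symbol j x'" "x' \<in> Fp j a" using symbol_parts[of j a] by blast
  show "sG c x \<in> gp j a" for c
    using *[of "sL c x'"] symbol_scale[of x' j c] x' F_closed(3) L_part_closed(3) by auto
  fix y assume "y \<in> gp j a"
  then obtain y' where y': "y = symbol j y'" "y' \<in> Fp j a" using symbol_parts[of j a] by blast
  show "x + y \<in> gp j a"
    using *[of "x' + y'"] symbol_add[of x' j y'] x' y' F_closed(1) L_part_closed(1) by auto
qed

lemmas gr_closed = VG.subspace_add[OF gr_subspace] VG.subspace_diff[OF gr_subspace]
  VG.subspace_scale[OF gr_subspace] VG.subspace_0[OF gr_subspace] VG.subspace_sum[OF gr_subspace]

lemmas gp_closed = VG.subspace_add[OF gp_subspace] VG.subspace_diff[OF gp_subspace]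
  VG.subspace_scale[OF gp_subspace] VG.subspace_0[OF gp_subspace]

lemma gr_low: "j < - int h \<Longrightarrow> x \<in> gr j \<Longrightarrow> x = 0"
  using symbol_surj[of j] symbol_eq_0_iff[of _ j] F_low[of j] F_low[of "j + 1"] by auto

lemma gr_decompose: "x \<in> gr j \<Longrightarrow> \<exists>u\<in>gp j 0. \<exists>v\<in>gp j 1. x = u + v"
proof -
  assume "x \<in> gr j"
  then obtain x' where x': "x = symbol j x'" "x' \<in> F j" using symbol_surj[of j] by auto
  moreover obtain u v where uv: "u \<in> Fp j 0" "v \<in> Fp j 1" "x' = u + v"
    using F_decompose[OF \<open>x' \<in> F j\<close>] by auto
  ultimately have "x = symbol j u + symbol j v"
    using symbol_add[of u j v] by simp
  moreover have "symbol j u \<in> gp j 0" "symbol j v \<in> gp j 1"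
    using uv unfolding symbol_parts[symmetric] by blast+
  ultimately show ?thesis by blast
qed

lemma gp_disjoint: "x \<in> gp j 0 \<Longrightarrow> x \<in> gp j 1 \<Longrightarrow> x = 0"
proof -
  assume "x \<in> gp j 0" "x \<in> gp j 1"
  then obtain u v where uv: "x = symbol j u" "u \<in> Fp j 0" "x = symbol j v" "v \<in> Fp j 1"
    using symbol_parts[of j 0] symbol_parts[of j 1] by blast
  have "symbol j (u - v) = 0" using uv symbol_diff[of u j v] by simp
  moreover have "u - v \<in> F j" using uv F_closed(2) by blast
  ultimately have "u + - v \<in> F (j + 1)"
    using symbol_eq_0_iff by simp
  moreover have "- v \<in> lie_part L (0 + 1)" using uv L_part_closed(5)[of v 1] by simp
  ultimately have "u \<in> F (j + 1)"
    using F_part_of_sum(1)[of u "- v" "j + 1" 0] uv by blast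
  then have "symbol j u = 0" using uv(2) symbol_eq_0_iff[of u j] by blast
  then show "x = 0" using uv(1) by simp
qed

lemma gr_lift: "x \<in> gr j \<Longrightarrow> \<exists>x'. x' \<in> F j \<and> x = symbol j x'"
  unfolding symbol_surj[symmetric] by blast

lemma gp_lift: "x \<in> gp j a \<Longrightarrow> \<exists>x'. x' \<in> F j \<and> x' \<in> lie_part L a \<and> x = symbol j x'"
  unfolding symbol_parts[symmetric] by blast

lemma gr_bracket:
  assumes "x \<in> gr i" "y \<in> gr j" "m = i + j"
  shows "bg x y \<in> gr m"
proof -
  obtain x' y' where "x' \<in> F i" "x = symbol i x'" "y' \<in> F j" "y = symbol j y'"
    using gr_lift[OF assms(1)] gr_lift[OF assms(2)] by auto
  then have "symbol m (bl x' y') = bg x y" "bl x' y' \<in> F m"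
    using assms(3) F_bracket symbol_bracket by auto
  then show ?thesis using symbol_surj[of m] by (metis imageI)
qed

lemma gp_bracket:
  assumes "x \<in> gp i a" "y \<in> gp j b" "m = i + j"
  shows "bg x y \<in> gp m (a + b)"
proof -
  obtain x' y' where "x' \<in> F i" "x' \<in> lie_part L a" "x = symbol i x'"
    "y' \<in> F j" "y' \<in> lie_part L b" "y = symbol j y'"
    using gp_lift[OF assms(1)] gp_lift[OF assms(2)] by blast
  then show ?thesis
    using symbol_bracket[of x' i y' j m] F_bracket[of x' i y' j m] L_part_bracket[of x' a y' b]
      symbol_parts[of m "a + b"] assms(3) by (metis (no_types) IntI imageI)
qed

lemma G_add:
  assumes "x \<in> gr i" "y \<in> gr i" "z \<in> gr j"
  shows "bg (x + y) z = bg x z + bg y z" "bg z (x + y) = bg z x + bg z y"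
proof -
  obtain x' y' z' where l: "x' \<in> F i" "x = symbol i x'" "y' \<in> F i" "y = symbol i y'"
    "z' \<in> F j" "z = symbol j z'"
    using gr_lift[OF assms(1)] gr_lift[OF assms(2)] gr_lift[OF assms(3)] by blast
  then have c: "x' \<in> lie_carrier L" "y' \<in> lie_carrier L" "z' \<in> lie_carrier L" using F_carrier by auto
  have "bg (x + y) z = symbol (i + j) (bl (x' + y') z')"
    using l by (simp add: symbol_bracket[of _ i _ j] symbol_add F_closed)
  also have "\<dots> = bg x z + bg y z"
    using l c by (simp add: L_add symbol_add F_bracket[of _ i _ j] symbol_bracket[of _ i _ j])
  finally show "bg (x + y) z = bg x z + bg y z" .
  have "bg z (x + y) = symbol (j + i) (bl z' (x' + y'))"
    using l by (simp add: symbol_bracket[of _ j _ i] symbol_add F_closed)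
  also have "\<dots> = bg z x + bg z y"
    using l c by (simp add: L_add symbol_add F_bracket[of _ j _ i] symbol_bracket[of _ j _ i])
  finally show "bg z (x + y) = bg z x + bg z y" .
qed

lemma G_scale:
  assumes "x \<in> gr i" "y \<in> gr j"
  shows "bg (sG c x) y = sG c (bg x y)" "bg x (sG c y) = sG c (bg x y)"
proof -
  obtain x' y' where l: "x' \<in> F i" "x = symbol i x'" "y' \<in> F j" "y = symbol j y'"
    using gr_lift[OF assms(1)] gr_lift[OF assms(2)] by blast
  then have c: "x' \<in> lie_carrier L" "y' \<in> lie_carrier L" using F_carrier by auto
  have "bg (sG c x) y = symbol (i + j) (bl (sL c x') y')" "bg x (sG c y) = symbol (i + j) (bl x' (sL c y'))"
    using l by (simp_all add: symbol_bracket[of _ i _ j] symbol_scale F_closed)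
  then show "bg (sG c x) y = sG c (bg x y)" "bg x (sG c y) = sG c (bg x y)"
    using l c by (simp_all add: L_scale symbol_scale F_bracket[of _ i _ j] symbol_bracket[of _ i _ j])
qed

lemma G_skew:
  assumes "x \<in> gp i a" "y \<in> gp j b"
  shows "bg x y = - sG (parity_sign a b) (bg y x)"
proof -
  obtain x' y' where l: "x' \<in> F i" "x' \<in> lie_part L a" "x = symbol i x'"
    "y' \<in> F j" "y' \<in> lie_part L b" "y = symbol j y'"
    using gp_lift[OF assms(1)] gp_lift[OF assms(2)] by blast
  have "bg x y = symbol (i + j) (- sL (parity_sign a b) (bl y' x'))"
    using l symbol_bracket[of x' i y' j "i + j"] L_skew[of x' a y' b] by simp
  also have "\<dots> = symbol (i + j) (0 - sL (parity_sign a b) (bl y' x'))" by simp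
  also have "\<dots> = - sG (parity_sign a b) (bg y x)"
    using l symbol_diff[of 0 "i + j" "sL (parity_sign a b) (bl y' x')"]
      symbol_scale[of "bl y' x'" "i + j"] F_bracket[of y' j x' i "i + j"] symbol_bracket[of y' j x' i "i + j"]
    by (simp add: F_closed symbol_0)
  finally show ?thesis .
qed

lemma G_jacobi: "graded_jacobi G"
  unfolding graded_jacobi_def
proof (intro allI ballI)
  fix i j l a b c x y z
  assume xyz: "x \<in> gp i a" "y \<in> gp j b" "z \<in> gp l c"
  obtain x' y' z' where *: "x' \<in> F i" "x' \<in> lie_part L a" "x = symbol i x'"
    "y' \<in> F j" "y' \<in> lie_part L b" "y = symbol j y'" "z' \<in> F l" "z = symbol l z'"
    using gp_lift[OF xyz(1)] gp_lift[OF xyz(2)] gp_lift[OF xyz(3)] by blast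
  let ?m = "i + j + l"
  have "bg x (bg y z) = symbol ?m (bl x' (bl y' z'))"
    using * symbol_bracket[of x' i "bl y' z'" "j + l" ?m] symbol_bracket[of y' j z' l "j + l"]
      F_bracket[of y' j z' l "j + l"] by simp
  also have "\<dots> = symbol ?m (bl (bl x' y') z' + sL (parity_sign a b) (bl y' (bl x' z')))"
    using * F_carrier by (subst L_jacobi[of x' a y' b]) auto
  also have "\<dots> = symbol ?m (bl (bl x' y') z') + sG (parity_sign a b) (symbol ?m (bl y' (bl x' z')))"
  proof -
    have "bl (bl x' y') z' \<in> F ?m" "bl y' (bl x' z') \<in> F ?m"
      using * F_bracket[of "bl x' y'" "i + j" z' l ?m] F_bracket[of x' i y' j "i + j"]
        F_bracket[of y' j "bl x' z'" "i + l" ?m] F_bracket[of x' i z' l "i + l"] by auto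
    then show ?thesis by (simp add: symbol_add symbol_scale F_closed)
  qed
  also have "\<dots> = bg (bg x y) z + sG (parity_sign a b) (bg y (bg x z))"
    using * symbol_bracket[of "bl x' y'" "i + j" z' l ?m] symbol_bracket[of x' i y' j "i + j"]
      F_bracket[of x' i y' j "i + j"] symbol_bracket[of y' j "bl x' z'" "i + l" ?m]
      symbol_bracket[of x' i z' l "i + l"] F_bracket[of x' i z' l "i + l"] by simp
  finally show "bg x (bg y z) = bg (bg x y) z + sG (parity_sign a b) (bg y (bg x z))" .
qed

subsection \<open>Even linear sections of the symbol maps\<close>

definition even_section :: "(int \<Rightarrow> 'g \<Rightarrow> 'a) \<Rightarrow> bool" where
  "even_section \<sigma> \<longleftrightarrow>
     grade_linear G sL \<sigma> \<and>
     (\<forall>j a. \<forall>y\<in>gp j a. \<sigma> j y \<in> Fp j a) \<and>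
     (\<forall>j. \<forall>y\<in>gr j. symbol j (\<sigma> j y) = y)"

lemma gp_disjoint': "x \<in> gp j a \<Longrightarrow> x \<in> gp j (a + 1) \<Longrightarrow> x = 0"
  using gp_disjoint[of x j] by (cases "a = 0") auto

lemma gr_decompose': "x \<in> gr j \<Longrightarrow> \<exists>u\<in>gp j a. \<exists>v\<in>gp j (a + 1). x = u + v"
  using gr_decompose[of x j] by (cases "a = 0") (auto, metis IntI add.commute)

definition parity_proj :: "int \<Rightarrow> bit \<Rightarrow> 'g \<Rightarrow> 'g" where
  "parity_proj j a y = (THE u. u \<in> gp j a \<and> y - u \<in> gp j (a + 1))"

lemma parity_proj_eq:
  assumes "u \<in> gp j a" "v \<in> gp j (a + 1)"
  shows "parity_proj j a (u + v) = u"
  unfolding parity_proj_def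
proof (rule the_equality)
  show "u \<in> gp j a \<and> u + v - u \<in> gp j (a + 1)" using assms by simp
  fix w assume w: "w \<in> gp j a \<and> u + v - w \<in> gp j (a + 1)"
  then have "u - w \<in> gp j a" using assms gp_closed(2) by blast
  moreover have "(u + v - w) - v \<in> gp j (a + 1)" using w assms gp_closed(2) by blast
  then have "u - w \<in> gp j (a + 1)" by (simp add: algebra_simps)
  ultimately show "w = u" using gp_disjoint'[of "u - w" j a] by simp
qed

text \<open>The section is defined by lifting a basis.\<close>

lemma component_section:
  "\<exists>s. Vector_Spaces.linear sG sL s \<and> (\<forall>y\<in>gp j a. s y \<in> Fp j a \<and> symbol j (s y) = y)"
proof -
  obtain B where B: "B \<subseteq> gp j a" "VG.independent B" "gp j a \<subseteq> VG.span B"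
    by (rule VG.basis_exists)
  have "\<forall>b\<in>B. \<exists>x. x \<in> Fp j a \<and> symbol j x = b"
    using gp_lift B(1) by blast
  then obtain f where f: "\<forall>b\<in>B. f b \<in> Fp j a \<and> symbol j (f b) = b"
    by (rule bchoice[THEN exE])
  define s where "s = VGL.construct B f"
  have lin: "Vector_Spaces.linear sG sL s"
    unfolding s_def by (rule VGL.linear_construct[OF B(2)])
  interpret s: Vector_Spaces.linear sG sL s by (rule lin)
  have "s y \<in> Fp j a \<and> symbol j (s y) = y" if "y \<in> VG.span B" for y
    using that
  proof (rule VG.span_induct)
    show "VG.subspace {y. s y \<in> Fp j a \<and> symbol j (s y) = y}"
      unfolding VG.subspace_def
      by (auto simp: s.add s.scale symbol_add symbol_scale symbol_0 F_closed L_part_closed)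
    show "s b \<in> Fp j a \<and> symbol j (s b) = b" if "b \<in> B" for b
      using f that VGL.construct_basis[OF B(2) that] by (simp add: s_def)
  qed
  then show ?thesis using lin B(3) by blast
qed

lemma even_section_exists: "\<exists>\<sigma>. even_section \<sigma>"
proof -
  obtain s where s: "\<And>j a. Vector_Spaces.linear sG sL (s j a)"
    "\<And>j a y. y \<in> gp j a \<Longrightarrow> s j a y \<in> Fp j a \<and> symbol j (s j a y) = y"
    using component_section by metis
  have s_add: "s j a (x + y) = s j a x + s j a y" and s_scale: "s j a (sG c x) = sL c (s j a x)"
    and s_0: "s j a 0 = 0" for j a x y c
  proof -
    interpret Vector_Spaces.linear sG sL "s j a" by (rule s(1))
    show "s j a (x + y) = s j a x + s j a y" "s j a (sG c x) = sL c (s j a x)" "s j a 0 = 0"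
      by (rule add scale zero)+
  qed
  define \<sigma> where "\<sigma> j y = s j 0 (parity_proj j 0 y) + s j 1 (parity_proj j 1 y)" for j y
  have \<sigma>: "\<sigma> j (u + v) = s j 0 u + s j 1 v" if "u \<in> gp j 0" "v \<in> gp j 1" for j u v
    using parity_proj_eq[of u j 0 v] parity_proj_eq[of v j 1 u] that
    by (simp add: \<sigma>_def add.commute[of u v])
  have "even_section \<sigma>"
    unfolding even_section_def grade_linear_def
  proof (intro conjI allI ballI)
    fix j x assume "x \<in> gr j"
    then obtain u v where uv: "u \<in> gp j 0" "v \<in> gp j 1" "x = u + v" using gr_decompose by blast
    show "\<sigma> j (sG c x) = sL c (\<sigma> j x)" for c
      using \<sigma>[OF gp_closed(3)[OF uv(1), of c] gp_closed(3)[OF uv(2), of c]] \<sigma>[OF uv(1,2)] uv(3)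
      by (simp add: VG.scale_right_distrib VL.scale_right_distrib s_scale)
    have "s j 0 u \<in> F j" "s j 1 v \<in> F j" "symbol j (s j 0 u) = u" "symbol j (s j 1 v) = v"
      using s(2) uv by auto
    then show "symbol j (\<sigma> j x) = x"
      using \<sigma>[of u j v] uv by (simp add: symbol_add)
    fix y assume "y \<in> gr j"
    then obtain u' v' where uv': "u' \<in> gp j 0" "v' \<in> gp j 1" "y = u' + v'" using gr_decompose by blast
    have "x + y = (u + u') + (v + v')" using uv uv' by (simp add: algebra_simps)
    moreover have "u + u' \<in> gp j 0" "v + v' \<in> gp j 1" using uv uv' gp_closed(1) by blast+
    ultimately have "\<sigma> j (x + y) = s j 0 (u + u') + s j 1 (v + v')"
      using \<sigma> by presburger
    then show "\<sigma> j (x + y) = \<sigma> j x + \<sigma> j y"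
      using \<sigma>[OF uv(1,2)] \<sigma>[OF uv'(1,2)] uv(3) uv'(3) by (simp add: s_add)
  next
    fix j a y assume y: "y \<in> gp j a"
    show "\<sigma> j y \<in> Fp j a"
    proof (cases "a = 0")
      case True
      then show ?thesis using y \<sigma>[of y j 0] s(2)[of y j 0] gp_closed(4) s_0 by simp
    next
      case False
      then show ?thesis using y \<sigma>[of 0 j y] s(2)[of y j 1] gp_closed(4) s_0 by simp
    qed
  qed
  then show ?thesis by blast
qed

context
  fixes \<sigma> assumes \<sigma>: "even_section \<sigma>"
begin

lemma section_add: "x \<in> gr j \<Longrightarrow> y \<in> gr j \<Longrightarrow> \<sigma> j (x + y) = \<sigma> j x + \<sigma> j y"
  and section_scale: "x \<in> gr j \<Longrightarrow> \<sigma> j (sG c x) = sL c (\<sigma> j x)"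
  and section_symbol: "x \<in> gr j \<Longrightarrow> symbol j (\<sigma> j x) = x"
  using \<sigma> by (auto simp: even_section_def grade_linear_def)

lemma section_part: "x \<in> gp j a \<Longrightarrow> \<sigma> j x \<in> lie_part L a"
  using \<sigma> by (auto simp: even_section_def)

lemma section_0: "\<sigma> j 0 = 0"
  using section_add[of 0 j 0] gr_closed(4) by simp

lemma section_F: assumes "x \<in> gr j" shows "\<sigma> j x \<in> F j"
proof -
  obtain u v where "u \<in> gp j 0" "v \<in> gp j 1" "x = u + v" using gr_decompose[OF assms] by blast
  moreover from this have "\<sigma> j u \<in> F j" "\<sigma> j v \<in> F j" using \<sigma> by (auto simp: even_section_def)
  ultimately show ?thesis using section_add[of u j v] F_closed(1) by auto
qed

lemma section_carrier: "x \<in> gr j \<Longrightarrow> \<sigma> j x \<in> lie_carrier L"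
  using section_F F_carrier by blast

lemma section_sum: "(\<And>i. i \<in> A \<Longrightarrow> x i \<in> gr j) \<Longrightarrow> \<sigma> j (sum x A) = (\<Sum>i\<in>A. \<sigma> j (x i))"
  by (induction A rule: infinite_finite_induct) (auto simp: section_0 section_add gr_closed)

definition defect :: "int \<Rightarrow> int \<Rightarrow> 'g \<Rightarrow> 'g \<Rightarrow> 'a" where
  "defect i j y z = bl (\<sigma> i y) (\<sigma> j z) - \<sigma> (i + j) (bg y z)"

lemma defect_add:
  assumes "x \<in> gr i" "y \<in> gr i" "z \<in> gr j"
  shows "defect i j (x + y) z = defect i j x z + defect i j y z"
    "defect j i z (x + y) = defect j i z x + defect j i z y"
  using assms section_carrier[OF assms(1)] section_carrier[OF assms(2)] section_carrier[OF assms(3)]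
    gr_bracket[OF assms(1) assms(3) refl] gr_bracket[OF assms(2) assms(3) refl]
    gr_bracket[OF assms(3) assms(1) refl] gr_bracket[OF assms(3) assms(2) refl]
  by (simp_all add: defect_def section_add L_add G_add)

lemma defect_scale:
  assumes "x \<in> gr i" "y \<in> gr j"
  shows "defect i j (sG c x) y = sL c (defect i j x y)" "defect i j x (sG c y) = sL c (defect i j x y)"
  using assms section_carrier[OF assms(1)] section_carrier[OF assms(2)] gr_bracket[OF assms refl]
  by (simp_all add: defect_def section_scale L_scale G_scale VL.scale_right_diff_distrib)

lemma defect_part:
  assumes "x \<in> gp i a" "y \<in> gp j b"
  shows "defect i j x y \<in> lie_part L (a + b)"
  unfolding defect_def using assms gp_bracket[OF assms refl]
  by (intro L_part_closed(2) L_part_bracket section_part) auto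

lemma defect_skew:
  assumes "x \<in> gp i a" "y \<in> gp j b"
  shows "defect i j x y = - sL (parity_sign a b) (defect j i y x)"
proof -
  have "\<sigma> (i + j) (bg x y) = \<sigma> (i + j) (sG (- parity_sign a b) (bg y x))"
    using G_skew[OF assms] by simp
  also have "\<dots> = sL (- parity_sign a b) (\<sigma> (i + j) (bg y x))"
    using assms gr_bracket[of y j x i "i + j"] by (intro section_scale) auto
  finally show ?thesis
    using L_skew[OF section_part[OF assms(1)] section_part[OF assms(2)]]
    by (simp add: defect_def VL.scale_right_diff_distrib add.commute)
qed

text \<open>A bracket and its two-fold iterates in \<open>L\<close> and in \<open>G\<close> satisfy the same Jacobi identity;
  subtracting one from the other shows that the defect satisfies the cocycle identity already
  in \<open>L\<close>.\<close>

lemma defect_cocycle: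
  assumes "x \<in> gp i a" "y \<in> gp j b" "z \<in> gp l c"
  shows "bl (\<sigma> i x) (defect j l y z) + defect i (j + l) x (bg y z) =
      bl (defect i j x y) (\<sigma> l z) + defect (i + j) l (bg x y) z
      + sL (parity_sign a b) (bl (\<sigma> j y) (defect i l x z) + defect j (i + l) y (bg x z))"
proof -
  have gr: "x \<in> gr i" "y \<in> gr j" "z \<in> gr l" using assms by auto
  note br = gr_bracket[OF gr(2,3) refl] gr_bracket[OF gr(1,2) refl] gr_bracket[OF gr(1,3) refl]
  have c: "\<sigma> i x \<in> lie_carrier L" "\<sigma> j y \<in> lie_carrier L" "\<sigma> l z \<in> lie_carrier L"
    "\<sigma> (j + l) (bg y z) \<in> lie_carrier L" "\<sigma> (i + j) (bg x y) \<in> lie_carrier L"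
    "\<sigma> (i + l) (bg x z) \<in> lie_carrier L"
    using gr br section_carrier by auto
  note cb = carrier_bracket[OF c(2,3)] carrier_bracket[OF c(1,2)] carrier_bracket[OF c(1,3)]
  have h1: "bl (\<sigma> i x) (defect j l y z) + defect i (j + l) x (bg y z) =
      bl (\<sigma> i x) (bl (\<sigma> j y) (\<sigma> l z)) - \<sigma> (i + j + l) (bg x (bg y z))"
    using c cb by (simp add: defect_def L_diff add.assoc)
  have h2: "bl (defect i j x y) (\<sigma> l z) + defect (i + j) l (bg x y) z =
      bl (bl (\<sigma> i x) (\<sigma> j y)) (\<sigma> l z) - \<sigma> (i + j + l) (bg (bg x y) z)"
    using c cb by (simp add: defect_def L_diff)
  have h3: "bl (\<sigma> j y) (defect i l x z) + defect j (i + l) y (bg x z) =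
      bl (\<sigma> j y) (bl (\<sigma> i x) (\<sigma> l z)) - \<sigma> (i + j + l) (bg y (bg x z))"
    using c cb by (simp add: defect_def L_diff add.assoc add.left_commute)
  have h4: "bl (\<sigma> i x) (bl (\<sigma> j y) (\<sigma> l z)) = bl (bl (\<sigma> i x) (\<sigma> j y)) (\<sigma> l z)
      + sL (parity_sign a b) (bl (\<sigma> j y) (bl (\<sigma> i x) (\<sigma> l z)))"
    using L_jacobi section_part assms c by blast
  have h5: "\<sigma> (i + j + l) (bg x (bg y z)) = \<sigma> (i + j + l) (bg (bg x y) z)
      + sL (parity_sign a b) (\<sigma> (i + j + l) (bg y (bg x z)))"
  proof -
    have "bg (bg x y) z \<in> gr (i + j + l)" "bg y (bg x z) \<in> gr (i + j + l)"
      using gr br gr_bracket[of "bg x y" "i + j" z l] gr_bracket[of y j "bg x z" "i + l" "i + j + l"] by auto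
    moreover have "bg x (bg y z) = bg (bg x y) z + sG (parity_sign a b) (bg y (bg x z))"
      using G_jacobi assms unfolding graded_jacobi_def by blast
    ultimately show ?thesis using gr_closed(3) by (simp add: section_add section_scale)
  qed
  show ?thesis
    unfolding h1 h2 h3 h4 h5 VL.scale_right_diff_distrib by simp
qed

text \<open>Estimates of the defect need to be shown only for arguments of pure parity.\<close>

lemma defect_mixed:
  assumes "\<And>a b x y. x \<in> gp i a \<Longrightarrow> y \<in> gp j b \<Longrightarrow> defect i j x y \<in> F m"
    and x: "x \<in> gr i" and y: "y \<in> gr j"
  shows "defect i j x y \<in> F m"
proof -
  obtain u v where uv: "u \<in> gp i 0" "v \<in> gp i 1" "x = u + v" using gr_decompose[OF x] by blast
  obtain u' v' where uv': "u' \<in> gp j 0" "v' \<in> gp j 1" "y = u' + v'" using gr_decompose[OF y] by blast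
  have "defect i j x y = defect i j u y + defect i j v y"
    using defect_add(1)[of u i v y j] uv y by auto
  also have "\<dots> = defect i j u u' + defect i j u v' + (defect i j v u' + defect i j v v')"
    using defect_add(2)[of u' j v' _ i] uv uv' by auto
  also have "\<dots> \<in> F m"
    by (intro F_closed(1) assms(1)[OF uv(1) uv'(1)] assms(1)[OF uv(1) uv'(2)]
        assms(1)[OF uv(2) uv'(1)] assms(1)[OF uv(2) uv'(2)])
  finally show ?thesis .
qed

end

text \<open>The defect of \<open>\<sigma>\<close> raises the degree by at least \<open>k\<close>.  Every section has this property for
  \<open>k = 1\<close>, since the symbol maps are compatible with the brackets.\<close>

definition bracket_upto :: "int \<Rightarrow> (int \<Rightarrow> 'g \<Rightarrow> 'a) \<Rightarrow> bool" where
  "bracket_upto k \<sigma> \<longleftrightarrow> (\<forall>i j. \<forall>y\<in>gr i. \<forall>z\<in>gr j. defect \<sigma> i j y z \<in> F (i + j + k))"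

lemma bracket_upto_1: assumes "even_section \<sigma>" shows "bracket_upto 1 \<sigma>"
  unfolding bracket_upto_def
proof (intro allI ballI)
  fix i j y z assume yz: "y \<in> gr i" "z \<in> gr j"
  note s = section_F[OF assms] section_symbol[OF assms]
  have b: "bl (\<sigma> i y) (\<sigma> j z) \<in> F (i + j)" "bg y z \<in> gr (i + j)"
    using yz s F_bracket gr_bracket by auto
  then have "symbol (i + j) (defect \<sigma> i j y z) = bg y z - bg y z"
    using yz s symbol_bracket[of "\<sigma> i y" i "\<sigma> j z" j]
    by (simp add: defect_def[OF assms] symbol_diff)
  moreover have "defect \<sigma> i j y z \<in> F (i + j)"
    unfolding defect_def[OF assms] using b s F_closed(2) by blast
  ultimately show "defect \<sigma> i j y z \<in> F (i + j + 1)"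
    using symbol_eq_0_iff by simp
qed

text \<open>The symbols of the identity \<open>defect_cocycle\<close> are the cocycle identity in \<open>G\<close>.\<close>

lemma defect_symbol_cocycle:
  assumes \<sigma>: "even_section \<sigma>" and k: "bracket_upto k \<sigma>"
  shows "even_2_cocycle G k (\<lambda>i j y z. symbol (i + j + k) (defect \<sigma> i j y z))"
proof -
  have D: "defect \<sigma> i j y z \<in> F m" if "y \<in> gr i" "z \<in> gr j" "m = i + j + k" for i j y z m
    using k that unfolding bracket_upto_def by simp
  note s = section_F[OF \<sigma>] section_symbol[OF \<sigma>]
  show ?thesis
    unfolding even_2_cocycle_def
  proof (intro conjI allI ballI)
    fix i j x y z assume xyz: "x \<in> gr i" "y \<in> gr i" "z \<in> gr j"
    show "symbol (i + j + k) (defect \<sigma> i j (x + y) z) =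
        symbol (i + j + k) (defect \<sigma> i j x z) + symbol (i + j + k) (defect \<sigma> i j y z)"
      "symbol (j + i + k) (defect \<sigma> j i z (x + y)) =
        symbol (j + i + k) (defect \<sigma> j i z x) + symbol (j + i + k) (defect \<sigma> j i z y)"
      unfolding defect_add[OF \<sigma> xyz] using xyz by (auto intro!: symbol_add D)
  next
    fix i j c x y assume xy: "x \<in> gr i" "y \<in> gr j"
    show "symbol (i + j + k) (defect \<sigma> i j (sG c x) y) = sG c (symbol (i + j + k) (defect \<sigma> i j x y))"
      "symbol (i + j + k) (defect \<sigma> i j x (sG c y)) = sG c (symbol (i + j + k) (defect \<sigma> i j x y))"
      unfolding defect_scale[OF \<sigma> xy] using xy by (auto intro!: symbol_scale D)
  next
    fix i j a b x y assume xy: "x \<in> gp i a" "y \<in> gp j b"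
    have "defect \<sigma> i j x y \<in> Fp (i + j + k) (a + b)"
      using D[of x i y j] defect_part[OF \<sigma> xy] xy by auto
    then show "symbol (i + j + k) (defect \<sigma> i j x y) \<in> gp (i + j + k) (a + b)"
      unfolding symbol_parts[symmetric] by blast
    have d: "defect \<sigma> j i y x \<in> F (i + j + k)" using xy by (auto intro!: D)
    have "symbol (i + j + k) (defect \<sigma> i j x y) = symbol (i + j + k) (0 - sL (parity_sign a b) (defect \<sigma> j i y x))"
      using defect_skew[OF \<sigma> xy] by simp
    also have "\<dots> = 0 - sG (parity_sign a b) (symbol (i + j + k) (defect \<sigma> j i y x))"
      unfolding symbol_diff[OF F_closed(4) F_closed(3)[OF d]] symbol_scale[OF d] symbol_0 ..
    finally show "symbol (i + j + k) (defect \<sigma> i j x y) =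
        - sG (parity_sign a b) (symbol (j + i + k) (defect \<sigma> j i y x))"
      by (simp add: add.commute)
  next
    fix i j l a b c x y z assume p: "x \<in> gp i a" "y \<in> gp j b" "z \<in> gp l c"
    then have gr: "x \<in> gr i" "y \<in> gr j" "z \<in> gr l" by auto
    define m where "m = i + j + l + k"
    note br = gr_bracket[OF gr(2,3) refl] gr_bracket[OF gr(1,2) refl] gr_bracket[OF gr(1,3) refl]
    have in_m: "bl (\<sigma> i x) (defect \<sigma> j l y z) \<in> F m" "defect \<sigma> i (j + l) x (bg y z) \<in> F m"
      "bl (defect \<sigma> i j x y) (\<sigma> l z) \<in> F m" "defect \<sigma> (i + j) l (bg x y) z \<in> F m"
      "bl (\<sigma> j y) (defect \<sigma> i l x z) \<in> F m" "defect \<sigma> j (i + l) y (bg x z) \<in> F m"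
      using gr s D[OF gr(1) br(1), of m] D[OF br(2) gr(3), of m] D[OF gr(2) br(3), of m]
        D[OF gr(2,3) refl] D[OF gr(1,2) refl] D[OF gr(1,3) refl]
        F_bracket[of "\<sigma> i x" i "defect \<sigma> j l y z" "j + l + k" m]
        F_bracket[of "defect \<sigma> i j x y" "i + j + k" "\<sigma> l z" l m]
        F_bracket[of "\<sigma> j y" j "defect \<sigma> i l x z" "i + l + k" m] by (auto simp: m_def)
    have sym: "symbol m (bl (\<sigma> i x) (defect \<sigma> j l y z)) = bg x (symbol (j + l + k) (defect \<sigma> j l y z))"
      "symbol m (bl (defect \<sigma> i j x y) (\<sigma> l z)) = bg (symbol (i + j + k) (defect \<sigma> i j x y)) z"
      "symbol m (bl (\<sigma> j y) (defect \<sigma> i l x z)) = bg y (symbol (i + l + k) (defect \<sigma> i l x z))"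
      using gr s D[of y j z l] D[of x i y j] D[of x i z l]
        symbol_bracket[of "\<sigma> i x" i "defect \<sigma> j l y z" "j + l + k" m]
        symbol_bracket[of "defect \<sigma> i j x y" "i + j + k" "\<sigma> l z" l m]
        symbol_bracket[of "\<sigma> j y" j "defect \<sigma> i l x z" "i + l + k" m] by (auto simp: m_def)
    have "symbol m (bl (\<sigma> i x) (defect \<sigma> j l y z) + defect \<sigma> i (j + l) x (bg y z)) =
        symbol m (bl (defect \<sigma> i j x y) (\<sigma> l z) + defect \<sigma> (i + j) l (bg x y) z
          + sL (parity_sign a b) (bl (\<sigma> j y) (defect \<sigma> i l x z) + defect \<sigma> j (i + l) y (bg x z)))"
      using defect_cocycle[OF \<sigma> p] by simp
    also have "\<dots> = bg (symbol (i + j + k) (defect \<sigma> i j x y)) z + symbol m (defect \<sigma> (i + j) l (bg x y) z)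
        + sG (parity_sign a b) (bg y (symbol (i + l + k) (defect \<sigma> i l x z))
          + symbol m (defect \<sigma> j (i + l) y (bg x z)))"
      using in_m by (simp add: symbol_add symbol_scale F_closed(1,3) sym)
    finally have fin: "bg x (symbol (j + l + k) (defect \<sigma> j l y z)) + symbol m (defect \<sigma> i (j + l) x (bg y z)) =
        bg (symbol (i + j + k) (defect \<sigma> i j x y)) z + symbol m (defect \<sigma> (i + j) l (bg x y) z)
        + sG (parity_sign a b) (bg y (symbol (i + l + k) (defect \<sigma> i l x z))
          + symbol m (defect \<sigma> j (i + l) y (bg x z)))"
      using in_m by (simp add: symbol_add sym)
    have m: "i + (j + l) + k = m" "i + j + l + k = m" "j + (i + l) + k = m" by (simp_all add: m_def)
    show "bg x (symbol (j + l + k) (defect \<sigma> j l y z)) + symbol (i + (j + l) + k) (defect \<sigma> i (j + l) x (bg y z)) =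
        bg (symbol (i + j + k) (defect \<sigma> i j x y)) z + symbol (i + j + l + k) (defect \<sigma> (i + j) l (bg x y) z)
        + sG (parity_sign a b) (bg y (symbol (i + l + k) (defect \<sigma> i l x z))
          + symbol (j + (i + l) + k) (defect \<sigma> j (i + l) y (bg x z)))"
      unfolding m by (rule fin)
  qed
qed

text \<open>If the leading term of the defect is the coboundary of \<open>\<psi>\<close>, then subtracting \<open>\<sigma> \<circ> \<psi>\<close>
  kills it: the quadratic term \<open>[\<sigma> \<psi> y, \<sigma> \<psi> z]\<close> has degree \<open>2k > k\<close>.\<close>

lemma improve_section:
  assumes \<sigma>: "even_section \<sigma>" and upto: "bracket_upto k \<sigma>" and k: "k > 0"
    and \<psi>: "even_1_cochain G k \<psi>"
    and cob: "is_coboundary_of G (\<lambda>i j y z. symbol (i + j + k) (defect \<sigma> i j y z)) \<psi>"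
  defines "\<sigma>' \<equiv> \<lambda>j y. \<sigma> j y - \<sigma> (j + k) (\<psi> j y)"
  shows "even_section \<sigma>'" "bracket_upto (k + 1) \<sigma>'"
proof -
  note s = section_F[OF \<sigma>] section_symbol[OF \<sigma>]
  have \<psi>_part: "\<psi> j y \<in> gp (j + k) a" if "y \<in> gp j a" for j y a
    using \<psi> that unfolding even_1_cochain_def by blast
  have \<psi>_add: "\<psi> j (x + y) = \<psi> j x + \<psi> j y" if "x \<in> gr j" "y \<in> gr j" for j x y
    using \<psi> that unfolding even_1_cochain_def grade_linear_def by blast
  have \<psi>_scale: "\<psi> j (sG c y) = sG c (\<psi> j y)" if "y \<in> gr j" for j c y
    using \<psi> that unfolding even_1_cochain_def grade_linear_def by blast
  have \<psi>_gr: "\<psi> j y \<in> gr (j + k)" if y: "y \<in> gr j" for j y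
  proof -
    obtain u v where uv: "u \<in> gp j 0" "v \<in> gp j 1" "y = u + v" using gr_decompose[OF y] by blast
    then show ?thesis using \<psi>_part[OF uv(1)] \<psi>_part[OF uv(2)] \<psi>_add[of u j v] gr_closed(1) by auto
  qed
  have F_up: "x \<in> F (j + k) \<Longrightarrow> x \<in> F (j + 1)" "x \<in> F (j + k) \<Longrightarrow> x \<in> F j" for x j
    using F_antimono[of "j + 1" "j + k"] F_antimono[of j "j + k"] k by auto
  show \<sigma>': "even_section \<sigma>'"
    unfolding even_section_def grade_linear_def
  proof (intro conjI allI ballI)
    fix j x y assume "x \<in> gr j" "y \<in> gr j"
    then show "\<sigma>' j (x + y) = \<sigma>' j x + \<sigma>' j y"
      using \<psi>_gr[of x j] \<psi>_gr[of y j] by (simp add: \<sigma>'_def \<psi>_add section_add[OF \<sigma>])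
  next
    fix j c x assume "x \<in> gr j"
    then show "\<sigma>' j (sG c x) = sL c (\<sigma>' j x)"
      using \<psi>_gr[of x j]
      by (simp add: \<sigma>'_def \<psi>_scale section_scale[OF \<sigma>] VL.scale_right_diff_distrib)
  next
    fix j a y assume y: "y \<in> gp j a"
    then have "\<sigma> j y \<in> F j" "\<sigma> (j + k) (\<psi> j y) \<in> F j"
      using s \<psi>_part[OF y] F_up by auto
    moreover have "\<sigma> j y \<in> lie_part L a" "\<sigma> (j + k) (\<psi> j y) \<in> lie_part L a"
      using section_part[OF \<sigma>] y \<psi>_part[OF y] by auto
    ultimately show "\<sigma>' j y \<in> Fp j a"
      unfolding \<sigma>'_def using F_closed(2) L_part_closed(2) by blast
  next
    fix j y assume y: "y \<in> gr j"
    then have "\<sigma> (j + k) (\<psi> j y) \<in> F (j + 1)"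
      using s \<psi>_gr[OF y] F_up by auto
    moreover from this have "\<sigma> (j + k) (\<psi> j y) \<in> F j" using F_step by blast
    ultimately show "symbol j (\<sigma>' j y) = y"
      unfolding \<sigma>'_def using s y symbol_eq_0_iff by (simp add: symbol_diff)
  qed
  have pure: "defect \<sigma>' i j y z \<in> F (i + j + k + 1)" if yz: "y \<in> gp i a" "z \<in> gp j b" for i j y z a b
  proof -
    define m where "m = i + j + k"
    have g: "y \<in> gr i" "z \<in> gr j" "\<psi> i y \<in> gr (i + k)" "\<psi> j z \<in> gr (j + k)" "bg y z \<in> gr (i + j)"
      "\<psi> (i + j) (bg y z) \<in> gr m"
      using yz \<psi>_gr gr_bracket[of y i z j "i + j"] by (auto simp: m_def)
    define P where "P = bl (\<sigma> i y) (\<sigma> (j + k) (\<psi> j z))"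
    define Q where "Q = bl (\<sigma> (i + k) (\<psi> i y)) (\<sigma> j z)"
    define R where "R = bl (\<sigma> (i + k) (\<psi> i y)) (\<sigma> (j + k) (\<psi> j z))"
    define S where "S = \<sigma> m (\<psi> (i + j) (bg y z))"
    have eq: "defect \<sigma>' i j y z = defect \<sigma> i j y z - (P + Q - S) + R"
      using g section_carrier[OF \<sigma>] carrier_closed(2) unfolding defect_def[OF \<sigma>] defect_def[OF \<sigma>']
      by (simp add: \<sigma>'_def P_def Q_def R_def S_def L_diff m_def algebra_simps)
    have F: "P \<in> F m" "Q \<in> F m" "R \<in> F (m + k)" "S \<in> F m" "defect \<sigma> i j y z \<in> F m"
      using g s upto unfolding P_def Q_def R_def S_def bracket_upto_def
      by (auto intro!: F_bracket s simp: m_def)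
    have "symbol m P = bg y (\<psi> j z)" "symbol m Q = bg (\<psi> i y) z" "symbol m S = \<psi> (i + j) (bg y z)"
      using g s symbol_bracket[of "\<sigma> i y" i "\<sigma> (j + k) (\<psi> j z)" "j + k" m]
        symbol_bracket[of "\<sigma> (i + k) (\<psi> i y)" "i + k" "\<sigma> j z" j m]
      by (simp_all add: P_def Q_def S_def m_def)
    moreover have "symbol m (defect \<sigma> i j y z) = bg y (\<psi> j z) + bg (\<psi> i y) z - \<psi> (i + j) (bg y z)"
      using cob yz unfolding is_coboundary_of_def m_def by blast
    moreover have "R \<in> F m" "symbol m R = 0"
      using F(3) F_up symbol_eq_0_iff by blast+
    ultimately have "symbol m (defect \<sigma>' i j y z) = 0"
      unfolding eq using F by (simp add: symbol_add symbol_diff F_closed(1,2))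
    moreover have "defect \<sigma>' i j y z \<in> F m"
      unfolding eq using F \<open>R \<in> F m\<close> F_closed(1,2) by presburger
    ultimately show ?thesis using symbol_eq_0_iff by (simp add: m_def)
  qed
  show "bracket_upto (k + 1) \<sigma>'"
    unfolding bracket_upto_def
  proof (intro allI ballI)
    fix i j y z assume "y \<in> gr i" "z \<in> gr j"
    have "defect \<sigma>' i j y z \<in> F (i + j + k + 1)"
      by (rule defect_mixed[OF \<sigma>']) (fact pure, fact+)
    then show "defect \<sigma>' i j y z \<in> F (i + j + (k + 1))" by (simp add: add.assoc)
  qed
qed

subsection \<open>Passage to the limit\<close>

lemma F_decompose': assumes "x \<in> F j" shows "\<exists>u\<in>lie_part L a. \<exists>v\<in>lie_part L (a + 1). x = u + v"
proof -
  obtain u v where uv: "u \<in> lie_part L 0" "v \<in> lie_part L 1" "x = u + v"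
    using F_decompose[OF assms] by blast
  show ?thesis
  proof (cases "a = 0")
    case True
    then show ?thesis using uv by auto
  next
    case False
    then have "v \<in> lie_part L a" "u \<in> lie_part L (a + 1)" "x = v + u"
      using uv by (simp_all add: add.commute)
    then show ?thesis by blast
  qed
qed

lemma separated_nat: assumes "\<And>t::nat. w \<in> F (j + int t)" shows "w = 0"
proof (rule separated)
  fix N
  have "N \<le> j + int (nat (N - j))" by simp
  then show "w \<in> F N" using F_antimono assms by blast
qed

text \<open>Completeness with an explicit rate of convergence.\<close>

lemma complete:
  assumes "\<And>t. x t \<in> lie_carrier L" and "\<And>t. x (Suc t) - x t \<in> F (j + int t)"
  shows "\<exists>l\<in>lie_carrier L. \<forall>t. x t - l \<in> F (j + int t)"
proof -
  have tail: "x (t + s) - x t \<in> F (j + int t)" for s t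
  proof (induction s)
    case (Suc s)
    have "x (Suc (t + s)) - x (t + s) \<in> F (j + int t)"
      using assms(2)[of "t + s"] F_antimono[of "j + int t" "j + int (t + s)"] by auto
    then have "(x (Suc (t + s)) - x (t + s)) + (x (t + s) - x t) \<in> F (j + int t)"
      using Suc F_closed(1) by blast
    then show ?case by simp
  qed (simp add: F_closed)
  have "\<forall>i. \<exists>N. \<forall>m\<ge>N. \<forall>k\<ge>N. x m - x k \<in> F i"
  proof
    fix i
    define N where "N = nat (i - j)"
    have "x m - x k \<in> F i" if "m \<ge> N" "k \<ge> N" for m k
    proof -
      have "F (j + int N) \<subseteq> F i" by (rule F_antimono) (simp add: N_def)
      moreover have "x m - x N \<in> F (j + int N)" "x k - x N \<in> F (j + int N)"
        using tail[of N "m - N"] tail[of N "k - N"] that by simp_all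
      ultimately have "x m - x N \<in> F i" "x k - x N \<in> F i" by auto
      then have "(x m - x N) - (x k - x N) \<in> F i" using F_closed(2) by blast
      then show ?thesis by simp
    qed
    then show "\<exists>N. \<forall>m\<ge>N. \<forall>k\<ge>N. x m - x k \<in> F i" by blast
  qed
  moreover have "filt_complete L"
    using filtered by (simp add: filtered_lie_superalgebra_def)
  moreover have "range x \<subseteq> lie_carrier L" using assms(1) by blast
  ultimately obtain l where l: "l \<in> lie_carrier L" "\<forall>i. \<exists>N. \<forall>m\<ge>N. x m - l \<in> F i"
    unfolding filt_complete_def by (elim conjE allE[of _ x]) blast
  have "x t - l \<in> F (j + int t)" for t
  proof -
    obtain N where N: "\<forall>m\<ge>N. x m - l \<in> F (j + int t)" using l(2) by blast
    have "(x (t + N) - l) - (x (t + N) - x t) \<in> F (j + int t)"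
      using N tail[of t N] F_closed(2) by (metis le_add2)
    then show ?thesis by simp
  qed
  then show ?thesis using l(1) by blast
qed

text \<open>The successive corrections of the section in degree \<open>j\<close> lie in \<open>F (j + 1)\<close>, \<open>F (j + 2)\<close> and so on.
  Hence they converge, the limit is again a section, and its defect lies in every \<open>F i\<close>.\<close>

lemma exact_section:
  assumes H2: "\<And>k \<mu>. k > 0 \<Longrightarrow> even_2_cocycle G k \<mu> \<Longrightarrow> \<exists>\<psi>. even_1_cochain G k \<psi> \<and> is_coboundary_of G \<mu> \<psi>"
  shows "\<exists>\<sigma>. even_section \<sigma> \<and> (\<forall>i j. \<forall>y\<in>gr i. \<forall>z\<in>gr j. bl (\<sigma> i y) (\<sigma> j z) = \<sigma> (i + j) (bg y z))"
proof -
  have "\<exists>\<sigma>. \<forall>t. (even_section (\<sigma> t) \<and> bracket_upto (int t + 1) (\<sigma> t)) \<and>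
      (\<forall>j. \<forall>y\<in>gr j. \<sigma> (Suc t) j y - \<sigma> t j y \<in> F (j + int t + 1))"
  proof (rule dependent_nat_choice)
    show "\<exists>\<sigma>. even_section \<sigma> \<and> bracket_upto (int 0 + 1) \<sigma>"
      using even_section_exists bracket_upto_1 by auto
    fix \<sigma> t assume \<sigma>: "even_section \<sigma> \<and> bracket_upto (int t + 1) \<sigma>"
    define k where "k = int t + 1"
    have k: "k > 0" "bracket_upto k \<sigma>" using \<sigma> by (auto simp: k_def)
    obtain \<psi> where \<psi>: "even_1_cochain G k \<psi>"
      "is_coboundary_of G (\<lambda>i j y z. symbol (i + j + k) (defect \<sigma> i j y z)) \<psi>"
      using H2[OF k(1) defect_symbol_cocycle[OF conjunct1[OF \<sigma>] k(2)]] by blast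
    define \<sigma>' where "\<sigma>' j y = \<sigma> j y - \<sigma> (j + k) (\<psi> j y)" for j y
    have "even_section \<sigma>'" "bracket_upto (k + 1) \<sigma>'"
      using improve_section[OF conjunct1[OF \<sigma>] k(2,1) \<psi>] unfolding \<sigma>'_def[abs_def] by auto
    moreover have "\<sigma>' j y - \<sigma> j y \<in> F (j + k)" if y: "y \<in> gr j" for j y
    proof -
      obtain u v where uv: "u \<in> gp j 0" "v \<in> gp j 1" "y = u + v" using gr_decompose[OF y] by blast
      then have "\<psi> j u \<in> gr (j + k)" "\<psi> j v \<in> gr (j + k)" "\<psi> j y = \<psi> j u + \<psi> j v"
        using \<psi>(1) unfolding even_1_cochain_def grade_linear_def by auto
      then have "\<psi> j y \<in> gr (j + k)" using gr_closed(1) by auto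
      then show ?thesis
        using section_F[OF conjunct1[OF \<sigma>]] F_closed(5) by (simp add: \<sigma>'_def)
    qed
    ultimately show "\<exists>\<sigma>'. (even_section \<sigma>' \<and> bracket_upto (int (Suc t) + 1) \<sigma>') \<and>
        (\<forall>j. \<forall>y\<in>gr j. \<sigma>' j y - \<sigma> j y \<in> F (j + int t + 1))"
      by (intro exI[of _ \<sigma>']) (auto simp: k_def algebra_simps)
  qed
  then obtain S where S: "\<And>t. even_section (S t)" "\<And>t. bracket_upto (int t + 1) (S t)"
    and S_step: "\<And>t j y. y \<in> gr j \<Longrightarrow> S (Suc t) j y - S t j y \<in> F (j + 1 + int t)"
    by (auto simp: algebra_simps)
  have limit: "\<exists>l. l \<in> lie_carrier L \<and> (\<forall>t. S t j y - l \<in> F (j + 1 + int t))" if "y \<in> gr j" for j y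
    using complete[of "\<lambda>t. S t j y" "j + 1"] section_carrier[OF S(1)] S_step that by blast
  define \<sigma> where "\<sigma> j y = (SOME l. l \<in> lie_carrier L \<and> (\<forall>t. S t j y - l \<in> F (j + 1 + int t)))" for j y
  have \<sigma>: "\<sigma> j y \<in> lie_carrier L" "S t j y - \<sigma> j y \<in> F (j + 1 + int t)" if "y \<in> gr j" for j y t
    using someI_ex[OF limit[OF that]] by (auto simp: \<sigma>_def)
  note Sc = section_carrier[OF S(1)]
  have \<sigma>F: "\<sigma> j y \<in> F j" if "y \<in> gr j" for j y
  proof -
    have "S 0 j y \<in> F j" "S 0 j y - \<sigma> j y \<in> F j"
      using that section_F[OF S(1)] \<sigma>(2)[of y j 0] F_step[of j] by auto
    then have "S 0 j y - (S 0 j y - \<sigma> j y) \<in> F j" using F_closed(2) by blast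
    then show ?thesis by simp
  qed
  have "even_section \<sigma>"
    unfolding even_section_def grade_linear_def
  proof (intro conjI allI ballI)
    fix j x y assume xy: "x \<in> gr j" "y \<in> gr j"
    have "\<sigma> j (x + y) - (\<sigma> j x + \<sigma> j y) \<in> F (j + 1 + int t)" for t
    proof -
      have "(S t j x - \<sigma> j x) + (S t j y - \<sigma> j y) - (S t j (x + y) - \<sigma> j (x + y)) \<in> F (j + 1 + int t)"
        by (intro F_closed(1,2) \<sigma>(2) xy gr_closed(1))
      then show ?thesis using xy by (simp add: section_add[OF S(1)] algebra_simps)
    qed
    then show "\<sigma> j (x + y) = \<sigma> j x + \<sigma> j y" using separated_nat by (metis eq_iff_diff_eq_0)
  next
    fix j c x assume x: "x \<in> gr j"
    have "\<sigma> j (sG c x) - sL c (\<sigma> j x) \<in> F (j + 1 + int t)" for t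
    proof -
      have "sL c (S t j x - \<sigma> j x) - (S t j (sG c x) - \<sigma> j (sG c x)) \<in> F (j + 1 + int t)"
        by (intro F_closed(2,3) \<sigma>(2) x gr_closed(3))
      then show ?thesis using x by (simp add: section_scale[OF S(1)] VL.scale_right_diff_distrib)
    qed
    then show "\<sigma> j (sG c x) = sL c (\<sigma> j x)" using separated_nat by (metis eq_iff_diff_eq_0)
  next
    fix j a y assume y: "y \<in> gp j a"
    have "\<sigma> j y \<in> F j" using y \<sigma>F by blast
    then obtain u v where uv: "u \<in> lie_part L a" "v \<in> lie_part L (a + 1)" "\<sigma> j y = u + v"
      using F_decompose' by blast
    have "- v \<in> F (j + 1 + int t)" for t
    proof (rule F_part_of_sum(2)[of "S t j y - u" "- v" _ a])
      show "S t j y - u + - v \<in> F (j + 1 + int t)"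
        using \<sigma>(2)[of y j t] y uv(3) by (simp add: algebra_simps)
      show "S t j y - u \<in> lie_part L a" using section_part[OF S(1) y] uv(1) L_part_closed(2) by blast
      show "- v \<in> lie_part L (a + 1)" using uv(2) L_part_closed(5) by blast
    qed
    then have "- v = 0" using separated_nat by blast
    then show "\<sigma> j y \<in> Fp j a" using uv \<sigma>F y by auto
  next
    fix j y assume y: "y \<in> gr j"
    have "S 0 j y - \<sigma> j y \<in> F (j + 1)" using \<sigma>(2)[OF y, of 0] by simp
    then have "symbol j (S 0 j y - \<sigma> j y) = 0" using symbol_eq_0_iff F_step by blast
    then show "symbol j (\<sigma> j y) = y"
      using section_symbol[OF S(1) y] section_F[OF S(1) y] \<sigma>F[OF y] by (simp add: symbol_diff)
  qed
  moreover have "bl (\<sigma> i y) (\<sigma> j z) = \<sigma> (i + j) (bg y z)" if yz: "y \<in> gr i" "z \<in> gr j" for i j y z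
  proof -
    have "bl (\<sigma> i y) (\<sigma> j z) - \<sigma> (i + j) (bg y z) \<in> F (i + j + 1 + int t)" for t
    proof -
      note c = \<sigma>(1)[OF yz(1)] \<sigma>(1)[OF yz(2)] Sc[OF yz(1), of t] Sc[OF yz(2), of t]
      have b: "bg y z \<in> gr (i + j)" using yz gr_bracket by blast
      have "bl (S t i y - \<sigma> i y) (S t j z) \<in> F (i + j + 1 + int t)"
        "bl (\<sigma> i y) (S t j z - \<sigma> j z) \<in> F (i + j + 1 + int t)"
        by (rule F_bracket[OF \<sigma>(2)[OF yz(1), of t] section_F[OF S(1) yz(2), of t]], simp)
          (rule F_bracket[OF \<sigma>F[OF yz(1)] \<sigma>(2)[OF yz(2), of t]], simp)
      moreover have "defect (S t) i j y z \<in> F (i + j + 1 + int t)"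
        using S(2)[of t, unfolded bracket_upto_def, rule_format, OF yz] by (simp only: ac_simps)
      moreover have "S t (i + j) (bg y z) - \<sigma> (i + j) (bg y z) \<in> F (i + j + 1 + int t)"
        using \<sigma>(2)[OF b] .
      ultimately have "defect (S t) i j y z + (S t (i + j) (bg y z) - \<sigma> (i + j) (bg y z))
          - (bl (S t i y - \<sigma> i y) (S t j z) + bl (\<sigma> i y) (S t j z - \<sigma> j z)) \<in> F (i + j + 1 + int t)"
        using F_closed(1,2) by presburger
      then show ?thesis using c by (simp add: defect_def[OF S(1)] L_diff)
    qed
    then show ?thesis using separated_nat by (metis eq_iff_diff_eq_0)
  qed
  ultimately show ?thesis by blast
qed

subsection \<open>The isomorphism with the completion\<close>

context
  fixes \<sigma>
  assumes \<sigma>: "even_section \<sigma>"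
    and hom: "\<And>i j y z. y \<in> gr i \<Longrightarrow> z \<in> gr j \<Longrightarrow> bl (\<sigma> i y) (\<sigma> j z) = \<sigma> (i + j) (bg y z)"
begin

definition partial_sum :: "(int \<Rightarrow> 'g) \<Rightarrow> int \<Rightarrow> 'a" where
  "partial_sum f N = (\<Sum>j\<in>{- int h..<N}. \<sigma> j (f j))"

text \<open>\<open>expansion x f\<close> says that \<open>x\<close> is the sum of the convergent series of the \<open>\<sigma> j (f j)\<close>.\<close>

definition expansion :: "'a \<Rightarrow> (int \<Rightarrow> 'g) \<Rightarrow> bool" where
  "expansion x f \<longleftrightarrow> x \<in> lie_carrier L \<and> (\<forall>j. f j \<in> gr j) \<and> (\<forall>N. x - partial_sum f N \<in> F N)"

lemma partial_sum_carrier: "(\<And>j. f j \<in> gr j) \<Longrightarrow> partial_sum f N \<in> lie_carrier L"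
  unfolding partial_sum_def by (intro carrier_closed(5) section_carrier[OF \<sigma>])

lemma partial_sum_step:
  "N \<ge> - int h \<Longrightarrow> partial_sum f (N + 1) = partial_sum f N + \<sigma> N (f N)"
proof -
  assume "N \<ge> - int h"
  then have "{- int h..<N + 1} = insert N {- int h..<N}" by auto
  then show ?thesis by (simp add: partial_sum_def add.commute)
qed

lemma partial_sum_part:
  "(\<And>j. f j \<in> gp j a) \<Longrightarrow> partial_sum f N \<in> lie_part L a"
  unfolding partial_sum_def by (intro VL.subspace_sum[OF L_part_subspace] section_part[OF \<sigma>])

lemma expansion_ofI:
  assumes "x \<in> lie_carrier L" "\<And>j. f j \<in> gr j"
    and "\<And>t::nat. x - partial_sum f (- int h + int t) \<in> F (- int h + int t)"
  shows "expansion x f"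
  unfolding expansion_def
proof (intro conjI allI)
  fix N show "x - partial_sum f N \<in> F N"
  proof (cases "N \<ge> - int h")
    case True
    then show ?thesis using assms(3)[of "nat (N + int h)"] by simp
  next
    case False
    then show ?thesis using assms(1) F_low[of N] by (simp add: partial_sum_def)
  qed
qed (use assms in auto)

text \<open>The terms of the series are the symbols of the successive remainders.\<close>

lemma expansion_exists:
  assumes x: "x \<in> lie_carrier L"
  shows "\<exists>f. expansion x f"
proof -
  define r where "r = rec_nat x (\<lambda>t y. y - \<sigma> (- int h + int t) (symbol (- int h + int t) y))"
  have r0: "r 0 = x" and rS: "r (Suc t) = r t - \<sigma> (- int h + int t) (symbol (- int h + int t) (r t))" for t
    by (simp_all add: r_def)
  have rF: "r t \<in> F (- int h + int t)" for t
  proof (induction t)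
    case 0
    then show ?case using x F_low[of "- int h"] by (simp add: r0)
  next
    case (Suc t)
    define j where "j = - int h + int t"
    have s: "symbol j (r t) \<in> gr j" using Suc symbol_surj[of j] by (auto simp: j_def)
    note sF = section_F[OF \<sigma> s] section_symbol[OF \<sigma> s]
    have "symbol j (r (Suc t)) = 0" "r (Suc t) \<in> F j"
      using Suc sF F_closed(2) unfolding rS j_def[symmetric] by (simp_all add: symbol_diff)
    then have "r (Suc t) \<in> F (j + 1)" using symbol_eq_0_iff by blast
    then show ?case by (simp add: j_def algebra_simps)
  qed
  define f where "f j = (if j < - int h then 0 else symbol j (r (nat (j + int h))))" for j
  have f: "f (- int h + int t) = symbol (- int h + int t) (r t)" for t
    by (simp add: f_def)
  have f_gr: "f j \<in> gr j" for j
    using rF[of "nat (j + int h)"] symbol_surj[of j] gr_closed(4)[of j] by (auto simp: f_def)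
  have "x - partial_sum f (- int h + int t) = r t" for t
  proof (induction t)
    case 0
    then show ?case by (simp add: r0 partial_sum_def)
  next
    case (Suc t)
    have e: "- int h + int (Suc t) = (- int h + int t) + 1" by simp
    have "partial_sum f (- int h + int (Suc t)) =
        partial_sum f (- int h + int t) + \<sigma> (- int h + int t) (f (- int h + int t))"
      unfolding e by (rule partial_sum_step) simp
    then show ?case using Suc unfolding rS f by (simp add: diff_diff_add[symmetric])
  qed
  then have "expansion x f" using expansion_ofI[OF x f_gr] rF by simp
  then show ?thesis by blast
qed

lemma expansion_sums:
  assumes f: "\<And>j. f j \<in> gr j"
  shows "\<exists>x. expansion x f"
proof -
  let ?x = "\<lambda>t. partial_sum f (- int h + int t)"
  have "?x (Suc t) - ?x t \<in> F (- int h + int t)" for t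
    using partial_sum_step[of "- int h + int t" f] section_F[OF \<sigma> f[of "- int h + int t"]]
    by (simp add: algebra_simps)
  then obtain l where l: "l \<in> lie_carrier L" "\<And>t. ?x t - l \<in> F (- int h + int t)"
    using complete[of ?x "- int h"] partial_sum_carrier[OF f] by blast
  have "expansion l f"
  proof (rule expansion_ofI[OF l(1) f])
    fix t show "l - ?x t \<in> F (- int h + int t)" using F_closed(5)[OF l(2)[of t]] by simp
  qed
  then show ?thesis by blast
qed

lemma expansion_add:
  assumes "expansion x f" "expansion y g"
  shows "expansion (x + y) (f + g)"
proof -
  have "partial_sum (f + g) N = partial_sum f N + partial_sum g N" for N
    using assms by (simp add: expansion_def partial_sum_def section_add[OF \<sigma>] sum.distrib)
  moreover have "(x - partial_sum f N) + (y - partial_sum g N) \<in> F N" for N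
    using assms F_closed(1) unfolding expansion_def by blast
  ultimately have "x + y - partial_sum (f + g) N \<in> F N" for N
    by (simp add: algebra_simps)
  then show ?thesis
    using assms carrier_closed(1) gr_closed(1) by (simp add: expansion_def)
qed

lemma expansion_scale:
  assumes "expansion x f"
  shows "expansion (sL c x) (\<lambda>j. sG c (f j))"
proof -
  have "partial_sum (\<lambda>j. sG c (f j)) N = sL c (partial_sum f N)" for N
    using assms by (simp add: expansion_def partial_sum_def section_scale[OF \<sigma>] VL.scale_sum_right)
  moreover have "sL c (x - partial_sum f N) \<in> F N" for N
    using assms F_closed(3) unfolding expansion_def by blast
  ultimately show ?thesis
    using assms carrier_closed(3) gr_closed(3) by (simp add: expansion_def VL.scale_right_diff_distrib)
qed

text \<open>The first nonzero term of the series is the symbol of \<open>x\<close>.\<close>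

lemma expansion_filt:
  assumes xf: "expansion x f"
  shows "x \<in> F j \<longleftrightarrow> (\<forall>i<j. f i = 0)"
proof
  assume x: "x \<in> F j"
  have low: "f i = 0" if "i < - int h" for i
    using xf gr_low[OF that] by (auto simp: expansion_def)
  have "f i = 0" if "i < j" for i
    using that
  proof (induction "nat (i + int h + 1)" arbitrary: i rule: less_induct)
    case less
    show ?case
    proof (cases "i < - int h")
      case False
      have "f l = 0" if "l < i" for l
        using less(1)[of l] low[of l] that False less.prems by (cases "l < - int h") auto
      then have "partial_sum f i = 0"
        unfolding partial_sum_def by (intro sum.neutral) (auto simp: section_0[OF \<sigma>])
      then have "x - \<sigma> i (f i) \<in> F (i + 1)"
        using xf partial_sum_step[of i f] False unfolding expansion_def by (metis add_0 not_less)
      moreover have "x \<in> F (i + 1)" using x less.prems F_antimono[of "i + 1" j] by auto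
      ultimately have "x - (x - \<sigma> i (f i)) \<in> F (i + 1)" using F_closed(2) by blast
      then have "\<sigma> i (f i) \<in> F (i + 1)" by simp
      then have "symbol i (\<sigma> i (f i)) = 0"
        using symbol_eq_0_iff F_step by blast
      then show ?thesis using xf section_symbol[OF \<sigma>] by (simp add: expansion_def)
    qed (rule low)
  qed
  then show "\<forall>i<j. f i = 0" by blast
next
  assume "\<forall>i<j. f i = 0"
  then have "partial_sum f j = 0"
    unfolding partial_sum_def by (intro sum.neutral) (auto simp: section_0[OF \<sigma>])
  then show "x \<in> F j" using xf unfolding expansion_def by (metis diff_zero)
qed

lemma expansion_diff:
  assumes "expansion x f" "expansion y g"
  shows "expansion (x - y) (f - g)"
proof -
  have "expansion (sL (- 1) y) (\<lambda>j. sG (- 1) (g j))" by (rule expansion_scale) fact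
  then have "expansion (- y) (- g)" by (simp add: fun_Compl_def)
  from expansion_add[OF assms(1) this] show ?thesis by simp
qed

lemma expansion_unique:
  assumes "expansion x f"
  shows "expansion x g \<Longrightarrow> f = g" "expansion y f \<Longrightarrow> x = y"
proof -
  assume "expansion x g"
  then have "expansion 0 (f - g)" using expansion_diff[OF assms] by fastforce
  then have "(f - g) i = 0" for i using expansion_filt[of 0 "f - g" "i + 1"] F_closed(4) by auto
  then show "f = g" by (intro ext) (simp add: fun_diff_def)
next
  assume "expansion y f"
  then have "expansion (x - y) 0" using expansion_diff[OF assms] by fastforce
  then have "x - y \<in> F j" for j using expansion_filt by auto
  then show "x = y" using separated[of "x - y"] by simp
qed

lemma expansion_part_sum:
  assumes xf: "expansion x f" and f: "\<And>j. f j \<in> gp j a"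
  shows "x \<in> lie_part L a"
proof -
  have "x \<in> F (- int h)" using xf F_low[of "- int h"] by (simp add: expansion_def)
  then obtain u v where uv: "u \<in> lie_part L a" "v \<in> lie_part L (a + 1)" "x = u + v"
    using F_decompose' by blast
  have "v \<in> F N" for N
  proof (rule F_part_of_sum(2))
    show "(u - partial_sum f N) + v \<in> F N" using xf uv(3) by (simp add: expansion_def algebra_simps)
    show "u - partial_sum f N \<in> lie_part L a" using uv(1) partial_sum_part f L_part_closed(2) by blast
  qed (rule uv(2))
  then have "v = 0" by (rule separated)
  then show ?thesis using uv by simp
qed

lemma expansion_part:
  assumes xf: "expansion x f"
  shows "x \<in> lie_part L a \<longleftrightarrow> (\<forall>j. f j \<in> gp j a)"
proof
  assume x: "x \<in> lie_part L a"
  have "\<exists>u. u \<in> gp j a \<and> f j - u \<in> gp j (a + 1)" for j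
  proof -
    have "f j \<in> gr j" using xf by (simp add: expansion_def)
    from gr_decompose'[OF this, of a] show ?thesis by auto
  qed
  then obtain g where g: "\<And>j. g j \<in> gp j a" "\<And>j. (f - g) j \<in> gp j (a + 1)"
    unfolding fun_diff_def by metis
  obtain y z where y: "expansion y g" and z: "expansion z (f - g)"
    using expansion_sums[of g] expansion_sums[of "f - g"] g by blast
  have "expansion (y + z) (g + (f - g))" by (rule expansion_add[OF y z])
  then have "x = y + z" using expansion_unique(2)[OF xf] by simp
  moreover have "y \<in> lie_part L a" "z \<in> lie_part L (a + 1)"
    using expansion_part_sum[OF y] expansion_part_sum[OF z] g by auto
  moreover have "z = x - y" using \<open>x = y + z\<close> by simp
  ultimately have "z \<in> lie_part L a" using x L_part_closed(2) by simp
  then have "z = 0"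
    using \<open>z \<in> lie_part L (a + 1)\<close> L_part_disjoint[of z] by (cases "a = 0") auto
  then have "f = g" using expansion_unique(1)[OF xf, of g] y \<open>x = y + z\<close> by simp
  then show "\<forall>j. f j \<in> gp j a" using g by simp
qed (use expansion_part_sum[OF xf] in blast)

text \<open>Multiply the partial sums.  The products \<open>[\<sigma> y, \<sigma> z] = \<sigma> [y, z]\<close> of degree less than \<open>N\<close> make up the
  partial sum of the Cauchy product, and the others lie in \<open>F N\<close>.\<close>

lemma expansion_bracket:
  assumes xf: "expansion x f" and yg: "expansion y g"
  shows "expansion (bl x y) (\<lambda>k. \<Sum>i\<in>{- int h..k + int h}. bg (f i) (g (k - i)))"
proof -
  have c: "x \<in> lie_carrier L" "y \<in> lie_carrier L" "\<And>j. f j \<in> gr j" "\<And>j. g j \<in> gr j"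
    using xf yg by (auto simp: expansion_def)
  define p where "p k = (\<Sum>i\<in>{- int h..k + int h}. bg (f i) (g (k - i)))" for k
  have p: "p k \<in> gr k" for k
    unfolding p_def using c by (intro gr_closed(5) gr_bracket) auto
  have "bl x y - partial_sum p N \<in> F N" for N
  proof -
    \<comment> \<open>The other factor may have degree \<open>-h\<close>, so the series are truncated \<open>h\<close> degrees after \<open>N\<close>.\<close>
    define M where "M = max (- int h) (N + int h)"
    define A where "A = {- int h..<M}"
    define x' y' where "x' = partial_sum f M" and "y' = partial_sum g M"
    have c': "x' \<in> lie_carrier L" "y' \<in> lie_carrier L"
      using c partial_sum_carrier by (auto simp: x'_def y'_def)
    have "bl (x - x') y \<in> F (M - int h)" "bl x' (y - y') \<in> F (M - int h)"
      using xf yg c c' F_low[of "- int h"]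
      by (auto simp: expansion_def x'_def y'_def intro!: F_bracket[of "x - partial_sum f M" M y "- int h"]
          F_bracket[of "partial_sum f M" "- int h" "y - partial_sum g M" M])
    then have "bl (x - x') y + bl x' (y - y') \<in> F (M - int h)" using F_closed(1) by blast
    moreover have "F (M - int h) \<subseteq> F N" by (rule F_antimono) (simp add: M_def)
    ultimately have 1: "bl x y - bl x' y' \<in> F N" using c c' by (auto simp: L_diff)
    have suml: "bl (sum u B) z = (\<Sum>i\<in>B. bl (u i) z)" "bl z (sum u B) = (\<Sum>i\<in>B. bl z (u i))"
      if "finite B" "\<And>i. i \<in> B \<Longrightarrow> u i \<in> lie_carrier L" "z \<in> lie_carrier L" for u B z
      using that by (induction B rule: finite_induct) (auto simp: L_zero L_add carrier_closed(5))
    have sc: "\<sigma> i (f i) \<in> lie_carrier L" "\<sigma> i (g i) \<in> lie_carrier L" for i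
      using c section_carrier[OF \<sigma>] by auto
    define t where "t = (\<lambda>(i, j). \<sigma> (i + j) (bg (f i) (g j)))"
    have "bl x' y' = (\<Sum>i\<in>A. \<Sum>j\<in>A. bl (\<sigma> i (f i)) (\<sigma> j (g j)))"
      unfolding x'_def y'_def partial_sum_def A_def[symmetric]
      using sc by (subst suml(1)) (auto simp: A_def intro!: carrier_closed(5) sum.cong suml(2))
    also have "\<dots> = sum t (A \<times> A)"
      using c by (simp add: hom sum.cartesian_product t_def)
    also have "A \<times> A = {q \<in> A \<times> A. fst q + snd q < N} \<union> {q \<in> A \<times> A. fst q + snd q \<ge> N}"
      by auto
    also have "sum t \<dots> = sum t {q \<in> A \<times> A. fst q + snd q < N} + sum t {q \<in> A \<times> A. fst q + snd q \<ge> N}"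
      by (rule sum.union_disjoint) (auto simp: A_def)
    finally have 2: "bl x' y' = sum t {q \<in> A \<times> A. fst q + snd q < N} + sum t {q \<in> A \<times> A. fst q + snd q \<ge> N}" .
    have "t q \<in> F N" if "fst q + snd q \<ge> N" for q
      using that section_F[OF \<sigma>, of "bg (f (fst q)) (g (snd q))" "fst q + snd q"] c
        gr_bracket[of "f (fst q)" "fst q" "g (snd q)" "snd q"] F_antimono[of N "fst q + snd q"]
      by (auto simp: t_def split_beta)
    then have 3: "sum t {q \<in> A \<times> A. fst q + snd q \<ge> N} \<in> F N" by (intro F_closed(6)) auto
    have t_low: "t q = 0" if "fst q + snd q < - int h" for q
      using gr_low[OF that gr_bracket[OF c(3,4) refl]] section_0[OF \<sigma>] by (simp add: t_def split_beta)
    have "partial_sum p N = (\<Sum>k\<in>{- int h..<N}. \<Sum>i\<in>{- int h..k + int h}. t (i, k - i))"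
      unfolding partial_sum_def p_def
      using c by (intro sum.cong refl, subst section_sum[OF \<sigma>]) (auto simp: t_def intro!: gr_bracket)
    also have "\<dots> = (\<Sum>(k, i)\<in>Sigma {- int h..<N} (\<lambda>k. {- int h..k + int h}). t (i, k - i))"
      by (simp add: sum.Sigma)
    also have "\<dots> = sum t {q \<in> A \<times> A. fst q + snd q < N \<and> - int h \<le> fst q + snd q}"
      by (rule sum.reindex_bij_witness[of _ "\<lambda>q. (fst q + snd q, fst q)" "\<lambda>(k, i). (i, k - i)"])
        (auto simp: A_def M_def)
    also have "\<dots> = sum t {q \<in> A \<times> A. fst q + snd q < N}"
      by (rule sum.mono_neutral_left) (auto simp: A_def intro!: t_low)
    finally have 4: "partial_sum p N = sum t {q \<in> A \<times> A. fst q + snd q < N}" .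
    have "bl x y - partial_sum p N = (bl x y - bl x' y') + sum t {q \<in> A \<times> A. fst q + snd q \<ge> N}"
      using 2 4 by simp
    then show ?thesis using 1 3 F_closed(1) by presburger
  qed
  then show ?thesis
    using carrier_bracket[OF c(1,2)] p unfolding expansion_def p_def by blast
qed

lemma filtered_isomorphism_expansion:
  "filtered_isomorphism L (completion h G) (\<lambda>x. THE f. expansion x f)"
proof -
  define \<Phi> where "\<Phi> x = (THE f. expansion x f)" for x
  have \<Phi>: "\<Phi> x = f" if "expansion x f" for x f
    unfolding \<Phi>_def using that expansion_unique(1)[OF that] by (blast intro: the_equality)
  have ex: "expansion x (\<Phi> x)" if "x \<in> lie_carrier L" for x
    using expansion_exists[OF that] \<Phi> by metis
  have inv: "\<exists>x. expansion x f \<and> x \<in> lie_carrier L \<and> \<Phi> x = f" if "\<And>j. f j \<in> gr j" for f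
    using expansion_sums[of f] that \<Phi> unfolding expansion_def by blast
  have gr: "\<Phi> x j \<in> gr j" if "x \<in> lie_carrier L" for x j
    using ex[OF that] by (simp add: expansion_def)
  have "filtered_isomorphism L (completion h G) \<Phi>"
    unfolding filtered_isomorphism_def
  proof (intro conjI allI ballI)
    show "bij_betw \<Phi> (lie_carrier L) (lie_carrier (completion h G))"
      unfolding bij_betw_def
    proof
      show "inj_on \<Phi> (lie_carrier L)"
        by (rule inj_onI) (metis ex expansion_unique(2))
      show "\<Phi> ` lie_carrier L = lie_carrier (completion h G)"
        using gr inv by (auto simp: completion_def) (metis imageI)
    qed
    fix x assume x: "x \<in> lie_carrier L"
    show "\<Phi> (sL c x) = lie_scale (completion h G) c (\<Phi> x)" for c
      using \<Phi>[OF expansion_scale[OF ex[OF x]]] by (simp add: completion_def)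
    fix y assume y: "y \<in> lie_carrier L"
    show "\<Phi> (x + y) = \<Phi> x + \<Phi> y"
      using \<Phi>[OF expansion_add[OF ex[OF x] ex[OF y]]] .
    show "\<Phi> (bl x y) = lie_bracket (completion h G) (\<Phi> x) (\<Phi> y)"
      using \<Phi>[OF expansion_bracket[OF ex[OF x] ex[OF y]]] by (simp add: completion_def)
  next
    fix a
    have "\<Phi> ` lie_part L a = {f. \<forall>j. f j \<in> gp j a}"
    proof
      show "\<Phi> ` lie_part L a \<subseteq> {f. \<forall>j. f j \<in> gp j a}"
        using expansion_part[OF ex] L_part_carrier by blast
      show "{f. \<forall>j. f j \<in> gp j a} \<subseteq> \<Phi> ` lie_part L a"
      proof
        fix f assume f: "f \<in> {f. \<forall>j. f j \<in> gp j a}"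
        then obtain x where "expansion x f" "\<Phi> x = f" using inv[of f] by blast
        then show "f \<in> \<Phi> ` lie_part L a" using expansion_part f by blast
      qed
    qed
    then show "\<Phi> ` lie_part L a = lie_part (completion h G) a" by (simp add: completion_def)
  next
    fix j
    have "\<Phi> ` F j = {f. (\<forall>i. f i \<in> gr i) \<and> (\<forall>i<j. f i = 0)}"
    proof
      show "\<Phi> ` F j \<subseteq> {f. (\<forall>i. f i \<in> gr i) \<and> (\<forall>i<j. f i = 0)}"
        using expansion_filt[OF ex] F_carrier gr by blast
      show "{f. (\<forall>i. f i \<in> gr i) \<and> (\<forall>i<j. f i = 0)} \<subseteq> \<Phi> ` F j"
      proof
        fix f assume f: "f \<in> {f. (\<forall>i. f i \<in> gr i) \<and> (\<forall>i<j. f i = 0)}"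
        then obtain x where "expansion x f" "\<Phi> x = f" using inv[of f] by blast
        then show "f \<in> \<Phi> ` F j" using expansion_filt f by blast
      qed
    qed
    then show "\<Phi> ` F j = filt (completion h G) j" by (simp add: completion_def)
  qed
  then show ?thesis by (simp add: \<Phi>_def[abs_def])
qed

end

end

text \<open>The standard criterion: only the part of \<open>H\<^sup>2(G, G)\<close> that is even and of positive degree
  can obstruct triviality.\<close>

theorem trivial_deformation_if_no_cohomology:
  assumes "filtered_deformation h G L" and "vector_space (lie_scale G)"
    and "\<And>k \<mu>. graded_jacobi G \<Longrightarrow> k > 0 \<Longrightarrow> even_2_cocycle G k \<mu> \<Longrightarrow>
      \<exists>\<psi>. even_1_cochain G k \<psi> \<and> is_coboundary_of G \<mu> \<psi>"
  shows "trivial_deformation h G L"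
proof -
  obtain \<phi> where "filtered_lie_superalgebra h L" "gr_isomorphism L G \<phi>"
    using assms(1) by (auto simp: filtered_deformation_def)
  then interpret graded_deformation h G L \<phi>
    using assms(2) by (intro graded_deformation.intro)
  obtain \<sigma> where "even_section \<sigma>"
    "\<And>i j y z. y \<in> gr i \<Longrightarrow> z \<in> gr j \<Longrightarrow> bl (\<sigma> i y) (\<sigma> j z) = \<sigma> (i + j) (bg y z)"
    using exact_section[OF assms(3)[OF G_jacobi]] by blast
  from filtered_isomorphism_expansion[OF this] show ?thesis
    unfolding trivial_deformation_def by blast
qed

section \<open>Derivatives and multiplications by coordinates\<close>

lemma vector_space_sp_scale: "vector_space sp_scale"
  by unfold_locales (auto intro!: poly_mapping_eqI simp: lookup_sp_scale lookup_add algebra_simps)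

interpretation SP: vector_space sp_scale by (rule vector_space_sp_scale)

definition xi_sign :: "nat \<Rightarrow> nat set \<Rightarrow> complex" where
  "xi_sign i I = (- 1) ^ card {j \<in> I. j < i}"

lemma xi_sign_insert: "xi_sign i (insert j I) = (if j < i \<and> j \<notin> I then - xi_sign i I else xi_sign i I)"
proof -
  have "{l \<in> insert j I. l < i} = (if j < i then insert j {l \<in> I. l < i} else {l \<in> I. l < i})" by auto
  moreover have "finite {l \<in> I. l < i}" by (rule finite_subset[of _ "{..<i}"]) auto
  ultimately show ?thesis by (auto simp: xi_sign_def insert_absorb)
qed

lemma xi_sign_remove: "xi_sign i (I - {j}) = (if j < i \<and> j \<in> I then - xi_sign i I else xi_sign i I)"
  using xi_sign_insert[of i j "I - {j}"] by (cases "j \<in> I") (auto simp: insert_absorb)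

lemma xi_sign_square [simp]: "xi_sign i I * xi_sign i I = 1" "xi_sign i I * (xi_sign i I * c) = c"
  by (simp_all add: xi_sign_def power_mult_distrib[symmetric] mult.assoc[symmetric])

abbreviation "lookup \<equiv> Poly_Mapping.lookup"
abbreviation "keys \<equiv> Poly_Mapping.keys"
abbreviation "single \<equiv> Poly_Mapping.single"

lemma sum_keys_delta:
  fixes f :: "'a \<Rightarrow>\<^sub>0 complex"
  assumes "\<And>m. m \<noteq> k \<Longrightarrow> F m = 0" and "lookup f k = 0 \<Longrightarrow> F k = 0"
  shows "(\<Sum>m\<in>keys f. F m) = (F k :: complex)"
proof -
  have "(\<Sum>m\<in>keys f. F m) = (\<Sum>m\<in>keys f. if m = k then F k else 0)"
    by (intro sum.cong) (auto simp: assms)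
  then show ?thesis using assms(2) by (auto simp: in_keys_iff)
qed

lemma minus_single_eq_iff:
  fixes a b :: "nat \<Rightarrow>\<^sub>0 nat"
  assumes "lookup b i \<noteq> 0"
  shows "b - single i 1 = a \<longleftrightarrow> b = a + single i 1"
proof
  assume "b - single i 1 = a"
  then show "b = a + single i 1"
    using assms by (auto intro!: poly_mapping_eqI simp: lookup_add lookup_minus lookup_single when_def)
qed (simp add: poly_mapping_eqI lookup_add lookup_minus)

lemma lookup_d_x:
  "lookup (d_x i f) (a, I) =
     of_nat (lookup a i + 1) * lookup f (a + single i 1, I)"
proof -
  have "lookup (d_x i f) (a, I) = (\<Sum>m\<in>keys f.
      lookup (single (fst m - single i 1, snd m)
        (of_nat (lookup (fst m) i) * lookup f m)) (a, I))"
    by (simp add: d_x_def lookup_sum split_beta)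
  also have "\<dots> = lookup (single (a, I)
        (of_nat (lookup a i + 1) * lookup f (a + single i 1, I))) (a, I)"
  proof (subst sum_keys_delta[where k = "(a + single i 1, I)"])
    fix m :: super_mono assume "m \<noteq> (a + single i 1, I)"
    then show "lookup (single (fst m - single i 1, snd m)
        (of_nat (lookup (fst m) i) * lookup f m)) (a, I) = 0"
      using minus_single_eq_iff[of "fst m" i a]
      by (cases m; cases "lookup (fst m) i = 0") (auto simp: lookup_single when_def)
  qed (simp_all add: lookup_add)
  finally show ?thesis by simp
qed

lemma lookup_d_xi:
  "lookup (d_xi i f) (a, I) =
     (if i \<in> I then 0 else xi_sign i I * lookup f (a, insert i I))"
proof -
  have "lookup (d_xi i f) (a, I) = (\<Sum>m\<in>keys f.
      lookup (if i \<in> snd m then single (fst m, snd m - {i})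
        ((- 1) ^ card {j \<in> snd m. j < i} * lookup f m) else 0) (a, I))"
    by (simp add: d_xi_def lookup_sum split_beta cong: if_cong)
  also have "\<dots> = (if i \<in> I then 0 else lookup (single (a, insert i I - {i})
        ((- 1) ^ card {j \<in> insert i I. j < i} * lookup f (a, insert i I))) (a, I))"
  proof (subst sum_keys_delta[where k = "(a, insert i I)"])
    fix m :: super_mono assume "m \<noteq> (a, insert i I)"
    then show "lookup (if i \<in> snd m then single (fst m, snd m - {i})
        ((- 1) ^ card {j \<in> snd m. j < i} * lookup f m) else 0) (a, I) = 0"
      by (cases m) (auto simp: lookup_single when_def insert_absorb)
  qed (auto simp: lookup_single when_def)
  also have "{j \<in> insert i I. j < i} = {j \<in> I. j < i}" by auto
  finally show ?thesis by (auto simp: xi_sign_def lookup_single when_def)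
qed

definition mul_x :: "nat \<Rightarrow> super_poly \<Rightarrow> super_poly" where
  "mul_x i f = (\<Sum>(a, I)\<in>keys f.
     single (a + single i 1, I) (lookup f (a, I)))"

text \<open>Multiplication from the left; the sign comes from moving \<open>\<xi>\<^sub>i\<close> to its place in the increasing order.\<close>

definition mul_xi :: "nat \<Rightarrow> super_poly \<Rightarrow> super_poly" where
  "mul_xi i f = (\<Sum>(a, I)\<in>keys f.
     if i \<in> I then 0
     else single (a, insert i I) ((- 1) ^ card {j \<in> I. j < i} * lookup f (a, I)))"

lemma lookup_mul_x:
  "lookup (mul_x i f) (a, I) =
     (if lookup a i = 0 then 0 else lookup f (a - single i 1, I))"
proof -
  have eq: "a = b + single i 1 \<longleftrightarrow> b = a - single i 1"
    if "lookup a i \<noteq> 0" for b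
    using minus_single_eq_iff[OF that] by auto
  have neq: "a \<noteq> b + single i 1" if "lookup a i = 0" for b
    using that by (auto simp: lookup_add)
  have "lookup (mul_x i f) (a, I) = (\<Sum>m\<in>keys f.
      lookup (single (fst m + single i 1, snd m)
        (lookup f m)) (a, I))"
    by (simp add: mul_x_def lookup_sum split_beta)
  also have "\<dots> = (if lookup a i = 0 then 0 else lookup f (a - single i 1, I))"
  proof (cases "lookup a i = 0")
    case True
    then show ?thesis
      by (auto intro!: sum.neutral simp: lookup_single when_def neq[OF True, symmetric] simp del: One_nat_def)
  next
    case False
    have "fst m + single i 1 = a \<and> snd m = I \<longleftrightarrow> m = (a - single i 1, I)" for m
      using eq[OF False, of "fst m"] by (cases m) auto
    moreover have "a - single i 1 + single i 1 = a"
      using eq[OF False, of "a - single i 1"] by simp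
    ultimately show ?thesis
      using False by (subst sum_keys_delta[where k = "(a - single i 1, I)"])
        (auto simp: lookup_single when_def)
  qed
  finally show ?thesis .
qed

lemma lookup_mul_xi:
  "lookup (mul_xi i f) (a, I) =
     (if i \<in> I then xi_sign i I * lookup f (a, I - {i}) else 0)"
proof -
  have "lookup (mul_xi i f) (a, I) = (\<Sum>m\<in>keys f.
      lookup (if i \<in> snd m then 0 else single (fst m, insert i (snd m))
        ((- 1) ^ card {j \<in> snd m. j < i} * lookup f m)) (a, I))"
    by (simp add: mul_xi_def lookup_sum split_beta cong: if_cong)
  also have "\<dots> = (if i \<in> I then lookup (single (a, insert i (I - {i}))
        ((- 1) ^ card {j \<in> I - {i}. j < i} * lookup f (a, I - {i}))) (a, I) else 0)"
  proof (subst sum_keys_delta[where k = "(a, I - {i})"])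
    fix m :: super_mono assume "m \<noteq> (a, I - {i})"
    then show "lookup (if i \<in> snd m then 0 else single (fst m, insert i (snd m))
        ((- 1) ^ card {j \<in> snd m. j < i} * lookup f m)) (a, I) = 0"
      by (cases m) (auto simp: lookup_single when_def)
  qed (auto simp: lookup_single when_def)
  also have "{j \<in> I - {i}. j < i} = {j \<in> I. j < i}" by auto
  finally show ?thesis by (auto simp: xi_sign_def lookup_single when_def insert_absorb)
qed

lemmas lookup_ops = lookup_d_x lookup_d_xi lookup_mul_x lookup_mul_xi lookup_parity_twist
  lookup_add lookup_minus lookup_uminus lookup_sp_scale

lemma super_poly_eqI: "(\<And>a I. lookup f (a, I) = lookup g (a, I)) \<Longrightarrow> f = g"
  for f g :: super_poly
  by (rule poly_mapping_eqI) auto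

text \<open>The coordinate with index \<open>u = (i, p)\<close> is \<open>x\<^sub>i\<close> if \<open>p = 0\<close> and \<open>\<xi>\<^sub>i\<close> if \<open>p = 1\<close>, so \<open>p\<close> is its
  parity in \<open>\<Lambda>(n,n)\<close>.\<close>

definition deriv_op :: "nat \<times> bit \<Rightarrow> super_poly \<Rightarrow> super_poly" where
  "deriv_op u = (if snd u = 0 then d_x (fst u) else d_xi (fst u))"

definition mult_op :: "nat \<times> bit \<Rightarrow> super_poly \<Rightarrow> super_poly" where
  "mult_op u = (if snd u = 0 then mul_x (fst u) else mul_xi (fst u))"

abbreviation coord_sign :: "nat \<times> bit \<Rightarrow> nat \<times> bit \<Rightarrow> complex" where
  "coord_sign u v \<equiv> parity_sign (snd u) (snd v)"

definition coords :: "nat \<Rightarrow> (nat \<times> bit) set" where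
  "coords n = {1..n} \<times> {0, 1}"

lemma finite_coords [simp]: "finite (coords n)"
  unfolding coords_def by simp

lemma sum_coords: "(\<Sum>u\<in>coords n. F u) = (\<Sum>i\<in>{1..n}. F (i, 0) + F (i, 1))"
proof -
  have "(\<Sum>u\<in>coords n. F u) = (\<Sum>i\<in>{1..n}. \<Sum>p\<in>{0, 1}. F (i, p))"
    unfolding coords_def by (simp only: sum.cartesian_product case_prod_eta)
  then show ?thesis by simp
qed

lemma deriv_op_linear:
  "deriv_op u (f + g) = deriv_op u f + deriv_op u g"
  "deriv_op u (f - g) = deriv_op u f - deriv_op u g"
  "deriv_op u (- f) = - deriv_op u f"
  "deriv_op u (sp_scale c f) = sp_scale c (deriv_op u f)"
  "deriv_op u 0 = 0"
  by (auto intro!: super_poly_eqI simp: deriv_op_def lookup_ops algebra_simps)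

lemma mult_op_linear:
  "mult_op u (f + g) = mult_op u f + mult_op u g"
  "mult_op u (f - g) = mult_op u f - mult_op u g"
  "mult_op u (- f) = - mult_op u f"
  "mult_op u (sp_scale c f) = sp_scale c (mult_op u f)"
  "mult_op u 0 = 0"
  by (auto intro!: super_poly_eqI simp: mult_op_def lookup_ops algebra_simps)

lemma deriv_op_sum: "deriv_op u (sum f A) = (\<Sum>i\<in>A. deriv_op u (f i))"
  by (induction A rule: infinite_finite_induct) (simp_all add: deriv_op_linear)

lemma deriv_op_commute: "deriv_op u (deriv_op v f) = sp_scale (coord_sign u v) (deriv_op v (deriv_op u f))"
proof (rule super_poly_eqI)
  fix a :: "nat \<Rightarrow>\<^sub>0 nat" and I
  obtain i p j q where uv: "u = (i, p)" "v = (j, q)" by (metis surj_pair)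
  show "lookup (deriv_op u (deriv_op v f)) (a, I) =
      lookup (sp_scale (coord_sign u v) (deriv_op v (deriv_op u f))) (a, I)"
    by (cases "p = 0"; cases "q = 0"; cases i j rule: linorder_cases)
      (auto simp: uv deriv_op_def parity_sign_def lookup_ops xi_sign_insert insert_commute ac_simps
        lookup_single when_def)
qed

lemma deriv_mult_commute:
  "deriv_op u (mult_op v f) = (if u = v then f else 0) + sp_scale (coord_sign u v) (mult_op v (deriv_op u f))"
proof (rule super_poly_eqI)
  fix a :: "nat \<Rightarrow>\<^sub>0 nat" and I
  obtain i p j q where uv: "u = (i, p)" "v = (j, q)" by (metis surj_pair)
  have minus: "a + single i 1 - single j 1 = a - single j 1 + single i 1"
    if "i \<noteq> j"
    using that by (intro poly_mapping_eqI) (auto simp: lookup_add lookup_minus lookup_single when_def)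
  show "lookup (deriv_op u (mult_op v f)) (a, I) =
      lookup ((if u = v then f else 0) + sp_scale (coord_sign u v) (mult_op v (deriv_op u f))) (a, I)"
  proof (cases "p = 0 \<and> q = 0")
    case True
    have "a - single i 1 + single i 1 = a" if "lookup a i \<noteq> 0"
      using minus_single_eq_iff[OF that] by metis
    then show ?thesis using True minus
      by (cases "i = j") (auto simp: uv deriv_op_def mult_op_def parity_sign_def lookup_ops lookup_single when_def algebra_simps of_nat_diff)
  next
    case False
    then show ?thesis
    proof (cases "p = 1 \<and> q = 1")
      case True
      show ?thesis
      proof (cases i j rule: linorder_cases)
        case equal
        then show ?thesis using True
          by (auto simp: uv deriv_op_def mult_op_def parity_sign_def lookup_ops insert_absorb xi_sign_insert xi_sign_remove)
      next
        case less
        then show ?thesis using True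
          by (auto simp: uv deriv_op_def mult_op_def parity_sign_def lookup_ops xi_sign_insert xi_sign_remove insert_Diff_if)
      next
        case greater
        then show ?thesis using True
          by (auto simp: uv deriv_op_def mult_op_def parity_sign_def lookup_ops xi_sign_insert xi_sign_remove insert_Diff_if)
      qed
    next
      case F: False
      then show ?thesis using False
        by (cases "p = 0"; cases "q = 0") (auto simp: uv deriv_op_def mult_op_def parity_sign_def lookup_ops lookup_single when_def)
    qed
  qed
qed

lemma parity_twist_linear:
  "parity_twist (f + g) = parity_twist f + parity_twist g"
  "parity_twist (- f) = - parity_twist f"
  by (auto intro!: super_poly_eqI simp: lookup_ops algebra_simps)

section \<open>Homogeneous polynomials\<close>

lemma x_degree_superset:
  "finite K \<Longrightarrow> keys a \<subseteq> K \<Longrightarrow> x_degree a = (\<Sum>i\<in>K. lookup a i)"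
  unfolding x_degree_def by (rule sum.mono_neutral_left) (auto simp: in_keys_iff)

lemma x_degree_add: "x_degree (a + b) = x_degree a + x_degree b"
proof -
  let ?K = "keys a \<union> keys b"
  have "x_degree (a + b) = (\<Sum>i\<in>?K. lookup (a + b) i)"
    using Poly_Mapping.keys_add[of a b] by (intro x_degree_superset) auto
  then show ?thesis
    by (simp add: x_degree_superset[of ?K] lookup_add sum.distrib)
qed

lemma x_degree_single [simp]: "x_degree (single i c) = c"
  by (simp add: x_degree_def)

lemma x_degree_remove:
  assumes "lookup a i \<noteq> 0"
  shows "x_degree a = x_degree (a - single i 1) + 1"
proof -
  have "a = (a - single i 1) + single i 1"
    using minus_single_eq_iff[OF assms] by blast
  then have "x_degree a = x_degree ((a - single i 1) + single i 1)" by simp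
  then show ?thesis unfolding x_degree_add x_degree_single .
qed

lemma keys_add_nat: "keys (a + b) = keys a \<union> keys b"
  for a b :: "'a \<Rightarrow>\<^sub>0 nat"
  by (auto simp: in_keys_iff lookup_add)

text \<open>The polynomials of degree \<open>j\<close> in the gradation of \<open>SHO\<close>.\<close>

definition homog :: "nat \<Rightarrow> int \<Rightarrow> super_poly set" where
  "homog n j = {f. \<forall>a I. lookup f (a, I) \<noteq> 0 \<longrightarrow>
     keys a \<subseteq> {1..n} \<and> I \<subseteq> {1..n} \<and> int (x_degree a) + int (card I) - 2 = j}"

text \<open>The parity is the reversed one of \<open>SHO\<close>, so that \<open>x\<^sub>i\<close> is odd and \<open>\<xi>\<^sub>i\<close> is even.\<close>

definition has_parity :: "bit \<Rightarrow> super_poly set" where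
  "has_parity p = {f. \<forall>a I. lookup f (a, I) \<noteq> 0 \<longrightarrow> of_nat (card I) + 1 = p}"

lemma homogD:
  assumes "f \<in> homog n j" "lookup f (a, I) \<noteq> 0"
  shows "keys a \<subseteq> {1..n}" "I \<subseteq> {1..n}" "finite I" "int (x_degree a) + int (card I) - 2 = j"
proof -
  show "keys a \<subseteq> {1..n}" "I \<subseteq> {1..n}" "int (x_degree a) + int (card I) - 2 = j"
    using assms by (auto simp: homog_def)
  then show "finite I" by (meson finite_atLeastAtMost finite_subset)
qed

lemma homog_Lam: "f \<in> homog n j \<Longrightarrow> f \<in> Lam n"
  using homogD(1,2) unfolding Lam_def in_keys_iff by fast

lemma supported_subspace:
  "SP.subspace {f :: super_poly. \<forall>a I. lookup f (a, I) \<noteq> 0 \<longrightarrow> Q a I}"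
proof (rule SP.subspaceI)
  fix f g :: super_poly assume "f \<in> {f. \<forall>a I. lookup f (a, I) \<noteq> 0 \<longrightarrow> Q a I}"
    and "g \<in> {f. \<forall>a I. lookup f (a, I) \<noteq> 0 \<longrightarrow> Q a I}"
  moreover have "lookup f (a, I) \<noteq> 0 \<or> lookup g (a, I) \<noteq> 0"
    if "lookup (f + g) (a, I) \<noteq> 0" for a I
    using that by (auto simp: lookup_add)
  ultimately show "f + g \<in> {f. \<forall>a I. lookup f (a, I) \<noteq> 0 \<longrightarrow> Q a I}" by blast
qed (auto simp: lookup_sp_scale)

lemma homog_subspace: "SP.subspace (homog n j)"
  unfolding homog_def by (rule supported_subspace)

lemma has_parity_subspace: "SP.subspace (has_parity p)"
  unfolding has_parity_def by (rule supported_subspace)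

lemmas homog_closed = SP.subspace_add[OF homog_subspace] SP.subspace_diff[OF homog_subspace]
  SP.subspace_scale[OF homog_subspace] SP.subspace_0[OF homog_subspace]
  SP.subspace_neg[OF homog_subspace] SP.subspace_sum[OF homog_subspace]

lemmas has_parity_closed = SP.subspace_add[OF has_parity_subspace] SP.subspace_diff[OF has_parity_subspace]
  SP.subspace_scale[OF has_parity_subspace] SP.subspace_0[OF has_parity_subspace]
  SP.subspace_neg[OF has_parity_subspace] SP.subspace_sum[OF has_parity_subspace]

lemma homog_low: assumes "f \<in> homog n j" "j < - 2" shows "f = 0"
proof (rule super_poly_eqI)
  fix a I show "lookup f (a, I) = lookup 0 (a, I)"
    using homogD(4)[OF assms(1), of a I] assms(2) by (cases "lookup f (a, I) = 0") auto
qed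

lemma deriv_op_homog: assumes f: "f \<in> homog n j" shows "deriv_op u f \<in> homog n (j - 1)"
proof -
  have "d_x i f \<in> homog n (j - 1)" for i
    unfolding homog_def
  proof (intro CollectI allI impI)
    fix a I assume "lookup (d_x i f) (a, I) \<noteq> 0"
    then have "lookup f (a + single i 1, I) \<noteq> 0"
      by (auto simp: lookup_d_x)
    note h = homogD[OF f this]
    have "x_degree (a + single i 1) = x_degree a + 1"
      unfolding x_degree_add x_degree_single ..
    then show "keys a \<subseteq> {1..n} \<and> I \<subseteq> {1..n} \<and> int (x_degree a) + int (card I) - 2 = j - 1"
      using h unfolding keys_add_nat by auto
  qed
  moreover have "d_xi i f \<in> homog n (j - 1)" for i
    unfolding homog_def
  proof (intro CollectI allI impI)
    fix a I assume "lookup (d_xi i f) (a, I) \<noteq> 0"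
    then have "i \<notin> I" "lookup f (a, insert i I) \<noteq> 0"
      by (auto simp: lookup_d_xi split: if_splits)
    then show "keys a \<subseteq> {1..n} \<and> I \<subseteq> {1..n} \<and> int (x_degree a) + int (card I) - 2 = j - 1"
      using homogD[OF f, of a "insert i I"] by auto
  qed
  ultimately show ?thesis by (simp add: deriv_op_def)
qed

lemma mult_op_homog:
  assumes f: "f \<in> homog n j" and u: "u \<in> coords n"
  shows "mult_op u f \<in> homog n (j + 1)"
proof -
  have "mul_x i f \<in> homog n (j + 1)" if i: "i \<in> {1..n}" for i
    unfolding homog_def
  proof (intro CollectI allI impI)
    fix a I assume "lookup (mul_x i f) (a, I) \<noteq> 0"
    then have *: "lookup a i \<noteq> 0" "lookup f (a - single i 1, I) \<noteq> 0"
      by (auto simp: lookup_mul_x split: if_splits)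
    then have "a = (a - single i 1) + single i 1"
      using minus_single_eq_iff by blast
    then have "keys a \<subseteq> insert i (keys (a - single i 1))"
      using keys_add_nat[of "a - single i 1" "single i 1"] by auto
    then show "keys a \<subseteq> {1..n} \<and> I \<subseteq> {1..n} \<and> int (x_degree a) + int (card I) - 2 = j + 1"
      using homogD[OF f *(2)] x_degree_remove[OF *(1)] i by auto
  qed
  moreover have "mul_xi i f \<in> homog n (j + 1)" if i: "i \<in> {1..n}" for i
    unfolding homog_def
  proof (intro CollectI allI impI)
    fix a I assume "lookup (mul_xi i f) (a, I) \<noteq> 0"
    then have *: "i \<in> I" "lookup f (a, I - {i}) \<noteq> 0"
      by (auto simp: lookup_mul_xi split: if_splits)
    then have "card I = card (I - {i}) + 1" using homogD(3)[OF f *(2)] card_Suc_Diff1[of I i] by simp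
    then show "keys a \<subseteq> {1..n} \<and> I \<subseteq> {1..n} \<and> int (x_degree a) + int (card I) - 2 = j + 1"
      using homogD[OF f *(2)] i by auto
  qed
  ultimately show ?thesis using u by (auto simp: mult_op_def coords_def)
qed

lemma deriv_op_parity: assumes "f \<in> has_parity p" "f \<in> homog n j" shows "deriv_op u f \<in> has_parity (p + snd u)"
proof (cases "snd u = 0")
  case True
  then show ?thesis using assms(1) by (auto simp: has_parity_def deriv_op_def lookup_d_x)
next
  case False
  have "of_nat (card I) + 1 = p + 1" if "lookup (d_xi (fst u) f) (a, I) \<noteq> 0" for a I
  proof -
    have *: "fst u \<notin> I" "lookup f (a, insert (fst u) I) \<noteq> 0"
      using that by (auto simp: lookup_d_xi split: if_splits)
    then have "finite I" using homogD(3)[OF assms(2) *(2)] by simp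
    then have "card (insert (fst u) I) = Suc (card I)" using *(1) by simp
    moreover have "of_nat (card (insert (fst u) I)) + 1 = p"
      using assms(1) *(2) unfolding has_parity_def by blast
    ultimately show ?thesis by (cases p; simp)
  qed
  then show ?thesis using False by (simp add: has_parity_def deriv_op_def)
qed

lemma mult_op_parity: assumes "f \<in> has_parity p" "f \<in> homog n j" shows "mult_op u f \<in> has_parity (p + snd u)"
proof (cases "snd u = 0")
  case True
  then show ?thesis using assms(1) by (auto simp: has_parity_def mult_op_def lookup_mul_x split: if_splits)
next
  case False
  have "of_nat (card I) + 1 = p + 1" if "lookup (mul_xi (fst u) f) (a, I) \<noteq> 0" for a I
  proof -
    have *: "fst u \<in> I" "lookup f (a, I - {fst u}) \<noteq> 0"
      using that by (auto simp: lookup_mul_xi split: if_splits)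
    then have "card I = Suc (card (I - {fst u}))"
      using homogD(3)[OF assms(2) *(2)] card_Suc_Diff1[of I "fst u"] by simp
    moreover have "of_nat (card (I - {fst u})) + 1 = p"
      using assms(1) *(2) unfolding has_parity_def by blast
    ultimately show ?thesis by (simp add: add.commute)
  qed
  then show ?thesis using False by (simp add: has_parity_def mult_op_def)
qed

text \<open>The Euler vector field multiplies a polynomial by its total degree, which is \<open>j + 2\<close> in degree \<open>j\<close>.\<close>

lemma euler_identity:
  assumes f: "f \<in> homog n j"
  shows "(\<Sum>u\<in>coords n. mult_op u (deriv_op u f)) = sp_scale (of_int (j + 2)) f"
proof (rule super_poly_eqI)
  fix a :: "nat \<Rightarrow>\<^sub>0 nat" and I
  have 1: "lookup (mul_x i (d_x i f)) (a, I) = of_nat (lookup a i) * lookup f (a, I)" for i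
    using minus_single_eq_iff[of a i "a - single i 1"]
    by (auto simp: lookup_ops lookup_single)
  have 2: "lookup (mul_xi i (d_xi i f)) (a, I) = (if i \<in> I then 1 else 0) * lookup f (a, I)" for i
    by (auto simp: lookup_ops xi_sign_remove insert_absorb)
  have "lookup (\<Sum>u\<in>coords n. mult_op u (deriv_op u f)) (a, I) =
      (\<Sum>i\<in>{1..n}. of_nat (lookup a i) + (if i \<in> I then 1 else 0)) * lookup f (a, I)"
    by (simp add: sum_coords lookup_sum lookup_add mult_op_def deriv_op_def 1 2 sum_distrib_right distrib_right)
  also have "\<dots> = of_int (j + 2) * lookup f (a, I)"
  proof (cases "lookup f (a, I) = 0")
    case False
    note h = homogD[OF f False]
    have "(\<Sum>i\<in>{1..n}. of_nat (lookup a i) :: complex) = of_nat (x_degree a)"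
      using x_degree_superset[of "{1..n}" a] h(1) by simp
    moreover have "(\<Sum>i\<in>{1..n}. if i \<in> I then 1 else 0 :: complex) = of_nat (card I)"
    proof -
      have "{1..n} \<inter> I = I" using h(2) by auto
      then show ?thesis by (simp add: sum.If_cases Int_commute)
    qed
    moreover have "of_int (j + 2) = (of_nat (x_degree a) + of_nat (card I) :: complex)"
    proof -
      have "j + 2 = int (x_degree a) + int (card I)" using h(4) by simp
      then show ?thesis by simp
    qed
    ultimately show ?thesis by (simp add: sum.distrib)
  qed simp
  finally show "lookup (\<Sum>u\<in>coords n. mult_op u (deriv_op u f)) (a, I) =
      lookup (sp_scale (of_int (j + 2)) f) (a, I)"
    by (simp add: lookup_sp_scale)
qed

text \<open>By Euler's identity a polynomial without constant term vanishes if all its derivatives do.\<close>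

lemma derivatives_zero:
  assumes "f \<in> homog n j" "j \<noteq> - 2" "\<And>u. u \<in> coords n \<Longrightarrow> deriv_op u f = 0"
  shows "f = 0"
proof -
  have "sp_scale (of_int (j + 2)) f = 0"
    using euler_identity[OF assms(1)] assms(3) by (simp add: mult_op_linear(5))
  moreover have "of_int (j + 2) \<noteq> (0 :: complex)" unfolding of_int_eq_0_iff using assms(2) by simp
  ultimately show ?thesis by simp
qed

text \<open>The primitive that the Poincare lemma gives for the 1-form \<open>c\<close>.  The factor \<open>d\<close> is the total degree
  of the primitive; the coefficients have total degree \<open>d - 1\<close>, that is, degree \<open>d - 3\<close> in the
  gradation.\<close>

definition primitive :: "nat \<Rightarrow> int \<Rightarrow> (nat \<times> bit \<Rightarrow> super_poly) \<Rightarrow> super_poly" where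
  "primitive n d c = sp_scale (1 / of_int d) (\<Sum>u\<in>coords n. mult_op u (c u))"

text \<open>Since \<open>c\<close> is closed, the derivative of \<open>\<Sum> w c\<^sub>w\<close> along \<open>u\<close> is \<open>c\<^sub>u + \<Sum> w \<partial>\<^sub>w c\<^sub>u\<close>, and the second term is
  \<open>(d - 1) c\<^sub>u\<close> by Euler's identity.\<close>

lemma deriv_op_primitive:
  assumes c: "\<And>u. u \<in> coords n \<Longrightarrow> c u \<in> homog n (d - 3)" and d: "d > 0"
    and closed: "\<And>u v. u \<in> coords n \<Longrightarrow> v \<in> coords n \<Longrightarrow>
      deriv_op u (c v) = sp_scale (coord_sign u v) (deriv_op v (c u))"
    and u: "u \<in> coords n"
  shows "deriv_op u (primitive n d c) = c u"
proof -
  have "deriv_op u (\<Sum>v\<in>coords n. mult_op v (c v)) =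
      (\<Sum>v\<in>coords n. (if u = v then c v else 0) + sp_scale (coord_sign u v) (mult_op v (deriv_op u (c v))))"
    by (simp add: deriv_op_sum deriv_mult_commute)
  also have "\<dots> = (\<Sum>v\<in>coords n. (if u = v then c v else 0) + mult_op v (deriv_op v (c u)))"
  proof (rule sum.cong[OF refl])
    fix v assume v: "v \<in> coords n"
    have "coord_sign u v * coord_sign u v = 1" by (simp add: parity_sign_def)
    then show "(if u = v then c v else 0) + sp_scale (coord_sign u v) (mult_op v (deriv_op u (c v))) =
        (if u = v then c v else 0) + mult_op v (deriv_op v (c u))"
      by (simp add: closed[OF u v] mult_op_linear)
  qed
  also have "\<dots> = c u + sp_scale (of_int (d - 3 + 2)) (c u)"
    using u by (simp add: sum.distrib euler_identity[OF c[OF u]] sum.delta)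
  also have "\<dots> = sp_scale (of_int d) (c u)"
    using SP.scale_left_distrib[of 1 "of_int (d - 1)" "c u"] by simp
  finally show ?thesis
    using d by (simp add: primitive_def deriv_op_linear)
qed

lemma primitive_homog:
  assumes "\<And>u. u \<in> coords n \<Longrightarrow> c u \<in> homog n j"
  shows "primitive n d c \<in> homog n (j + 1)"
  unfolding primitive_def by (intro homog_closed(3,6) mult_op_homog assms)

lemma primitive_parity:
  assumes "\<And>u. u \<in> coords n \<Longrightarrow> c u \<in> homog n j" "\<And>u. u \<in> coords n \<Longrightarrow> c u \<in> has_parity (p + snd u)"
  shows "primitive n d c \<in> has_parity p"
proof -
  have "mult_op u (c u) \<in> has_parity p" if "u \<in> coords n" for u
  proof -
    have "p + snd u + snd u = p" by (cases p; cases "snd u"; simp)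
    then show ?thesis using mult_op_parity[OF assms(2) assms(1), OF that that, of u] by metis
  qed
  then show ?thesis unfolding primitive_def by (intro has_parity_closed(3,6))
qed

lemma parity_twist_0 [simp]: "parity_twist 0 = 0"
  by (simp add: parity_twist_def)

section \<open>The product and the Buttin bracket\<close>

lemma sum_keys_add:
  fixes F :: "super_mono \<Rightarrow> complex \<Rightarrow> super_poly"
  assumes F0: "\<And>m. F m 0 = 0" and add: "\<And>m c d. F m (c + d) = F m c + F m d"
  shows "(\<Sum>m\<in>keys (f + g). F m (lookup (f + g) m)) =
    (\<Sum>m\<in>keys f. F m (lookup f m)) +
    (\<Sum>m\<in>keys g. F m (lookup g m))"
proof -
  let ?K = "keys f \<union> keys g"
  have e: "(\<Sum>m\<in>keys h. F m (lookup h m)) = (\<Sum>m\<in>?K. F m (lookup h m))"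
    if "keys h \<subseteq> ?K" for h
    by (rule sum_keys_superset) (use that F0 in auto)
  show ?thesis
    unfolding e[OF Poly_Mapping.keys_add] e[OF Un_upper1] e[OF Un_upper2]
    by (simp add: lookup_add add sum.distrib)
qed

definition mul_sign :: "nat set \<Rightarrow> nat set \<Rightarrow> complex" where
  "mul_sign I J = (- 1) ^ card {(i, j). i \<in> I \<and> j \<in> J \<and> j < i}"

text \<open>The contribution to a product of the coefficient \<open>c\<close> of a pair of monomials; it is linear in \<open>c\<close>, so
  that \<open>sum_keys_add\<close> applies.\<close>

definition mult_term :: "super_mono \<Rightarrow> super_mono \<Rightarrow> complex \<Rightarrow> super_poly" where
  "mult_term m l c = (if snd m \<inter> snd l = {}
     then single (fst m + fst l, snd m \<union> snd l) (mul_sign (snd m) (snd l) * c) else 0)"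

lemma sp_mult_terms:
  "sp_mult f g = (\<Sum>m\<in>keys f. \<Sum>l\<in>keys g.
     mult_term m l (lookup f m * lookup g l))"
  unfolding sp_mult_def mult_term_def mul_sign_def
  by (intro sum.cong refl) (auto simp: split_beta mult.assoc intro!: sum.cong)

lemma mult_term_linear: "mult_term m l 0 = 0" "mult_term m l (c + d) = mult_term m l c + mult_term m l d"
  by (auto simp: mult_term_def single_add distrib_left)

lemma sp_mult_add: "sp_mult (f + g) h = sp_mult f h + sp_mult g h" "sp_mult h (f + g) = sp_mult h f + sp_mult h g"
proof -
  show "sp_mult (f + g) h = sp_mult f h + sp_mult g h"
    unfolding sp_mult_terms
    by (rule sum_keys_add[where F = "\<lambda>m c. \<Sum>l\<in>keys h. mult_term m l (c * lookup h l)"])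
      (simp_all add: mult_term_linear distrib_right sum.distrib)
  have "sp_mult h g = (\<Sum>l\<in>keys g. \<Sum>m\<in>keys h.
      mult_term m l (lookup h m * lookup g l))" for g
    unfolding sp_mult_terms by (rule sum.swap)
  then show "sp_mult h (f + g) = sp_mult h f + sp_mult h g"
    by (simp only:) (rule sum_keys_add[where F = "\<lambda>l c. \<Sum>m\<in>keys h. mult_term m l (lookup h m * c)"];
      simp add: mult_term_linear distrib_left sum.distrib)
qed

lemma sp_mult_0: "sp_mult 0 g = 0" "sp_mult f 0 = 0"
  by (simp_all add: sp_mult_def)

lemma sp_mult_minus: "sp_mult (- f) g = - sp_mult f g" "sp_mult f (- g) = - sp_mult f g"
  using sp_mult_add(1)[of f "- f" g] sp_mult_add(2)[of f g "- g"]
  by (simp_all add: sp_mult_0 eq_neg_iff_add_eq_0 add.commute)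

lemma sp_mult_scale: "sp_mult (sp_scale c f) g = sp_scale c (sp_mult f g)" "sp_mult f (sp_scale c g) = sp_scale c (sp_mult f g)"
proof -
  have t: "mult_term m l (c * d) = sp_scale c (mult_term m l d)" for m l d
    by (auto intro!: super_poly_eqI simp: mult_term_def lookup_sp_scale lookup_single when_def)
  have k: "keys (sp_scale c h) = keys h" if "c \<noteq> 0" for h
    using that by (auto simp: in_keys_iff lookup_sp_scale)
  show "sp_mult (sp_scale c f) g = sp_scale c (sp_mult f g)"
    by (cases "c = 0") (simp_all add: sp_mult_0 sp_mult_terms k lookup_sp_scale mult.assoc t SP.scale_sum_right)
  show "sp_mult f (sp_scale c g) = sp_scale c (sp_mult f g)"
    by (cases "c = 0") (simp_all add: sp_mult_0 sp_mult_terms k lookup_sp_scale mult.left_commute[of _ c] t SP.scale_sum_right)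
qed

lemma sp_mult_single: "sp_mult (single m c) (single l d) = mult_term m l (c * d)"
  by (auto simp: sp_mult_terms mult_term_linear)

lemma super_poly_induct:
  fixes f :: super_poly
  assumes "P 0" "\<And>f g. P f \<Longrightarrow> P g \<Longrightarrow> P (f + g)"
    and "\<And>a I c. (a, I) \<in> keys f \<Longrightarrow> P (single (a, I) c)"
  shows "P f"
proof -
  have "P (\<Sum>m\<in>K. single m (lookup f m))" if "finite K" "K \<subseteq> keys f" for K
    using that by (induction K rule: finite_induct) (auto intro: assms)
  moreover have "(\<Sum>m\<in>keys f. single m (lookup f m)) = f"
    by (rule poly_mapping_eqI) (simp add: lookup_sum lookup_single when_def sum.delta in_keys_iff)
  ultimately show ?thesis by (metis finite_keys order_refl)
qed

lemma op_single:
  "d_x i (single (a, I) c) =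
     single (a - single i 1, I) (of_nat (lookup a i) * c)"
  "d_xi i (single (a, I) c) =
     (if i \<in> I then single (a, I - {i}) (xi_sign i I * c) else 0)"
  "parity_twist (single (a, I) c) = single (a, I) ((- 1) ^ card I * c)"
  by (auto simp: d_x_def d_xi_def parity_twist_def xi_sign_def)

lemma d_linear:
  "d_x i (f + g) = d_x i f + d_x i g" "d_xi i (f + g) = d_xi i f + d_xi i g" "d_x i 0 = 0" "d_xi i 0 = 0"
  "d_x i (- f) = - d_x i f" "d_xi i (- f) = - d_xi i f"
  using deriv_op_linear[of "(i, 0)"] deriv_op_linear[of "(i, 1)"] by (simp_all add: deriv_op_def)

lemma d_sum: "d_x i (sum f A) = (\<Sum>a\<in>A. d_x i (f a))" "d_xi i (sum f A) = (\<Sum>a\<in>A. d_xi i (f a))"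
  using deriv_op_sum[of "(i, 0)"] deriv_op_sum[of "(i, 1)"] by (simp_all add: deriv_op_def)

lemma mul_sign_insert:
  assumes "finite I" "finite J"
  shows "i \<notin> I \<Longrightarrow> mul_sign (insert i I) J = mul_sign I J * xi_sign i J"
    and "i \<notin> J \<Longrightarrow> mul_sign I (insert i J) * xi_sign i I = mul_sign I J * (- 1) ^ card (I - {i})"
proof -
  let ?S = "\<lambda>I J. {(i, j). i \<in> I \<and> j \<in> J \<and> j < i}"
  have fin: "finite (?S I J)" by (rule finite_subset[of _ "I \<times> J"]) (use assms in auto)
  have fin': "finite {j \<in> J. j < i}" "finite {j \<in> I. j < i}" "finite {j \<in> I. i < j}" using assms by auto
  show "mul_sign (insert i I) J = mul_sign I J * xi_sign i J" if "i \<notin> I"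
  proof -
    have "?S (insert i I) J = ?S I J \<union> Pair i ` {j \<in> J. j < i}" by auto
    moreover have "card (?S I J \<union> Pair i ` {j \<in> J. j < i}) = card (?S I J) + card (Pair i ` {j \<in> J. j < i})"
      using fin fin' that by (intro card_Un_disjoint) auto
    ultimately show ?thesis
      by (simp add: mul_sign_def xi_sign_def power_add card_image inj_on_def)
  qed
  show "mul_sign I (insert i J) * xi_sign i I = mul_sign I J * (- 1) ^ card (I - {i})" if "i \<notin> J"
  proof -
    have "?S I (insert i J) = ?S I J \<union> (\<lambda>j. (j, i)) ` {j \<in> I. i < j}" by auto
    moreover have "card (?S I J \<union> (\<lambda>j. (j, i)) ` {j \<in> I. i < j}) = card (?S I J) + card ((\<lambda>j. (j, i)) ` {j \<in> I. i < j})"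
      using fin fin' that by (intro card_Un_disjoint) auto
    ultimately have "mul_sign I (insert i J) = mul_sign I J * (- 1) ^ card {j \<in> I. i < j}"
      by (simp add: mul_sign_def power_add card_image inj_on_def)
    moreover have "card (I - {i}) = card {j \<in> I. i < j} + card {j \<in> I. j < i}"
    proof -
      have "I - {i} = {j \<in> I. i < j} \<union> {j \<in> I. j < i}" by auto
      then show ?thesis using fin' by (simp add: card_Un_disjoint disjoint_iff)
    qed
    ultimately show ?thesis by (simp add: xi_sign_def power_add)
  qed
qed

lemma xi_sign_union: "I \<inter> J = {} \<Longrightarrow> xi_sign i (I \<union> J) = xi_sign i I * xi_sign i J"
proof -
  assume "I \<inter> J = {}"
  moreover have "{l \<in> I \<union> J. l < i} = {l \<in> I. l < i} \<union> {l \<in> J. l < i}" by auto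
  moreover have "finite {l \<in> I. l < i}" "finite {l \<in> J. l < i}" by (auto intro: finite_subset[of _ "{..<i}"])
  ultimately show ?thesis
    by (simp add: xi_sign_def power_add[symmetric]) (subst card_Un_disjoint, auto)
qed

lemma leibniz_x_single:
  "d_x i (mult_term (a, I) (b, J) c) =
     mult_term (a - single i 1, I) (b, J) (of_nat (lookup a i) * c) +
     mult_term (a, I) (b - single i 1, J) (of_nat (lookup b i) * c)"
proof -
  have "a - single i 1 + b = a + b - single i 1" if nz: "lookup a i \<noteq> 0" for a b :: "nat \<Rightarrow>\<^sub>0 nat"
  proof (rule poly_mapping_eqI)
    fix l show "lookup (a - single i 1 + b) l =
        lookup (a + b - single i 1) l"
      using nz not0_implies_Suc[OF nz] by (cases "l = i") (auto simp: lookup_add lookup_minus lookup_single_not_eq)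
  qed
  from this[of a b] this[of b a] show ?thesis
    by (cases "lookup a i = 0"; cases "lookup b i = 0")
      (auto simp: mult_term_def op_single lookup_add d_linear algebra_simps single_add)
qed

lemma leibniz_xi_single:
  assumes fin: "finite I" "finite J"
  shows "d_xi i (mult_term (a, I) (b, J) c) =
     (if i \<in> I then mult_term (a, I - {i}) (b, J) (xi_sign i I * c) else 0) +
     (if i \<in> J then mult_term (a, I) (b, J - {i}) ((- 1) ^ card I * xi_sign i J * c) else 0)"
proof (cases "i \<in> I")
  case True
  define I' where "I' = I - {i}"
  have I: "I = insert i I'" "i \<notin> I'" "finite I'" using True fin by (auto simp: I'_def)
  show ?thesis
  proof (cases "i \<in> J")
    case True
    define J' where "J' = J - {i}"
    have J: "J = insert i J'" "i \<notin> J'" "finite J'" using True fin by (auto simp: J'_def)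
    have "mul_sign I' J * xi_sign i I' = mul_sign I' J' * (- 1) ^ card I'"
      using mul_sign_insert(2)[OF I(3) J(3,2)] I(2) J(1) by simp
    moreover have "mul_sign I J' = mul_sign I' J' * xi_sign i J'"
      using mul_sign_insert(1)[OF I(3) J(3)] I by simp
    ultimately show ?thesis
      using I J by (auto simp: mult_term_def d_linear xi_sign_insert single_add[symmetric]
          simp flip: mult.assoc) (simp_all add: algebra_simps)
  next
    case False
    have "mul_sign I J = mul_sign I' J * xi_sign i J"
      using mul_sign_insert(1)[OF I(3) fin(2)] I by simp
    moreover have "I' \<inter> J = {} \<longleftrightarrow> I \<inter> J = {}" "(I \<union> J) - {i} = I' \<union> J" using False I by auto
    ultimately show ?thesis
      using False I by (auto simp: mult_term_def op_single d_linear xi_sign_insert xi_sign_union ac_simps)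
  qed
next
  case False
  show ?thesis
  proof (cases "i \<in> J")
    case True
    define J' where "J' = J - {i}"
    have J: "J = insert i J'" "i \<notin> J'" "finite J'" using True fin by (auto simp: J'_def)
    have *: "mul_sign I J * xi_sign i I = mul_sign I J' * (- 1) ^ card I"
      using mul_sign_insert(2)[OF fin(1) J(3,2)] False J(1) by simp
    have "I \<inter> J' = {} \<longleftrightarrow> I \<inter> J = {}" "(I \<union> J) - {i} = I \<union> J'" using False J by auto
    have eq: "xi_sign i I * xi_sign i J * (mul_sign I J * c) = mul_sign I J' * ((- 1) ^ card I * xi_sign i J * c)"
      using * by (metis (no_types, opaque_lifting) mult.assoc mult.commute)
    have eq': "I \<inter> J = {} \<Longrightarrow> xi_sign i (I \<union> J) * (mul_sign I J * c) = mul_sign I J' * ((- 1) ^ card I * xi_sign i J * c)"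
      unfolding eq[symmetric] by (simp only: xi_sign_union)
    show ?thesis
      using False True \<open>I \<inter> J' = {} \<longleftrightarrow> I \<inter> J = {}\<close> \<open>I \<union> J - {i} = I \<union> J'\<close>
      by (cases "I \<inter> J = {}") (simp_all add: mult_term_def op_single d_linear J'_def[symmetric] eq')
  next
    case F: False
    then show ?thesis using False by (auto simp: mult_term_def op_single d_linear)
  qed
qed

lemma Lam_keys: "f \<in> Lam n \<Longrightarrow> (a, I) \<in> keys f \<Longrightarrow> finite I"
  unfolding Lam_def using finite_subset[of I "{1..n}"] by blast

lemma leibniz_x: "d_x i (sp_mult f g) = sp_mult (d_x i f) g + sp_mult f (d_x i g)"
proof (induction f rule: super_poly_induct)
  case (3 a I c)
  show ?case
  proof (induction g rule: super_poly_induct)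
    case (3 b J d)
    show ?case by (simp add: sp_mult_single op_single leibniz_x_single mult.assoc mult.left_commute)
  qed (simp_all add: sp_mult_0 sp_mult_add d_linear algebra_simps)
qed (simp_all add: sp_mult_0 sp_mult_add d_linear algebra_simps)

text \<open>The parity twist accounts for moving \<open>\<partial>/\<partial>\<xi>\<^sub>i\<close> past \<open>f\<close>.\<close>

lemma leibniz_xi:
  assumes "f \<in> Lam n" "g \<in> Lam n"
  shows "d_xi i (sp_mult f g) = sp_mult (d_xi i f) g + sp_mult (parity_twist f) (d_xi i g)"
proof (induction f rule: super_poly_induct)
  case (3 a I c)
  then have I: "finite I" using assms Lam_keys by blast
  show ?case
  proof (induction g rule: super_poly_induct)
    case (3 b J d)
    then have "finite J" using assms Lam_keys by blast
    from leibniz_xi_single[OF I this] show ?case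
      by (auto simp: sp_mult_single sp_mult_0 op_single mult_term_linear ac_simps)
  qed (simp_all add: sp_mult_0 sp_mult_add d_linear algebra_simps)
qed (simp_all add: sp_mult_0 sp_mult_add d_linear parity_twist_linear algebra_simps)

lemma Lam_iff: "f \<in> Lam n \<longleftrightarrow>
    (\<forall>a I. lookup f (a, I) \<noteq> 0 \<longrightarrow> keys a \<subseteq> {1..n} \<and> I \<subseteq> {1..n})"
  by (simp add: Lam_def Ball_def in_keys_iff split_paired_All)

lemma Lam_finite: "f \<in> Lam n \<Longrightarrow> lookup f (a, I) \<noteq> 0 \<Longrightarrow> finite I"
  using Lam_keys[of f n a I] by (simp add: in_keys_iff)

lemma Lam_subspace: "SP.subspace (Lam n)"
proof -
  have "Lam n = {f. \<forall>a I. lookup f (a, I) \<noteq> 0 \<longrightarrow>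
      keys a \<subseteq> {1..n} \<and> I \<subseteq> {1..n}}"
    using Lam_iff by blast
  then show ?thesis by (simp only: supported_subspace)
qed

lemmas Lam_closed = SP.subspace_add[OF Lam_subspace] SP.subspace_diff[OF Lam_subspace]
  SP.subspace_scale[OF Lam_subspace] SP.subspace_0[OF Lam_subspace]
  SP.subspace_neg[OF Lam_subspace] SP.subspace_sum[OF Lam_subspace]

lemma Lam_ops:
  assumes f: "f \<in> Lam n"
  shows "d_x i f \<in> Lam n" "d_xi i f \<in> Lam n" "parity_twist f \<in> Lam n"
proof -
  have k: "keys a \<subseteq> {1..n} \<and> I \<subseteq> {1..n}" if "lookup f (a, I) \<noteq> 0" for a I
    using f that unfolding Lam_iff by blast
  show "d_x i f \<in> Lam n"
    unfolding Lam_iff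
  proof (intro allI impI)
    fix a I assume "lookup (d_x i f) (a, I) \<noteq> 0"
    then have "lookup f (a + single i 1, I) \<noteq> 0" by (auto simp: lookup_d_x)
    from k[OF this] show "keys a \<subseteq> {1..n} \<and> I \<subseteq> {1..n}" unfolding keys_add_nat by blast
  qed
  show "d_xi i f \<in> Lam n"
    unfolding Lam_iff
  proof (intro allI impI)
    fix a I assume "lookup (d_xi i f) (a, I) \<noteq> 0"
    then have "lookup f (a, insert i I) \<noteq> 0" by (auto simp: lookup_d_xi split: if_splits)
    from k[OF this] show "keys a \<subseteq> {1..n} \<and> I \<subseteq> {1..n}" by blast
  qed
  show "parity_twist f \<in> Lam n"
    unfolding Lam_iff
  proof (intro allI impI)
    fix a I assume "lookup (parity_twist f) (a, I) \<noteq> 0"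
    then have "lookup f (a, I) \<noteq> 0" by (auto simp: lookup_parity_twist)
    from k[OF this] show "keys a \<subseteq> {1..n} \<and> I \<subseteq> {1..n}" .
  qed
qed

lemma sp_mult_in_subspace:
  assumes "SP.subspace S"
    and "\<And>a I b J c. lookup f (a, I) \<noteq> 0 \<Longrightarrow> lookup g (b, J) \<noteq> 0 \<Longrightarrow>
      I \<inter> J = {} \<Longrightarrow> single (a + b, I \<union> J) c \<in> S"
  shows "sp_mult f g \<in> S"
  unfolding sp_mult_terms mult_term_def
  using assms(2) by (intro SP.subspace_sum[OF assms(1)]) (auto simp: in_keys_iff SP.subspace_0[OF assms(1)])

lemma sp_mult_Lam:
  assumes "f \<in> Lam n" "g \<in> Lam n"
  shows "sp_mult f g \<in> Lam n"
proof (rule sp_mult_in_subspace[OF Lam_subspace])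
  fix a I b J c assume "lookup f (a, I) \<noteq> 0" "lookup g (b, J) \<noteq> 0"
  then show "single (a + b, I \<union> J) c \<in> Lam n"
    using assms by (simp add: Lam_iff lookup_single when_def keys_add_nat)
qed

lemma single_homog:
  assumes "keys a \<subseteq> {1..n}" "I \<subseteq> {1..n}" "int (x_degree a) + int (card I) - 2 = j"
  shows "single (a, I) c \<in> homog n j"
  using assms by (simp add: homog_def lookup_single when_def)

lemma single_parity: "of_nat (card I) + 1 = p \<Longrightarrow> single (a, I) c \<in> has_parity p"
  by (simp add: has_parity_def lookup_single when_def)

lemma sp_mult_homog:
  assumes f: "f \<in> homog n i" and g: "g \<in> homog n j" and m: "m = i + j + 2"
  shows "sp_mult f g \<in> homog n m"
proof (rule sp_mult_in_subspace[OF homog_subspace])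
  fix a I b J c assume fg: "lookup f (a, I) \<noteq> 0" "lookup g (b, J) \<noteq> 0" "I \<inter> J = {}"
  note h = homogD[OF f fg(1)] homogD[OF g fg(2)]
  have "card (I \<union> J) = card I + card J" using fg(3) h by (intro card_Un_disjoint) auto
  then show "single (a + b, I \<union> J) c \<in> homog n m"
    using h m by (intro single_homog) (auto simp: keys_add_nat x_degree_add)
qed

lemma sp_mult_parity:
  assumes f: "f \<in> has_parity p" "f \<in> Lam n" and g: "g \<in> has_parity q" "g \<in> Lam n"
  shows "sp_mult f g \<in> has_parity (p + q + 1)"
proof (rule sp_mult_in_subspace[OF has_parity_subspace])
  fix a I b J c assume fg: "lookup f (a, I) \<noteq> 0" "lookup g (b, J) \<noteq> 0" "I \<inter> J = {}"
  have "card (I \<union> J) = card I + card J"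
    using fg Lam_finite[OF f(2) fg(1)] Lam_finite[OF g(2) fg(2)] by (intro card_Un_disjoint) auto
  moreover have "of_nat (card I) + 1 = p" "of_nat (card J) + 1 = q"
    using f(1) g(1) fg unfolding has_parity_def by blast+
  ultimately have "of_nat (card (I \<union> J)) + 1 = p + q + 1"
    by (cases p; cases q; cases "of_nat (card I) :: bit"; cases "of_nat (card J) :: bit"; simp)
  then show "single (a + b, I \<union> J) c \<in> has_parity (p + q + 1)"
    by (rule single_parity)
qed

lemma of_nat_bit: "(of_nat c :: bit) = (if even c then 0 else 1)"
  by (induction c) auto

lemma parity_twist_of_parity:
  assumes "f \<in> has_parity p"
  shows "parity_twist f = sp_scale (if p = 1 then 1 else - 1) f"
proof (rule super_poly_eqI)
  fix a I show "lookup (parity_twist f) (a, I) = lookup (sp_scale (if p = 1 then 1 else - 1) f) (a, I)"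
  proof (cases "lookup f (a, I) = 0")
    case False
    then have "of_nat (card I) + 1 = p" using assms unfolding has_parity_def by blast
    then show ?thesis by (cases "even (card I)") (auto simp: of_nat_bit lookup_ops)
  qed (simp add: lookup_ops)
qed

lemma parity_twist_twice [simp]: "parity_twist (parity_twist f) = f"
  by (rule super_poly_eqI) (simp add: lookup_ops mult.assoc[symmetric] power_mult_distrib[symmetric])

lemma parity_twist_deriv:
  "parity_twist (d_x i f) = d_x i (parity_twist f)"
  "f \<in> Lam n \<Longrightarrow> parity_twist (d_xi i f) = - d_xi i (parity_twist f)"
proof -
  show "parity_twist (d_x i f) = d_x i (parity_twist f)"
    by (rule super_poly_eqI) (simp add: lookup_ops)
  assume f: "f \<in> Lam n"
  show "parity_twist (d_xi i f) = - d_xi i (parity_twist f)"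
  proof (rule super_poly_eqI)
    fix a I
    show "lookup (parity_twist (d_xi i f)) (a, I) = lookup (- d_xi i (parity_twist f)) (a, I)"
    proof (cases "i \<in> I \<or> lookup f (a, insert i I) = 0")
      case False
      then have "finite I" using Lam_finite[OF f, of a "insert i I"] by simp
      then show ?thesis using False by (simp add: lookup_ops)
    qed (auto simp: lookup_ops)
  qed
qed

lemma d_commute:
  "d_x i (d_x j f) = d_x j (d_x i f)" "d_x i (d_xi j f) = d_xi j (d_x i f)"
  "d_xi i (d_xi j f) = - d_xi j (d_xi i f)"
  using deriv_op_commute[of "(i, 0)" "(j, 0)" f] deriv_op_commute[of "(i, 0)" "(j, 1)" f]
    deriv_op_commute[of "(i, 1)" "(j, 1)" f]
  by (simp_all add: deriv_op_def parity_sign_def)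

lemma deriv_op_buttin_even:
  assumes f: "f \<in> Lam n" and g: "g \<in> Lam n"
  shows "d_x l (buttin n f g) = buttin n (d_x l f) g + buttin n f (d_x l g)"
  unfolding buttin_def sum.distrib[symmetric] d_sum
  by (intro sum.cong refl) (simp add: d_linear leibniz_x d_commute(1)[of _ l] d_commute(2) parity_twist_deriv(1) ac_simps)

lemma deriv_op_buttin_odd:
  assumes f: "f \<in> Lam n" and g: "g \<in> Lam n"
  shows "d_xi l (buttin n f g) = buttin n (d_xi l f) g - buttin n (parity_twist f) (d_xi l g)"
proof -
  have "d_xi l (sp_mult (d_x i f) (d_xi i g) + sp_mult (d_xi i (parity_twist f)) (d_x i g)) =
      (sp_mult (d_x i (d_xi l f)) (d_xi i g) + sp_mult (d_xi i (parity_twist (d_xi l f))) (d_x i g)) -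
      (sp_mult (d_x i (parity_twist f)) (d_xi i (d_xi l g)) + sp_mult (d_xi i (parity_twist (parity_twist f))) (d_x i (d_xi l g)))" for i
  proof -
    have 1: "d_xi l (sp_mult (d_x i f) (d_xi i g)) =
        sp_mult (d_x i (d_xi l f)) (d_xi i g) - sp_mult (d_x i (parity_twist f)) (d_xi i (d_xi l g))"
      using f g by (simp add: leibniz_xi[of _ n] Lam_ops d_commute(2) d_commute(3)[of l i] parity_twist_deriv(1)[symmetric] sp_mult_minus)
    have 2: "d_xi l (sp_mult (d_xi i (parity_twist f)) (d_x i g)) =
        sp_mult (d_xi i (parity_twist (d_xi l f))) (d_x i g) - sp_mult (d_xi i f) (d_x i (d_xi l g))"
      using f g by (simp add: leibniz_xi[of _ n] Lam_ops d_commute(2) d_commute(3)[of l i]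
          parity_twist_deriv(2)[of _ n] parity_twist_linear d_linear sp_mult_minus)
    show ?thesis by (simp add: d_linear 1 2)
  qed
  then show ?thesis
    unfolding buttin_def sum_subtractf[symmetric] d_sum by (intro sum.cong refl)
qed

lemma buttin_add: "buttin n (f + f') g = buttin n f g + buttin n f' g" "buttin n f (g + g') = buttin n f g + buttin n f g'"
  by (simp_all add: buttin_def d_linear parity_twist_linear sp_mult_add sum.distrib algebra_simps)

lemma buttin_0 [simp]: "buttin n 0 g = 0" "buttin n f 0 = 0"
  by (simp_all add: buttin_def d_linear sp_mult_0)

lemma buttin_minus: "buttin n (- f) g = - buttin n f g" "buttin n f (- g) = - buttin n f g"
  using buttin_add(1)[of n f "- f" g] buttin_add(2)[of n f g "- g"]
  by (simp_all add: eq_neg_iff_add_eq_0 add.commute)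

lemma buttin_diff: "buttin n (f - f') g = buttin n f g - buttin n f' g" "buttin n f (g - g') = buttin n f g - buttin n f g'"
  using buttin_add(1)[of n f "- f'" g] buttin_add(2)[of n f g "- g'"] by (simp_all add: buttin_minus)

lemma parity_twist_scale: "parity_twist (sp_scale c f) = sp_scale c (parity_twist f)"
  by (rule super_poly_eqI) (simp add: lookup_ops)

lemma d_scale: "d_x i (sp_scale c f) = sp_scale c (d_x i f)" "d_xi i (sp_scale c f) = sp_scale c (d_xi i f)"
  using deriv_op_linear(4)[of "(i, 0)" c f] deriv_op_linear(4)[of "(i, 1)" c f] by (simp_all add: deriv_op_def)

lemma buttin_scale: "buttin n (sp_scale c f) g = sp_scale c (buttin n f g)" "buttin n f (sp_scale c g) = sp_scale c (buttin n f g)"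
  by (simp_all add: buttin_def d_scale parity_twist_scale sp_mult_scale SP.scale_right_distrib SP.scale_sum_right)

text \<open>In the reversed parity the derivative along \<open>u\<close> is a derivation of the bracket of the same parity as
  its coordinate in \<open>\<Lambda>(n,n)\<close>.  By \<open>buttin_shift\<close> below it is an inner derivation.\<close>

lemma deriv_op_buttin:
  assumes f: "f \<in> Lam n" "f \<in> has_parity p" and g: "g \<in> Lam n"
  shows "deriv_op u (buttin n f g) = buttin n (deriv_op u f) g + sp_scale (parity_sign (snd u) p) (buttin n f (deriv_op u g))"
  using deriv_op_buttin_even[OF f(1) g] deriv_op_buttin_odd[OF f(1) g]
  by (cases p; simp add: deriv_op_def parity_sign_def parity_twist_of_parity[OF f(2)] buttin_minus)

lemma buttin_homog:
  assumes f: "f \<in> homog n i" and g: "g \<in> homog n j" and m: "m = i + j"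
  shows "buttin n f g \<in> homog n m"
proof -
  have op: "d_x l h \<in> homog n (k - 1)" "d_xi l h \<in> homog n (k - 1)" if "h \<in> homog n k" for l h k
    using deriv_op_homog[OF that, of "(l, 0)"] deriv_op_homog[OF that, of "(l, 1)"] by (simp_all add: deriv_op_def)
  have "parity_twist f \<in> homog n i" using f by (simp add: homog_def lookup_parity_twist)
  then show ?thesis
    unfolding buttin_def using f g m
    by (intro homog_closed(6) homog_closed(1) sp_mult_homog[of _ n "i - 1" _ "j - 1"] op) auto
qed

lemma buttin_parity:
  assumes f: "f \<in> has_parity p" "f \<in> homog n i" and g: "g \<in> has_parity q" "g \<in> homog n j"
  shows "buttin n f g \<in> has_parity (p + q)"
proof -
  have op: "d_x l h \<in> has_parity r" "d_xi l h \<in> has_parity (r + 1)" if "h \<in> has_parity r" "h \<in> homog n k" for l h k r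
    using deriv_op_parity[OF that, of "(l, 0)"] deriv_op_parity[OF that, of "(l, 1)"]
    by (cases r; simp add: deriv_op_def)+
  have tw: "parity_twist f \<in> has_parity p" "parity_twist f \<in> homog n i"
    using f by (simp_all add: has_parity_def homog_def lookup_parity_twist)
  have pq: "p + q = p + (q + 1) + 1" "p + q = p + 1 + q + 1" by (cases p; cases q; simp)+
  have "sp_mult (d_x l f) (d_xi l g) \<in> has_parity (p + q)" for l
    unfolding pq(1) using f g homog_Lam by (intro sp_mult_parity[where n = n] op Lam_ops) auto
  moreover have "sp_mult (d_xi l (parity_twist f)) (d_x l g) \<in> has_parity (p + q)" for l
    unfolding pq(2) using tw f g homog_Lam by (intro sp_mult_parity[where n = n] op Lam_ops) auto
  ultimately show ?thesis
    unfolding buttin_def by (intro has_parity_closed(6) has_parity_closed(1))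
qed

lemma sp_scale_single: "sp_scale c (single m d) = single m (c * d)"
  by (rule poly_mapping_eqI) (simp add: lookup_sp_scale lookup_single when_def)

lemma sp_mult_const:
  "sp_mult (single (0, {}) c) g = sp_scale c g"
  "sp_mult f (single (0, {}) c) = sp_scale c f"
proof -
  show "sp_mult (single (0, {}) c) g = sp_scale c g"
    by (induction g rule: super_poly_induct)
      (simp_all add: sp_mult_0 sp_mult_add SP.scale_right_distrib sp_mult_single mult_term_def mul_sign_def sp_scale_single)
  show "sp_mult f (single (0, {}) c) = sp_scale c f"
    by (induction f rule: super_poly_induct)
      (simp_all add: sp_mult_0 sp_mult_add SP.scale_right_distrib sp_mult_single mult_term_def mul_sign_def sp_scale_single mult.commute)
qed

text \<open>The element of degree \<open>-1\<close> whose adjoint action is the derivative with respect to the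
  coordinate \<open>u\<close>.\<close>

definition shift :: "nat \<times> bit \<Rightarrow> super_poly" where
  "shift u = (if snd u = 1 then single (single (fst u) 1, {}) 1
     else single (0, {fst u}) (- 1))"

lemma d_shift:
  "d_x i (shift u) = (if u = (i, 1) then single (0, {}) 1 else 0)"
  "d_xi i (shift u) = (if u = (i, 0) then single (0, {}) (- 1) else 0)"
proof -
  obtain l q where u: "u = (l, q)" by (metis surj_pair)
  have e: "{j \<in> {l}. j < l} = {}" by auto
  have x: "xi_sign l {l} = 1" unfolding xi_sign_def e by simp
  show "d_x i (shift u) = (if u = (i, 1) then single (0, {}) 1 else 0)"
    by (cases "q = 0"; cases "i = l") (simp_all add: u shift_def op_single lookup_single_not_eq)
  show "d_xi i (shift u) = (if u = (i, 0) then single (0, {}) (- 1) else 0)"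
    by (cases "q = 0"; cases "i = l") (simp_all add: u shift_def op_single x)
qed

lemma x_degree_zero [simp]: "x_degree 0 = 0"
  by (simp add: x_degree_def)

lemma shift_parity: "shift u \<in> has_parity (snd u)"
  unfolding shift_def by (auto intro!: single_parity)

lemma shift_homog: "u \<in> coords n \<Longrightarrow> shift u \<in> homog n (- 1)"
  unfolding shift_def by (auto intro!: single_homog simp: coords_def)

lemma buttin_shift:
  assumes u: "u \<in> coords n"
  shows "buttin n (shift u) g = deriv_op u g"
    and "f \<in> has_parity p \<Longrightarrow> buttin n f (shift u) = - sp_scale (parity_sign p (snd u)) (deriv_op u f)"
proof -
  obtain i q where iq: "u = (i, q)" "i \<in> {1..n}" using u by (auto simp: coords_def)
  have tw: "parity_twist (shift v) = sp_scale (if snd v = 1 then 1 else - 1) (shift v)" for v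
    by (rule parity_twist_of_parity[OF shift_parity])
  have "buttin n (shift u) g = (\<Sum>l\<in>{1..n}. if l = i then deriv_op u g else 0)"
    unfolding buttin_def
    by (intro sum.cong refl) (cases "q = 0"; auto simp: tw d_scale d_linear sp_mult_scale sp_mult_minus d_shift iq sp_mult_0 sp_mult_const deriv_op_def)
  then show "buttin n (shift u) g = deriv_op u g" using iq by simp
  assume f: "f \<in> has_parity p"
  have "buttin n f (shift u) = (\<Sum>l\<in>{1..n}. if l = i then - sp_scale (parity_sign p (snd u)) (deriv_op u f) else 0)"
    unfolding buttin_def
    by (intro sum.cong refl) (cases p; cases "q = 0"; auto simp: parity_twist_of_parity[OF f] parity_sign_def d_scale d_linear
      sp_mult_scale d_shift iq sp_mult_0 sp_mult_const deriv_op_def)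
  then show "buttin n f (shift u) = - sp_scale (parity_sign p (snd u)) (deriv_op u f)" using iq by simp
qed

section \<open>The odd Laplacian\<close>

lemma d_diff: "d_x i (f - g) = d_x i f - d_x i g" "d_xi i (f - g) = d_xi i f - d_xi i g"
  using deriv_op_linear(2)[of "(i, 0)" f g] deriv_op_linear(2)[of "(i, 1)" f g] by (simp_all add: deriv_op_def)

lemma Delta_linear:
  "Delta n (f + g) = Delta n f + Delta n g" "Delta n (f - g) = Delta n f - Delta n g"
  "Delta n (- f) = - Delta n f" "Delta n (sp_scale c f) = sp_scale c (Delta n f)" "Delta n 0 = 0"
proof -
  show "Delta n (f + g) = Delta n f + Delta n g" "Delta n 0 = 0" "Delta n (sp_scale c f) = sp_scale c (Delta n f)"
    by (simp_all add: Delta_def d_linear d_scale sum.distrib SP.scale_sum_right)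
  show "Delta n (- f) = - Delta n f" "Delta n (f - g) = Delta n f - Delta n g"
    by (simp_all add: Delta_def d_linear d_diff sum_negf sum_subtractf)
qed

lemma Delta_sum: "Delta n (sum f A) = (\<Sum>a\<in>A. Delta n (f a))"
  by (induction A rule: infinite_finite_induct) (simp_all add: Delta_linear)

lemma deriv_op_Delta: "deriv_op u (Delta n f) = sp_scale (if snd u = 1 then - 1 else 1) (Delta n (deriv_op u f))"
proof -
  obtain i q where u: "u = (i, q)" by (metis surj_pair)
  have e: "d_x i (d_x j (d_xi j f)) = d_x j (d_xi j (d_x i f))" for j
    using d_commute(1)[of i j "d_xi j f"] d_commute(2)[of i j f] by simp
  have o: "d_xi i (d_x j (d_xi j f)) = - d_x j (d_xi j (d_xi i f))" for j
    using d_commute(2)[of j i "d_xi j f"] d_commute(3)[of i j f] by (simp add: d_linear)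
  have "d_x i (Delta n f) = Delta n (d_x i f)"
    unfolding Delta_def d_sum by (rule sum.cong[OF refl e])
  moreover have "d_xi i (Delta n f) = - Delta n (d_xi i f)"
    unfolding Delta_def d_sum sum_negf[symmetric] by (rule sum.cong[OF refl o])
  ultimately show ?thesis
    by (cases "q = 0") (simp_all add: u deriv_op_def)
qed

lemma Delta_Delta: "Delta n (Delta n f) = 0"
proof -
  let ?T = "\<lambda>i j. d_x i (d_x j (d_xi i (d_xi j f)))"
  have "Delta n (Delta n f) = (\<Sum>i\<in>{1..n}. \<Sum>j\<in>{1..n}. ?T i j)"
    by (simp add: Delta_def d_sum d_commute(2))
  moreover have "(\<Sum>i\<in>{1..n}. \<Sum>j\<in>{1..n}. ?T i j) = - (\<Sum>i\<in>{1..n}. \<Sum>j\<in>{1..n}. ?T j i)"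
  proof -
    have anti: "?T i j = - ?T j i" for i j
    proof -
      have "?T i j = d_x j (d_x i (d_xi i (d_xi j f)))" by (rule d_commute(1))
      also have "\<dots> = d_x j (d_x i (- d_xi j (d_xi i f)))" by (subst d_commute(3)) (rule refl)
      finally show ?thesis by (simp only: d_linear)
    qed
    show ?thesis unfolding sum_negf[symmetric] by (intro sum.cong refl anti)
  qed
  moreover have "(\<Sum>i\<in>{1..n}. \<Sum>j\<in>{1..n}. ?T j i) = (\<Sum>i\<in>{1..n}. \<Sum>j\<in>{1..n}. ?T i j)"
    by (rule sum.swap)
  ultimately have "Delta n (Delta n f) = - Delta n (Delta n f)" by simp
  then have "sp_scale 2 (Delta n (Delta n f)) = 0"
    using SP.scale_left_distrib[of 1 1 "Delta n (Delta n f)"] by (simp add: eq_neg_iff_add_eq_0)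
  then show ?thesis by simp
qed

lemma Delta_Lam: "f \<in> Lam n \<Longrightarrow> Delta n f \<in> Lam n"
  unfolding Delta_def by (intro Lam_closed(6) Lam_ops)

lemma d_homog:
  assumes "f \<in> homog n j"
  shows "d_x i f \<in> homog n (j - 1)" "d_xi i f \<in> homog n (j - 1)"
  using deriv_op_homog[OF assms, of "(i, 0)"] deriv_op_homog[OF assms, of "(i, 1)"] by (simp_all add: deriv_op_def)

lemma d_parity:
  assumes "f \<in> has_parity p" "f \<in> homog n j"
  shows "d_x i f \<in> has_parity p" "d_xi i f \<in> has_parity (p + 1)"
  using deriv_op_parity[OF assms, of "(i, 0)"] deriv_op_parity[OF assms, of "(i, 1)"]
  by (cases p; simp add: deriv_op_def)+

lemma Delta_homog:
  assumes f: "f \<in> homog n j" and m: "m = j - 2"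
  shows "Delta n f \<in> homog n m"
  unfolding Delta_def
proof (rule homog_closed(6))
  fix i show "d_x i (d_xi i f) \<in> homog n m"
    using d_homog(1)[OF d_homog(2)[OF f]] m by simp
qed

lemma Delta_parity:
  assumes f: "f \<in> has_parity p" "f \<in> homog n j"
  shows "Delta n f \<in> has_parity (p + 1)"
  unfolding Delta_def
  by (intro has_parity_closed(6) d_parity(1)[OF d_parity(2)[OF f] d_homog(2)[OF f(2)]])

text \<open>The bracket of two functions annihilated by \<open>\<Delta>\<close> is a value of \<open>\<Delta>\<close>: the bracket measures
  the failure of \<open>\<Delta>\<close> to be a derivation of the product.\<close>

lemma buttin_eq_Delta:
  assumes f: "f \<in> Lam n" "Delta n f = 0" and g: "g \<in> Lam n" "Delta n g = 0"
  shows "buttin n f g = Delta n (sp_mult (parity_twist f) g)"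
proof -
  have T: "d_x i (d_xi i (sp_mult (parity_twist f) g)) =
      - sp_mult (parity_twist (d_x i (d_xi i f))) g + sp_mult f (d_x i (d_xi i g)) +
      (sp_mult (d_x i f) (d_xi i g) + sp_mult (d_xi i (parity_twist f)) (d_x i g))" for i
    using f(1) g(1) Lam_ops
    by (simp add: leibniz_xi[of _ n] leibniz_x d_linear parity_twist_deriv(1) parity_twist_deriv(2)[of _ n] sp_mult_minus algebra_simps)
  have "Delta n (sp_mult (parity_twist f) g) =
      - sp_mult (parity_twist (Delta n f)) g + sp_mult f (Delta n g) + buttin n f g"
  proof -
    have s: "sp_mult h (sum k A) = (\<Sum>a\<in>A. sp_mult h (k a))" "sp_mult (parity_twist (sum k A)) h = (\<Sum>a\<in>A. sp_mult (parity_twist (k a)) h)"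
      for h k and A :: "nat set"
      by (induction A rule: infinite_finite_induct) (simp_all add: sp_mult_0 sp_mult_add parity_twist_linear)
    show ?thesis
      unfolding Delta_def buttin_def s sum_negf[symmetric] sum.distrib[symmetric]
      by (rule sum.cong[OF refl T])
  qed
  then show ?thesis using f(2) g(2) by (simp add: sp_mult_0)
qed

text \<open>Every monomial of \<open>\<partial>g/\<partial>\<xi>\<^sub>i\<close> lacks the factor \<open>\<xi>\<^sub>i\<close>.\<close>

lemma Delta_top: "lookup (Delta n g) (0, {1..n}) = 0"
  unfolding Delta_def lookup_sum by (intro sum.neutral) (simp add: lookup_ops)

subsection \<open>Exactness of the odd Laplacian\<close>

text \<open>Multiplication by \<open>\<Sum> x\<^sub>i \<xi>\<^sub>i\<close>, the homotopy for the exactness of \<open>\<Delta>\<close>.\<close>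

definition mult_coords :: "nat \<Rightarrow> super_poly \<Rightarrow> super_poly" where
  "mult_coords n f = (\<Sum>l\<in>{1..n}. mul_x l (mul_xi l f))"

lemma d_mul_commute:
  "d_x i (mul_x l f) = (if i = l then f else 0) + mul_x l (d_x i f)"
  "d_x i (mul_xi l f) = mul_xi l (d_x i f)"
  "d_xi i (mul_x l f) = mul_x l (d_xi i f)"
  "d_xi i (mul_xi l f) = (if i = l then f else 0) - mul_xi l (d_xi i f)"
  using deriv_mult_commute[of "(i, 0)" "(l, 0)" f] deriv_mult_commute[of "(i, 0)" "(l, 1)" f]
    deriv_mult_commute[of "(i, 1)" "(l, 0)" f] deriv_mult_commute[of "(i, 1)" "(l, 1)" f]
  by (simp_all add: deriv_op_def mult_op_def parity_sign_def)

lemma mul_linear: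
  "mul_x i (f + g) = mul_x i f + mul_x i g" "mul_xi i (f + g) = mul_xi i f + mul_xi i g"
  "mul_x i (f - g) = mul_x i f - mul_x i g" "mul_xi i (f - g) = mul_xi i f - mul_xi i g"
  "mul_x i 0 = 0" "mul_xi i 0 = 0" "mul_x i (- f) = - mul_x i f" "mul_xi i (- f) = - mul_xi i f"
  using mult_op_linear[of "(i, 0)"] mult_op_linear[of "(i, 1)"] by (simp_all add: mult_op_def)

lemma mul_sum: "mul_x i (sum f A) = (\<Sum>a\<in>A. mul_x i (f a))" "mul_xi i (sum f A) = (\<Sum>a\<in>A. mul_xi i (f a))"
  by (induction A rule: infinite_finite_induct) (simp_all add: mul_linear)

lemma Delta_mult_coords:
  "Delta n (mult_coords n f) + mult_coords n (Delta n f) =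
     (\<Sum>i\<in>{1..n}. f - mul_xi i (d_xi i f) + mul_x i (d_x i f))"
proof -
  have t: "d_x i (d_xi i (mul_x l (mul_xi l f))) =
      (if i = l then f - mul_xi i (d_xi i f) + mul_x i (d_x i f) else 0) - mul_x l (mul_xi l (d_x i (d_xi i f)))" for i l
    by (cases "i = l") (simp_all add: d_mul_commute mul_linear d_linear d_diff)
  have "Delta n (mult_coords n f) = (\<Sum>i\<in>{1..n}. \<Sum>l\<in>{1..n}. d_x i (d_xi i (mul_x l (mul_xi l f))))"
    by (simp add: Delta_def mult_coords_def d_sum)
  also have "\<dots> = (\<Sum>i\<in>{1..n}. f - mul_xi i (d_xi i f) + mul_x i (d_x i f)) -
      (\<Sum>i\<in>{1..n}. \<Sum>l\<in>{1..n}. mul_x l (mul_xi l (d_x i (d_xi i f))))"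
    by (simp add: t sum_subtractf)
  also have "(\<Sum>i\<in>{1..n}. \<Sum>l\<in>{1..n}. mul_x l (mul_xi l (d_x i (d_xi i f)))) = mult_coords n (Delta n f)"
    by (simp add: Delta_def mult_coords_def mul_sum) (rule sum.swap)
  finally show ?thesis by simp
qed

definition rescale :: "(super_mono \<Rightarrow> complex) \<Rightarrow> super_poly \<Rightarrow> super_poly" where
  "rescale w f = Poly_Mapping.mapp (\<lambda>m c. w m * c) f"

lemma lookup_rescale: "lookup (rescale w f) m = w m * lookup f m"
  by (simp add: rescale_def lookup_mapp when_def in_keys_iff)

lemma rescale_closed:
  "f \<in> Lam n \<Longrightarrow> rescale w f \<in> Lam n" "f \<in> homog n j \<Longrightarrow> rescale w f \<in> homog n j"
  "f \<in> has_parity p \<Longrightarrow> rescale w f \<in> has_parity p"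
  by (simp_all only: Lam_iff homog_def has_parity_def lookup_rescale mem_Collect_eq mult_eq_0_iff
      de_Morgan_disj) blast+

lemma mul_Lam:
  assumes f: "f \<in> Lam n" and i: "i \<in> {1..n}"
  shows "mul_x i f \<in> Lam n" "mul_xi i f \<in> Lam n"
proof -
  have k: "keys a \<subseteq> {1..n} \<and> I \<subseteq> {1..n}" if "lookup f (a, I) \<noteq> 0" for a I
    using f that unfolding Lam_iff by blast
  show "mul_x i f \<in> Lam n"
    unfolding Lam_iff
  proof (intro allI impI)
    fix a I assume "lookup (mul_x i f) (a, I) \<noteq> 0"
    then have *: "lookup a i \<noteq> 0" "lookup f (a - single i 1, I) \<noteq> 0"
      by (auto simp: lookup_mul_x split: if_splits)
    then have "a = (a - single i 1) + single i 1"
      using minus_single_eq_iff by blast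
    then have "keys a \<subseteq> insert i (keys (a - single i 1))"
      using keys_add_nat[of "a - single i 1" "single i 1"] by auto
    then show "keys a \<subseteq> {1..n} \<and> I \<subseteq> {1..n}" using k[OF *(2)] i by blast
  qed
  show "mul_xi i f \<in> Lam n"
    unfolding Lam_iff
  proof (intro allI impI)
    fix a I assume "lookup (mul_xi i f) (a, I) \<noteq> 0"
    then have "lookup f (a, I - {i}) \<noteq> 0" by (auto simp: lookup_mul_xi split: if_splits)
    from k[OF this] show "keys a \<subseteq> {1..n} \<and> I \<subseteq> {1..n}" using i by blast
  qed
qed

lemma mult_coords_Lam: "f \<in> Lam n \<Longrightarrow> mult_coords n f \<in> Lam n"
  unfolding mult_coords_def by (intro Lam_closed(6) mul_Lam)

lemma mult_coords_homog:
  assumes "f \<in> homog n j"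
  shows "mult_coords n f \<in> homog n (j + 2)"
  unfolding mult_coords_def
proof (rule homog_closed(6))
  fix l assume l: "l \<in> {1..n}"
  then have "mult_op (l, 1) f \<in> homog n (j + 1)"
    using assms by (intro mult_op_homog) (simp_all add: coords_def)
  then have "mult_op (l, 0) (mult_op (l, 1) f) \<in> homog n (j + 1 + 1)"
    by (rule mult_op_homog) (use l in \<open>simp add: coords_def\<close>)
  then show "mul_x l (mul_xi l f) \<in> homog n (j + 2)" by (simp add: mult_op_def add.commute)
qed

lemma mult_coords_parity:
  assumes f: "f \<in> homog n j" "f \<in> has_parity p"
  shows "mult_coords n f \<in> has_parity (p + 1)"
  unfolding mult_coords_def
proof (rule has_parity_closed(6))
  fix l assume l: "l \<in> {1..n}"
  then have "mult_op (l, 1) f \<in> homog n (j + 1)"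
    using f(1) by (intro mult_op_homog) (simp_all add: coords_def)
  from mult_op_parity[OF mult_op_parity[OF f(2,1), of "(l, 1)"] this, of "(l, 0)"]
  show "mul_x l (mul_xi l f) \<in> has_parity (p + 1)" by (cases p; simp add: mult_op_def)
qed

text \<open>The anticommutator of \<open>\<Delta>\<close> and multiplication by \<open>\<Sum> x\<^sub>i \<xi>\<^sub>i\<close> multiplies \<open>x\<^sup>a \<xi>\<^sub>I\<close> by
  \<open>n - |I| + |a|\<close>, which vanishes only for \<open>\<xi>\<^sub>1 \<dots> \<xi>\<^sub>n\<close>.  So if \<open>\<Delta> f = 0\<close>, a preimage of \<open>f\<close> is obtained by
  dividing the coefficients of \<open>f\<close> by these eigenvalues and multiplying by \<open>\<Sum> x\<^sub>i \<xi>\<^sub>i\<close>.\<close>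

lemma Delta_exact:
  assumes f: "f \<in> Lam n" "Delta n f = 0" "lookup f (0, {1..n}) = 0"
  obtains g where "g \<in> Lam n" "Delta n g = f"
    "\<And>j. f \<in> homog n j \<Longrightarrow> g \<in> homog n (j + 2)"
    "\<And>j p. f \<in> homog n j \<Longrightarrow> f \<in> has_parity p \<Longrightarrow> g \<in> has_parity (p + 1)"
proof -
  define w :: "super_mono \<Rightarrow> complex" where "w = (\<lambda>(a, I). of_nat n - of_nat (card I) + of_nat (x_degree a))"
  define f' where "f' = rescale (\<lambda>m. 1 / w m) f"
  have f': "f' \<in> Lam n" using f(1) by (simp add: f'_def rescale_closed)
  have eigen: "(\<Sum>i\<in>{1..n}. h - mul_xi i (d_xi i h) + mul_x i (d_x i h)) = rescale w h" if h: "h \<in> Lam n" for h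
  proof (rule super_poly_eqI)
    fix a :: "nat \<Rightarrow>\<^sub>0 nat" and I
    have 1: "lookup (mul_x i (d_x i h)) (a, I) = of_nat (lookup a i) * lookup h (a, I)" for i
      using minus_single_eq_iff[of a i "a - single i 1"]
      by (auto simp: lookup_ops lookup_single)
    have 2: "lookup (mul_xi i (d_xi i h)) (a, I) = (if i \<in> I then 1 else 0) * lookup h (a, I)" for i
      by (auto simp: lookup_ops xi_sign_remove insert_absorb)
    have "lookup (\<Sum>i\<in>{1..n}. h - mul_xi i (d_xi i h) + mul_x i (d_x i h)) (a, I) =
        (\<Sum>i\<in>{1..n}. 1 - (if i \<in> I then 1 else 0) + of_nat (lookup a i)) * lookup h (a, I)"
      by (simp add: lookup_sum lookup_add lookup_minus 1 2 sum_distrib_right left_diff_distrib distrib_right)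
    also have "\<dots> = w (a, I) * lookup h (a, I)"
    proof (cases "lookup h (a, I) = 0")
      case False
      then have k: "keys a \<subseteq> {1..n}" "I \<subseteq> {1..n}" using h unfolding Lam_iff by blast+
      have "(\<Sum>i\<in>{1..n}. of_nat (lookup a i) :: complex) = of_nat (x_degree a)"
        using x_degree_superset[of "{1..n}" a] k(1) by simp
      moreover have "(\<Sum>i\<in>{1..n}. if i \<in> I then 1 else 0 :: complex) = of_nat (card I)"
      proof -
        have "{1..n} \<inter> I = I" using k(2) by auto
        then show ?thesis by (simp add: sum.If_cases Int_commute)
      qed
      ultimately show ?thesis by (simp add: w_def sum.distrib sum_subtractf)
    qed simp
    finally show "lookup (\<Sum>i\<in>{1..n}. h - mul_xi i (d_xi i h) + mul_x i (d_x i h)) (a, I) =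
        lookup (rescale w h) (a, I)" by (simp add: lookup_rescale)
  qed
  \<comment> \<open>The eigenvalue is not changed by \<open>\<Delta>\<close>, which lowers both \<open>|a|\<close> and \<open>|I|\<close> by one.\<close>
  have "Delta n f' = 0"
  proof (rule super_poly_eqI)
    fix a :: "nat \<Rightarrow>\<^sub>0 nat" and I
    have "lookup (d_x i (d_xi i f')) (a, I) = 1 / w (a, I) * lookup (d_x i (d_xi i f)) (a, I)" for i
    proof (cases "i \<in> I \<or> lookup f (a + single i 1, insert i I) = 0")
      case False
      then have "finite I" using Lam_finite[OF f(1)] by (metis finite_insert)
      then have "w (a + single i 1, insert i I) = w (a, I)"
        using False by (simp add: w_def x_degree_add)
      then show ?thesis by (simp add: lookup_ops f'_def lookup_rescale)
    qed (auto simp: lookup_ops f'_def lookup_rescale)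
    then have "lookup (Delta n f') (a, I) = 1 / w (a, I) * lookup (Delta n f) (a, I)"
      by (simp add: Delta_def lookup_sum sum_distrib_left)
    then show "lookup (Delta n f') (a, I) = lookup 0 (a, I)" using f(2) by simp
  qed
  then have "Delta n (mult_coords n f') = rescale w f'"
    using Delta_mult_coords[of n f'] eigen[OF f'] by (simp add: mult_coords_def mul_linear)
  also have "rescale w f' = f"
  proof (rule super_poly_eqI)
    fix a I
    have "w (a, I) \<noteq> 0" if nz: "lookup f (a, I) \<noteq> 0"
    proof
      assume "w (a, I) = 0"
      then have "of_nat n + of_nat (x_degree a) - of_nat (card I) = (0 :: complex)"
        by (simp add: w_def algebra_simps)
      then have "of_nat (n + x_degree a) = (of_nat (card I) :: complex)" by simp
      then have e: "n + x_degree a = card I" by (rule of_nat_eq_iff[THEN iffD1])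
      have k: "keys a \<subseteq> {1..n}" "I \<subseteq> {1..n}" using f(1) nz unfolding Lam_iff by blast+
      then have "card I \<le> n" using card_mono[of "{1..n}" I] by simp
      then have "card I = n" "x_degree a = 0" using e by auto
      moreover from this have "I = {1..n}" using k(2) card_subset_eq[of "{1..n}" I] by simp
      moreover have "a = 0"
        using \<open>x_degree a = 0\<close> by (intro poly_mapping_eqI) (auto simp: x_degree_def in_keys_iff)
      ultimately show False using nz f(3) by simp
    qed
    then show "lookup (rescale w f') (a, I) = lookup f (a, I)"
      by (cases "lookup f (a, I) = 0") (simp_all add: lookup_rescale f'_def)
  qed
  finally have "Delta n (mult_coords n f') = f" .
  moreover have "mult_coords n f' \<in> homog n (j + 2)" if "f \<in> homog n j" for j
    using that by (intro mult_coords_homog) (simp add: f'_def rescale_closed)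
  moreover have "mult_coords n f' \<in> has_parity (p + 1)" if "f \<in> homog n j" "f \<in> has_parity p" for j p
    using that by (intro mult_coords_parity[of _ n j]) (simp_all add: f'_def rescale_closed)
  ultimately show ?thesis using that mult_coords_Lam[OF f'] by blast
qed

text \<open>Every element of \<open>SHO\<close> is a derivative of an element of \<open>SHO\<close>: if \<open>f = \<Delta> e\<close> and \<open>E\<close> is an integral of \<open>e\<close>
  with respect to \<open>x\<^sub>1\<close>, take \<open>\<Delta> E\<close>, which is in the kernel of \<open>\<Delta>\<close> and does not contain
  \<open>\<xi>\<^sub>1 \<dots> \<xi>\<^sub>n\<close> because it is a value of \<open>\<Delta>\<close>.\<close>

lemma Delta_integrate:
  assumes n: "n \<ge> 1" and f: "f \<in> Lam n" "Delta n f = 0" "lookup f (0, {1..n}) = 0"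
  obtains g where "g \<in> Lam n" "Delta n g = 0" "lookup g (0, {1..n}) = 0" "d_x 1 g = f"
    "\<And>j. f \<in> homog n j \<Longrightarrow> g \<in> homog n (j + 1)"
proof -
  obtain e where e: "e \<in> Lam n" "Delta n e = f" "\<And>j. f \<in> homog n j \<Longrightarrow> e \<in> homog n (j + 2)"
    using Delta_exact[OF f] by metis
  define E where "E = mul_x 1 (rescale (\<lambda>(a, I). 1 / of_nat (lookup a 1 + 1)) e)"
  have "d_x 1 E = e"
    by (rule super_poly_eqI) (simp add: E_def lookup_ops lookup_rescale lookup_single del: of_nat_Suc of_nat_add)
  moreover have "E \<in> Lam n"
    unfolding E_def using n e(1) by (intro mul_Lam rescale_closed) auto
  moreover have "E \<in> homog n (j + 3)" if "f \<in> homog n j" for j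
  proof -
    have "mult_op (1, 0) (rescale (\<lambda>(a, I). 1 / of_nat (lookup a 1 + 1)) e) \<in> homog n (j + 2 + 1)"
      using n e(3)[OF that] by (intro mult_op_homog rescale_closed) (auto simp: coords_def)
    then show ?thesis by (simp add: E_def mult_op_def add.commute)
  qed
  moreover have "d_x 1 (Delta n E) = Delta n (d_x 1 E)"
    using deriv_op_Delta[of "(1, 0)" n E] by (simp add: deriv_op_def)
  ultimately have "d_x 1 (Delta n E) = f" "E \<in> Lam n"
    "\<And>j. f \<in> homog n j \<Longrightarrow> Delta n E \<in> homog n (j + 1)"
    using e(2) Delta_homog[of E n "j + 3" "j + 1" for j] by auto
  then show ?thesis
    by (intro that[of "Delta n E"]) (use Delta_Lam Delta_Delta Delta_top in blast)+
qed

section \<open>\<open>SHO(n,n)\<close> in terms of polynomials without constant term\<close>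

definition drop_const :: "super_poly \<Rightarrow> super_poly" where
  "drop_const f = f - const_sp (lookup f (0, {}))"

lemma lookup_const_sp: "lookup (const_sp c) (a, I) = (if a = 0 \<and> I = {} then c else 0)"
  by (auto simp: const_sp_def lookup_single when_def)

lemma lookup_drop_const:
  "lookup (drop_const f) (a, I) = (if a = 0 \<and> I = {} then 0 else lookup f (a, I))"
  by (auto simp: drop_const_def lookup_minus lookup_const_sp)

lemma drop_const_linear:
  "drop_const (f + g) = drop_const f + drop_const g" "drop_const (f - g) = drop_const f - drop_const g"
  "drop_const (- f) = - drop_const f"
  "drop_const (sp_scale c f) = sp_scale c (drop_const f)" "drop_const 0 = 0"
  by (auto intro!: super_poly_eqI simp: lookup_drop_const lookup_add lookup_minus lookup_sp_scale)

lemma drop_const_eq: "lookup f (0, {}) = 0 \<Longrightarrow> drop_const f = f"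
  by (auto intro!: super_poly_eqI simp: lookup_drop_const)

lemma homog_const_coeff: "f \<in> homog n j \<Longrightarrow> j \<noteq> - 2 \<Longrightarrow> lookup f (0, {}) = 0"
  using homogD(4)[of f n j 0 "{}"] by auto

lemma drop_const_homog: "f \<in> homog n j \<Longrightarrow> j \<noteq> - 2 \<Longrightarrow> drop_const f = f"
  using drop_const_eq homog_const_coeff by blast

lemma drop_const_closed:
  "f \<in> homog n j \<Longrightarrow> drop_const f \<in> homog n j" "f \<in> has_parity p \<Longrightarrow> drop_const f \<in> has_parity p"
  "f \<in> Lam n \<Longrightarrow> drop_const f \<in> Lam n"
  by (simp_all add: homog_def has_parity_def Lam_iff lookup_drop_const)

text \<open>The polynomials of degree \<open>-2\<close> are the constants, and in the reversed parity these are odd.\<close>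

lemma homog_minus_2:
  assumes "f \<in> homog n (- 2)"
  shows "f = const_sp (lookup f (0, {}))" "f \<in> has_parity 0 \<Longrightarrow> f = 0" "drop_const f = 0"
proof -
  have z: "lookup f (a, I) = 0" if "\<not> (a = 0 \<and> I = {})" for a I
  proof (rule ccontr)
    assume nz: "lookup f (a, I) \<noteq> 0"
    note h = homogD[OF assms nz]
    have "x_degree a = 0" "card I = 0" using h(4) by linarith+
    then have "I = {}" using h(3) by simp
    moreover have "a = 0"
      using \<open>x_degree a = 0\<close> by (intro poly_mapping_eqI) (auto simp: x_degree_def in_keys_iff)
    ultimately show False using that by simp
  qed
  show 1: "f = const_sp (lookup f (0, {}))"
    by (rule super_poly_eqI) (use z in \<open>auto simp: lookup_const_sp\<close>)
  show "f = 0" if p: "f \<in> has_parity 0"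
  proof (rule super_poly_eqI)
    fix a I show "lookup f (a, I) = lookup 0 (a, I)"
    proof (rule ccontr)
      assume "lookup f (a, I) \<noteq> lookup 0 (a, I)"
      then have nz: "lookup f (a, I) \<noteq> 0" by simp
      then have "I = {}" using z by blast
      moreover have "of_nat (card I) + 1 = (0 :: bit)" using p nz unfolding has_parity_def by blast
      ultimately show False by simp
    qed
  qed
  show "drop_const f = 0"
    by (rule super_poly_eqI) (use z in \<open>auto simp: lookup_drop_const\<close>)
qed

lemma deriv_op_drop_const: "deriv_op u (drop_const f) = deriv_op u f"
proof -
  have "drop_const f = f + const_sp (- lookup f (0, {}))"
    by (simp add: drop_const_def const_sp_minus)
  then show ?thesis
    by (simp add: deriv_op_def d_x_add_const d_xi_add_const)
qed

lemma Delta_drop_const: "Delta n (drop_const f) = Delta n f"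
proof -
  have "d_xi i (drop_const f) = d_xi i f" for i
    using deriv_op_drop_const[of "(i, 1)" f] by (simp add: deriv_op_def)
  then show ?thesis by (simp add: Delta_def)
qed

lemma buttin_drop_const: "buttin n (drop_const f) g = buttin n f g" "buttin n f (drop_const g) = buttin n f g"
proof -
  have d: "drop_const f = f + const_sp (- lookup f (0, {}))" for f
    by (simp add: drop_const_def const_sp_minus)
  show "buttin n (drop_const f) g = buttin n f g" "buttin n f (drop_const g) = buttin n f g"
    unfolding d by (simp_all add: buttin_def d_x_add_const d_xi_add_const parity_twist_add_const)
qed

text \<open>The homogeneous components of \<open>SHO(n,n)\<close>, represented by polynomials without constant term.\<close>

definition sho_poly :: "nat \<Rightarrow> int \<Rightarrow> super_poly set" where
  "sho_poly n j = {f \<in> homog n j. Delta n f = 0 \<and> lookup f (0, {1..n}) = 0 \<and>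
     lookup f (0, {}) = 0}"

text \<open>The bracket of \<open>HO(n,n)\<close> on representatives without constant term.\<close>

definition br :: "nat \<Rightarrow> super_poly \<Rightarrow> super_poly \<Rightarrow> super_poly" where
  "br n f g = drop_const (buttin n f g)"

lemma sho_polyD:
  assumes "f \<in> sho_poly n j"
  shows "f \<in> homog n j" "f \<in> Lam n" "Delta n f = 0" "lookup f (0, {1..n}) = 0"
    "lookup f (0, {}) = 0" "drop_const f = f"
  using assms homog_Lam drop_const_eq by (auto simp: sho_poly_def)

lemma sho_poly_subspace: "SP.subspace (sho_poly n j)"
  unfolding SP.subspace_def sho_poly_def
  by (auto simp: Delta_linear lookup_add lookup_sp_scale homog_closed)

lemmas sho_poly_closed = SP.subspace_add[OF sho_poly_subspace] SP.subspace_diff[OF sho_poly_subspace]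
  SP.subspace_scale[OF sho_poly_subspace] SP.subspace_0[OF sho_poly_subspace]
  SP.subspace_neg[OF sho_poly_subspace] SP.subspace_sum[OF sho_poly_subspace]

lemma sho_poly_low: "f \<in> sho_poly n j \<Longrightarrow> j < - 1 \<Longrightarrow> f = 0"
proof -
  assume f: "f \<in> sho_poly n j" "j < - 1"
  then consider "j < - 2" | "j = - 2" by linarith
  then show "f = 0"
  proof cases
    case 2
    then show ?thesis using homog_minus_2(3)[of f n] sho_polyD[OF f(1)] by simp
  qed (use homog_low sho_polyD(1)[OF f(1)] in blast)
qed

lemma br_sho_poly:
  assumes f: "f \<in> homog n i" "Delta n f = 0" and g: "g \<in> homog n j" "Delta n g = 0" and m: "m = i + j" and n: "n \<ge> 1"
  shows "br n f g \<in> sho_poly n m"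
proof -
  have "buttin n f g = Delta n (sp_mult (parity_twist f) g)"
    using f g homog_Lam by (intro buttin_eq_Delta) auto
  then have "Delta n (buttin n f g) = 0" "lookup (buttin n f g) (0, {1..n}) = 0"
    using Delta_Delta Delta_top by auto
  then show ?thesis
    using buttin_homog[OF f(1) g(1) m] n
    by (auto simp: sho_poly_def br_def Delta_drop_const lookup_drop_const drop_const_closed)
qed

lemma br_sho_poly':
  assumes "f \<in> sho_poly n i" "g \<in> sho_poly n j" "m = i + j" "n \<ge> 1"
  shows "br n f g \<in> sho_poly n m"
  by (rule br_sho_poly[OF sho_polyD(1,3)[OF assms(1)] sho_polyD(1,3)[OF assms(2)] assms(3,4)])

lemma br_linear:
  "br n (f + f') g = br n f g + br n f' g" "br n f (g + g') = br n f g + br n f g'"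
  "br n (f - f') g = br n f g - br n f' g" "br n f (g - g') = br n f g - br n f g'"
  "br n (sp_scale c f) g = sp_scale c (br n f g)" "br n f (sp_scale c g) = sp_scale c (br n f g)"
  "br n 0 g = 0" "br n f 0 = 0" "br n (- f) g = - br n f g" "br n f (- g) = - br n f g"
  unfolding br_def
  by (simp_all only: buttin_add buttin_diff buttin_scale buttin_minus buttin_0 drop_const_linear)

lemma br_sum: "br n f (sum g A) = (\<Sum>a\<in>A. br n f (g a))" "br n (sum g A) f = (\<Sum>a\<in>A. br n (g a) f)"
  by (induction A rule: infinite_finite_induct) (simp_all add: br_linear)

lemma shift_sho_poly: assumes u: "u \<in> coords n" and n: "n \<ge> 2" shows "shift u \<in> sho_poly n (- 1)"
proof -
  have "Delta n (shift u) = 0"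
    by (simp add: Delta_def d_shift d_linear op_single sum.neutral)
  moreover have "lookup (shift u) (0, {1..n}) = 0"
  proof -
    have "card {1..n} \<noteq> card {fst u}" using n by simp
    then have "{1..n} \<noteq> {fst u}" by metis
    then have 0: "lookup (single (0, {fst u}) (- 1 :: complex)) (0, {1..n}) = 0"
      by (intro lookup_single_not_eq) blast
    have "{} \<noteq> {1..n}" using n by simp
    then have 1: "lookup (single (single (fst u) 1, {}) (1 :: complex)) (0, {1..n}) = 0"
      by (intro lookup_single_not_eq) simp
    show ?thesis
    proof (cases "snd u = 1")
      case True
      show ?thesis unfolding shift_def if_P[OF True] by (rule 1)
    next
      case False
      show ?thesis unfolding shift_def if_not_P[OF False] by (rule 0)
    qed
  qed
  ultimately show ?thesis
    using shift_homog[OF u] homog_const_coeff[OF shift_homog[OF u]] by (simp add: sho_poly_def)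
qed

lemma br_shift:
  assumes "u \<in> coords n"
  shows "br n (shift u) g = drop_const (deriv_op u g)"
    "f \<in> has_parity p \<Longrightarrow> br n f (shift u) = - sp_scale (parity_sign p (snd u)) (drop_const (deriv_op u f))"
  using buttin_shift[OF assms] by (simp_all add: br_def drop_const_linear)

lemma deriv_op_sho_poly:
  assumes f: "f \<in> sho_poly n j" and u: "u \<in> coords n" and n: "n \<ge> 2"
  shows "drop_const (deriv_op u f) \<in> sho_poly n (j - 1)"
  using br_sho_poly'[OF shift_sho_poly[OF u n] f, of "j - 1"] br_shift(1)[OF u, of f] n by simp

text \<open>The derivation property of the derivatives modulo constants.\<close>

lemma drop_const_deriv_br:
  assumes f: "f \<in> Lam n" "f \<in> has_parity p" and g: "g \<in> Lam n"
  shows "drop_const (deriv_op u (br n f g)) = br n (drop_const (deriv_op u f)) g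
    + sp_scale (parity_sign (snd u) p) (br n f (drop_const (deriv_op u g)))"
  unfolding br_def deriv_op_drop_const deriv_op_buttin[OF f g] drop_const_linear buttin_drop_const ..

lemma sho_poly_integrate:
  assumes f: "f \<in> sho_poly n j" and j: "j \<ge> - 1" and n: "n \<ge> 1"
  obtains g where "g \<in> sho_poly n (j + 1)" "deriv_op (1, 0) g = f"
proof -
  obtain g where g: "Delta n g = 0" "lookup g (0, {1..n}) = 0" "d_x 1 g = f" "g \<in> homog n (j + 1)"
    using Delta_integrate[OF n sho_polyD(2-4)[OF f]] sho_polyD(1)[OF f] by metis
  then show ?thesis
    using homog_const_coeff[OF g(4)] j by (intro that[of g]) (auto simp: sho_poly_def deriv_op_def)
qed

subsection \<open>Representatives of classes modulo constants\<close>

text \<open>Dropping the constant term makes the choice of representatives linear.\<close>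

definition repr :: "super_poly_mod \<Rightarrow> super_poly" where
  "repr u = drop_const (rep_super_poly_mod u)"

lemma mod_class_eq_iff: "mod_class f = mod_class g \<longleftrightarrow> drop_const f = drop_const g"
proof -
  have "mod_class f = mod_class g \<longleftrightarrow> const_rel f g"
    unfolding mod_class_def using Quotient_super_poly_mod equivp_const_rel
    by (metis Quotient_rel equivp_def)
  also have "\<dots> \<longleftrightarrow> drop_const f = drop_const g"
  proof
    assume "const_rel f g"
    then obtain c where "f = g + const_sp c" by (auto simp: const_rel_def)
    then show "drop_const f = drop_const g"
      by (intro super_poly_eqI) (auto simp: lookup_drop_const lookup_add lookup_const_sp)
  next
    assume "drop_const f = drop_const g"
    then have "f = g + const_sp (lookup f (0, {}) - lookup g (0, {}))"
      by (simp add: drop_const_def const_sp_add[of "_" "- _", simplified] const_sp_minus algebra_simps)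
    then show "const_rel f g" unfolding const_rel_def by blast
  qed
  finally show ?thesis .
qed

lemma mod_class_repr [simp]: "mod_class (repr u) = u"
proof -
  have "mod_class (drop_const (rep_super_poly_mod u)) = mod_class (rep_super_poly_mod u)"
    by (simp add: mod_class_eq_iff drop_const_eq lookup_drop_const)
  also have "\<dots> = u"
    unfolding mod_class_def using Quotient_super_poly_mod by (rule Quotient_abs_rep)
  finally show ?thesis by (simp add: repr_def)
qed

lemma repr_mod_class: "repr (mod_class f) = drop_const f"
  using mod_class_repr[of "mod_class f"] unfolding mod_class_eq_iff
  by (simp add: repr_def drop_const_eq lookup_drop_const)

lemma mod_class_ops:
  "mod_class (f + g) = mod_class f + mod_class g"
  "mod_class (- f) = - mod_class f"
  "mod_class (f - g) = mod_class f - mod_class g"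
  "mod_scale c (mod_class f) = mod_class (sp_scale c f)"
  "mod_buttin n (mod_class f) (mod_class g) = mod_class (br n f g)"
  "mod_class 0 = 0"
proof -
  show 1: "mod_class (f + g) = mod_class f + mod_class g" for f g by (simp add: mod_class_def plus_super_poly_mod.abs_eq)
  show 2: "mod_class (- f) = - mod_class f" for f by (simp add: mod_class_def uminus_super_poly_mod.abs_eq)
  show "mod_class (f - g) = mod_class f - mod_class g" using 1[of f "- g"] 2[of g] by simp
  show "mod_scale c (mod_class f) = mod_class (sp_scale c f)" by (simp add: mod_class_def mod_scale.abs_eq)
  show "mod_buttin n (mod_class f) (mod_class g) = mod_class (br n f g)"
  proof -
    have "mod_buttin n (mod_class f) (mod_class g) = mod_class (buttin n f g)"
      unfolding mod_class_def by (rule mod_buttin.abs_eq)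
    then show ?thesis by (simp add: mod_class_eq_iff br_def drop_const_eq lookup_drop_const)
  qed
  show "mod_class 0 = 0" by (simp add: mod_class_def zero_super_poly_mod_def)
qed

lemma repr_linear: "repr (u + v) = repr u + repr v" "repr (- u) = - repr u" "repr (mod_scale c u) = sp_scale c (repr u)" "repr 0 = 0"
proof -
  have r: "drop_const (repr u) = repr u" for u by (simp add: repr_def drop_const_eq lookup_drop_const)
  show "repr (u + v) = repr u + repr v"
    using repr_mod_class[of "repr u + repr v"] by (simp add: mod_class_ops drop_const_linear r)
  show "repr (- u) = - repr u"
    using repr_mod_class[of "- repr u"] by (simp add: mod_class_ops drop_const_linear r)
  show "repr (mod_scale c u) = sp_scale c (repr u)"
    using repr_mod_class[of "sp_scale c (repr u)"] by (simp add: mod_class_ops[symmetric] drop_const_linear r)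
  show "repr 0 = 0" using repr_mod_class[of 0] by (simp add: mod_class_ops drop_const_linear)
qed

text \<open>Brackets are values of \<open>\<Delta>\<close>, which do not contain \<open>\<xi>\<^sub>1 \<dots> \<xi>\<^sub>n\<close>.  Conversely, an element of the right-hand
  side is a derivative by \<open>Delta_integrate\<close>, hence a bracket with a coordinate.\<close>

lemma SHO_space_eq:
  assumes n: "n \<ge> 2"
  shows "SHO_space n = mod_class ` {f \<in> Lam n. Delta n f = 0 \<and> lookup f (0, {1..n}) = 0}" (is "_ = mod_class ` ?K")
proof
  interpret V: vector_space mod_scale by (rule vector_space_mod_scale)
  have top: "{1..n} \<noteq> {}" using n by auto
  have sub: "V.subspace (mod_class ` ?K)"
  proof (rule V.subspaceI)
    show "0 \<in> mod_class ` ?K" using mod_class_ops(6)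
      by (intro image_eqI[of _ _ 0]) (auto simp: Delta_linear Lam_closed)
    show "u + v \<in> mod_class ` ?K" if "u \<in> mod_class ` ?K" "v \<in> mod_class ` ?K" for u v
      using that by (auto simp: mod_class_ops(1)[symmetric] Delta_linear Lam_closed lookup_add intro!: imageI)
    show "mod_scale c u \<in> mod_class ` ?K" if "u \<in> mod_class ` ?K" for c u
      using that by (auto simp: mod_class_ops(4) Delta_linear Lam_closed lookup_sp_scale intro!: imageI)
  qed
  show "SHO_space n \<subseteq> mod_class ` ?K"
    unfolding SHO_space_def
  proof (rule V.span_minimal[OF _ sub], clarify)
    fix u v assume "u \<in> SHO' n" "v \<in> SHO' n"
    then obtain f g where f: "u = mod_class f" "f \<in> Lam n" "Delta n f = 0" and g: "v = mod_class g" "g \<in> Lam n" "Delta n g = 0"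
      by (auto simp: SHO'_def)
    let ?h = "sp_mult (parity_twist f) g"
    have "?h \<in> Lam n" using f g by (intro sp_mult_Lam Lam_ops)
    then have "Delta n ?h \<in> ?K" using Delta_Lam Delta_Delta Delta_top by blast
    moreover have "mod_buttin n u v = mod_class (Delta n ?h)"
      unfolding f(1) g(1) mod_class_ops(5) mod_class_eq_iff br_def buttin_eq_Delta[OF f(2,3) g(2,3)]
      by (simp add: drop_const_eq lookup_drop_const)
    ultimately show "mod_buttin n u v \<in> mod_class ` ?K" by blast
  qed
  show "mod_class ` ?K \<subseteq> SHO_space n"
  proof clarify
    fix f assume f: "f \<in> Lam n" "Delta n f = 0" "lookup f (0, {1..n}) = 0"
    obtain g where g: "g \<in> Lam n" "Delta n g = 0" "d_x 1 g = f"
      using Delta_integrate[OF _ f] n by (metis One_nat_def Suc_1 Suc_leD)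
    have c: "(1, 0) \<in> coords n" using n by (simp add: coords_def)
    have "mod_class f = mod_buttin n (mod_class (shift (1, 0))) (mod_class g)"
      using br_shift(1)[OF c, of g] g(3)
      by (simp add: mod_class_ops(5) mod_class_eq_iff deriv_op_def drop_const_eq lookup_drop_const)
    moreover have "mod_class (shift (1, 0)) \<in> SHO' n" "mod_class g \<in> SHO' n"
      using sho_polyD(2,3)[OF shift_sho_poly[OF c n]] g by (auto simp: SHO'_def)
    ultimately show "mod_class f \<in> SHO_space n"
      unfolding SHO_space_def by (intro V.span_base) blast
  qed
qed

lemma SHO_grade:
  assumes n: "n \<ge> 2"
  shows "grade (SHO n) j = mod_class ` sho_poly n j"
proof (intro equalityI subsetI)
  fix u assume "u \<in> grade (SHO n) j"
  then obtain f g where f: "u = mod_class f" "f \<in> Lam n" "\<forall>(a, I)\<in>keys f. int (x_degree a) + int (card I) - 2 = j"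
    and g: "u = mod_class g" "Delta n g = 0" "lookup g (0, {1..n}) = 0"
    unfolding SHO_def SHO_space_eq[OF n] by auto
  have fg: "drop_const f = drop_const g" using f(1) g(1) mod_class_eq_iff by metis
  have "f \<in> homog n j" using f(2,3) by (auto simp: homog_def Lam_iff in_keys_iff)
  then have "drop_const f \<in> sho_poly n j"
    using n g(2,3) fg Delta_drop_const[of n g] drop_const_closed(1)[of f n j] unfolding sho_poly_def
    by (auto simp: lookup_drop_const)
  moreover have "u = mod_class (drop_const f)"
    using f(1) by (simp add: mod_class_eq_iff drop_const_eq lookup_drop_const)
  ultimately show "u \<in> mod_class ` sho_poly n j" by blast
next
  fix u assume "u \<in> mod_class ` sho_poly n j"
  then obtain f where f: "u = mod_class f" "f \<in> sho_poly n j" by blast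
  note h = sho_polyD[OF f(2)]
  then have "\<forall>(a, I)\<in>keys f. int (x_degree a) + int (card I) - 2 = j"
    by (auto simp: homog_def in_keys_iff)
  then show "u \<in> grade (SHO n) j"
    using f(1) h unfolding SHO_def SHO_space_eq[OF n] by auto
qed

lemma has_parity_keys: "f \<in> has_parity p \<longleftrightarrow> (\<forall>(a, I)\<in>keys f. of_nat (card I) + 1 = p)"
  by (simp add: has_parity_def Ball_def in_keys_iff split_paired_All)

lemma SHO_component:
  assumes n: "n \<ge> 2"
  shows "grade (SHO n) j \<inter> lie_part (SHO n) p = mod_class ` (sho_poly n j \<inter> has_parity p)"
proof (intro equalityI subsetI)
  fix u assume u: "u \<in> grade (SHO n) j \<inter> lie_part (SHO n) p"
  then obtain f where f: "u = mod_class f" "f \<in> sho_poly n j" using SHO_grade[OF n] by auto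
  obtain g where g: "u = mod_class g" "\<forall>(a, I)\<in>keys g. of_nat (card I) + 1 = p"
    using u unfolding SHO_def by auto
  have "g \<in> has_parity p" using g(2) unfolding has_parity_keys .
  moreover have "f = drop_const g" using f g(1) sho_polyD(6) mod_class_eq_iff by metis
  ultimately show "u \<in> mod_class ` (sho_poly n j \<inter> has_parity p)"
    using f drop_const_closed(2) by blast
next
  fix u assume "u \<in> mod_class ` (sho_poly n j \<inter> has_parity p)"
  then obtain f where f: "u = mod_class f" "f \<in> sho_poly n j" "f \<in> has_parity p" by blast
  then have g: "u \<in> grade (SHO n) j" using SHO_grade[OF n] by blast
  moreover have "\<forall>(a, I)\<in>keys f. of_nat (card I) + 1 = p"
    using f(3) unfolding has_parity_keys .
  then have "u \<in> lie_part (SHO n) p"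
    using f(1) sho_polyD(2)[OF f(2)] g unfolding SHO_def by auto
  ultimately show "u \<in> grade (SHO n) j \<inter> lie_part (SHO n) p" by blast
qed

section \<open>Cocycles of positive degree\<close>

lemma parity_sign_add: "parity_sign (a + b) c = parity_sign a c * parity_sign b c"
  by (cases a; cases b; cases c; simp add: parity_sign_def)

lemma parity_sign_0 [simp]: "parity_sign 0 a = 1" "parity_sign a 0 = 1"
  by (simp_all add: parity_sign_def)

text \<open>The parity components are \<open>f \<mp> parity_twist f\<close>, up to the factor 2.\<close>

lemma sho_parity_decompose:
  assumes f: "f \<in> sho_poly n j"
  shows "\<exists>g h. g \<in> sho_poly n j \<and> g \<in> has_parity 0 \<and> h \<in> sho_poly n j \<and> h \<in> has_parity 1 \<and> f = g + h"
proof -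
  let ?t = "parity_twist f"
  have "Delta n ?t = 0"
  proof -
    have e: "d_x i (d_xi i ?t) = - parity_twist (d_x i (d_xi i f))" for i
      using parity_twist_deriv(2)[OF sho_polyD(2)[OF f], of i] by (simp add: parity_twist_deriv(1) d_linear)
    have "Delta n ?t = - parity_twist (Delta n f)"
    proof -
      have "parity_twist (sum F A) = (\<Sum>a\<in>A. parity_twist (F a))" for F and A :: "nat set"
        by (induction A rule: infinite_finite_induct) (simp_all add: parity_twist_linear)
      then show ?thesis unfolding Delta_def e by (simp add: sum_negf)
    qed
    then show ?thesis using sho_polyD(3)[OF f] by simp
  qed
  then have t: "?t \<in> sho_poly n j"
    using sho_polyD[OF f] by (simp add: sho_poly_def homog_def lookup_parity_twist)
  define g h where "g = sp_scale (1 / 2) (f - ?t)" and "h = sp_scale (1 / 2) (f + ?t)"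
  have "g \<in> sho_poly n j" "h \<in> sho_poly n j"
    unfolding g_def h_def using f t sho_poly_closed by auto
  moreover have "g \<in> has_parity 0" "h \<in> has_parity 1"
    unfolding has_parity_def g_def h_def
    by (auto simp: lookup_ops of_nat_bit split: if_splits)
  moreover have "f = g + h"
    by (rule super_poly_eqI) (simp add: g_def h_def lookup_ops algebra_simps)
  ultimately show ?thesis by blast
qed

text \<open>An even cocycle \<open>m\<close> of positive degree \<open>k\<close> on \<open>SHO(n,n)\<close>, in terms of the polynomials that represent its
  elements.  The Jacobi identity of \<open>SHO(n,n)\<close> is among the assumptions, because in the application it is
  inherited from the filtered deformation.\<close>

locale sho_cocycle =
  fixes n :: nat and k :: int and m :: "int \<Rightarrow> int \<Rightarrow> super_poly \<Rightarrow> super_poly \<Rightarrow> super_poly"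
  assumes n: "n \<ge> 3" and k: "k > 0"
    and m_in: "\<And>i j f g. f \<in> sho_poly n i \<Longrightarrow> g \<in> sho_poly n j \<Longrightarrow> m i j f g \<in> sho_poly n (i + j + k)"
    and m_parity: "\<And>i j f g a b. f \<in> sho_poly n i \<Longrightarrow> f \<in> has_parity a \<Longrightarrow> g \<in> sho_poly n j \<Longrightarrow> g \<in> has_parity b \<Longrightarrow>
      m i j f g \<in> has_parity (a + b)"
    and m_add: "\<And>i j f f' g. f \<in> sho_poly n i \<Longrightarrow> f' \<in> sho_poly n i \<Longrightarrow> g \<in> sho_poly n j \<Longrightarrow>
      m i j (f + f') g = m i j f g + m i j f' g"
      "\<And>i j f f' g. f \<in> sho_poly n i \<Longrightarrow> f' \<in> sho_poly n i \<Longrightarrow> g \<in> sho_poly n j \<Longrightarrow>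
      m j i g (f + f') = m j i g f + m j i g f'"
    and m_scale: "\<And>i j f g c. f \<in> sho_poly n i \<Longrightarrow> g \<in> sho_poly n j \<Longrightarrow>
      m i j (sp_scale c f) g = sp_scale c (m i j f g)"
      "\<And>i j f g c. f \<in> sho_poly n i \<Longrightarrow> g \<in> sho_poly n j \<Longrightarrow>
      m i j f (sp_scale c g) = sp_scale c (m i j f g)"
    and m_skew: "\<And>i j f g a b. f \<in> sho_poly n i \<Longrightarrow> f \<in> has_parity a \<Longrightarrow> g \<in> sho_poly n j \<Longrightarrow> g \<in> has_parity b \<Longrightarrow>
      m i j f g = - sp_scale (parity_sign a b) (m j i g f)"
    and m_cocycle: "\<And>i j l f g h a b c. f \<in> sho_poly n i \<Longrightarrow> f \<in> has_parity a \<Longrightarrow>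
      g \<in> sho_poly n j \<Longrightarrow> g \<in> has_parity b \<Longrightarrow> h \<in> sho_poly n l \<Longrightarrow> h \<in> has_parity c \<Longrightarrow>
      br n f (m j l g h) + m i (j + l) f (br n g h) =
        br n (m i j f g) h + m (i + j) l (br n f g) h
        + sp_scale (parity_sign a b) (br n g (m i l f h) + m j (i + l) g (br n f h))"
    and jacobi: "\<And>i j l f g h a b c. f \<in> sho_poly n i \<Longrightarrow> f \<in> has_parity a \<Longrightarrow>
      g \<in> sho_poly n j \<Longrightarrow> g \<in> has_parity b \<Longrightarrow> h \<in> sho_poly n l \<Longrightarrow> h \<in> has_parity c \<Longrightarrow>
      br n f (br n g h) = br n (br n f g) h + sp_scale (parity_sign a b) (br n g (br n f h))"
begin

lemma m_0: "f \<in> sho_poly n i \<Longrightarrow> m i j f 0 = 0" "f \<in> sho_poly n i \<Longrightarrow> m j i 0 f = 0"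
  using m_add(1)[of 0 j 0 f i] m_add(2)[of 0 j 0 f i] sho_poly_closed(4) by auto

lemma m_minus:
  assumes "f \<in> sho_poly n i" "g \<in> sho_poly n j"
  shows "m i j (- f) g = - m i j f g" "m i j f (- g) = - m i j f g"
  using m_scale[OF assms, of "- 1"] by simp_all

lemma m_sum:
  assumes "\<And>a. a \<in> A \<Longrightarrow> f a \<in> sho_poly n i" "g \<in> sho_poly n j"
  shows "m i j (sum f A) g = (\<Sum>a\<in>A. m i j (f a) g)" "m j i g (sum f A) = (\<Sum>a\<in>A. m j i g (f a))"
  using assms(1) by (induction A rule: infinite_finite_induct)
    (auto simp: m_0[OF assms(2)] m_add sho_poly_closed assms(2))

lemma shift_in: "u \<in> coords n \<Longrightarrow> shift u \<in> sho_poly n (- 1)"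
  using shift_sho_poly n by simp

lemma br_shift_shift: "u \<in> coords n \<Longrightarrow> v \<in> coords n \<Longrightarrow> br n (shift u) (shift v) = 0"
  using sho_poly_low[OF br_sho_poly'[OF shift_in shift_in, of u v "- 2"]] n by simp

text \<open>The restriction of the cocycle to degree \<open>-1\<close>, a 2-form on the superspace of dimension \<open>n|n\<close>.\<close>

definition c :: "nat \<times> bit \<Rightarrow> nat \<times> bit \<Rightarrow> super_poly" where
  "c u v = m (- 1) (- 1) (shift u) (shift v)"

lemma c_in: assumes "u \<in> coords n" "v \<in> coords n"
  shows "c u v \<in> sho_poly n (k - 2)" "c u v \<in> homog n (k - 2)" "c u v \<in> has_parity (snd u + snd v)"
  using m_in[OF shift_in[OF assms(1)] shift_in[OF assms(2)]]
    m_parity[OF shift_in[OF assms(1)] shift_parity shift_in[OF assms(2)] shift_parity]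
  by (auto simp: c_def sho_polyD)

lemma c_skew: "u \<in> coords n \<Longrightarrow> v \<in> coords n \<Longrightarrow> c u v = - sp_scale (coord_sign u v) (c v u)"
  unfolding c_def by (intro m_skew shift_in shift_parity)

text \<open>The cocycle identity for three elements of degree \<open>-1\<close>, which commute modulo constants and act by the
  derivatives.\<close>

lemma c_closed_mod_const:
  assumes uvw: "u \<in> coords n" "v \<in> coords n" "w \<in> coords n"
  shows "drop_const (deriv_op u (c v w)) = sp_scale (coord_sign u v) (drop_const (deriv_op v (c u w)))
    - sp_scale (coord_sign u w * coord_sign v w) (drop_const (deriv_op w (c u v)))"
proof -
  have "br n (shift u) (c v w) = br n (c u v) (shift w) + sp_scale (coord_sign u v) (br n (shift v) (c u w))"
    using m_cocycle[OF shift_in[OF uvw(1)] shift_parity shift_in[OF uvw(2)] shift_parity shift_in[OF uvw(3)] shift_parity]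
      m_0[OF shift_in[OF uvw(1)]] m_0[OF shift_in[OF uvw(2)]] m_0[OF shift_in[OF uvw(3)]]
    by (simp add: br_shift_shift uvw c_def[symmetric])
  then show ?thesis
    unfolding br_shift(1)[OF uvw(1)] br_shift(1)[OF uvw(2)] br_shift(2)[OF uvw(3) c_in(3)[OF uvw(1,2)]] parity_sign_add
    by simp
qed

subsection \<open>The 3-form of constants in degree 1\<close>

context
  assumes k1: "k = 1"
begin

text \<open>The differential of \<open>c\<close>.  In degree \<open>k = 1\<close> the coefficients of \<open>c\<close> are linear, so those of the
  differential are constants, and \<open>c_closed_mod_const\<close> gives no information about them.\<close>

definition three_form :: "nat \<times> bit \<Rightarrow> nat \<times> bit \<Rightarrow> nat \<times> bit \<Rightarrow> super_poly" where
  "three_form u v w = deriv_op u (c v w) + sp_scale (coord_sign u w * coord_sign v w) (deriv_op w (c u v))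
     - sp_scale (coord_sign u v) (deriv_op v (c u w))"

text \<open>The cocycle identity for an element \<open>a\<close> of degree 0 and two elements of degree \<open>-1\<close>: the action of \<open>a\<close>
  changes \<open>c\<close> by the differential of the 1-form \<open>q\<close>.\<close>

lemma act_on_c:
  assumes a: "a \<in> sho_poly n 0" "a \<in> has_parity 0" and v: "v \<in> coords n" and w: "w \<in> coords n"
  defines "q \<equiv> \<lambda>v. m 0 (- 1) a (shift v)"
  shows "br n a (c v w) = deriv_op v (q w) - sp_scale (coord_sign v w) (deriv_op w (q v))
    - m (- 1) (- 1) (deriv_op v a) (shift w) - m (- 1) (- 1) (shift v) (deriv_op w a)"
proof -
  have da: "drop_const (deriv_op u a) = deriv_op u a" for u
    using drop_const_homog[OF deriv_op_homog[OF sho_polyD(1)[OF a(1)], of u]] by simp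
  have q: "q u \<in> sho_poly n 0" "q u \<in> has_parity (snd u)" if "u \<in> coords n" for u
    using m_in[OF a(1) shift_in[OF that]] m_parity[OF a shift_in[OF that] shift_parity] unfolding q_def k1 add_0
    by simp_all
  have dq: "drop_const (deriv_op u (q x)) = deriv_op u (q x)" if "x \<in> coords n" for u x
    using drop_const_homog[OF deriv_op_homog[OF sho_polyD(1)[OF q(1)[OF that]], of u]] by simp
  have b: "br n a (shift u) = - deriv_op u a" if "u \<in> coords n" for u
    using br_shift(2)[OF that a(2)] da by simp
  have in1: "deriv_op u a \<in> sho_poly n (- 1)" if "u \<in> coords n" for u
    using deriv_op_sho_poly[OF a(1) that] n da by simp
  have "br n a (c v w) = br n (q v) (shift w) + m (- 1) (- 1) (br n a (shift v)) (shift w)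
      + (br n (shift v) (q w) + m (- 1) (- 1) (shift v) (br n a (shift w)))"
    using m_cocycle[OF a shift_in[OF v] shift_parity shift_in[OF w] shift_parity] m_0[OF a(1)]
    by (simp add: br_shift_shift v w c_def q_def)
  then show ?thesis
    using br_shift(2)[OF w q(2)[OF v]] m_minus(1)[OF in1[OF v] shift_in[OF w]] m_minus(2)[OF shift_in[OF v] in1[OF w]]
    by (simp add: b v w br_shift(1) dq)
qed

text \<open>The derivatives of an element of degree \<open>-1\<close> are constants, and constants are central.\<close>

lemma deriv_br_linear:
  assumes a: "a \<in> sho_poly n 0" "a \<in> has_parity 0" and f: "f \<in> sho_poly n (- 1)"
  shows "deriv_op u (br n a f) = buttin n (deriv_op u a) f"
proof -
  have "deriv_op u f \<in> homog n (- 2)" using deriv_op_homog[OF sho_polyD(1)[OF f], of u] by simp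
  then have "drop_const (deriv_op u f) = 0" by (rule homog_minus_2(3))
  then have "buttin n a (deriv_op u f) = 0" using buttin_drop_const(2)[of n a "deriv_op u f"] by simp
  then show ?thesis
    using deriv_op_buttin[OF sho_polyD(2)[OF a(1)] a(2) sho_polyD(2)[OF f], of u]
    by (simp add: br_def deriv_op_drop_const)
qed

text \<open>An element of degree 0 that acts diagonally on the coordinates multiplies the coefficients of the
  3-form by sums of three eigenvalues.  On the other hand it changes \<open>c\<close> only by a differential by
  \<open>act_on_c\<close>, so it annihilates the 3-form.\<close>

lemma three_form_weight:
  assumes a: "a \<in> sho_poly n 0" "a \<in> has_parity 0"
    and t: "\<And>u. u \<in> coords n \<Longrightarrow> deriv_op u a = - sp_scale (t u) (shift u)"
    and uvw: "u \<in> coords n" "v \<in> coords n" "w \<in> coords n"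
  shows "sp_scale (t u + t v + t w) (three_form u v w) = 0"
proof -
  define q where "q = (\<lambda>v. m 0 (- 1) a (shift v))"
  have X: "sp_scale (t u + t v + t w) (deriv_op u (c v w)) =
      sp_scale (coord_sign v w) (deriv_op u (deriv_op w (q v))) - deriv_op u (deriv_op v (q w))"
    if uvw: "u \<in> coords n" "v \<in> coords n" "w \<in> coords n" for u v w
  proof -
    have "m (- 1) (- 1) (deriv_op v a) (shift w) = - sp_scale (t v) (c v w)"
      "m (- 1) (- 1) (shift v) (deriv_op w a) = - sp_scale (t w) (c v w)"
      using t uvw shift_in sho_poly_closed(3)[of "shift v" n "- 1" "t v"] sho_poly_closed(3)[of "shift w" n "- 1" "t w"]
      by (simp_all add: m_minus[of _ "- 1" _ "- 1"] m_scale c_def)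
    then have "br n a (c v w) = deriv_op v (q w) - sp_scale (coord_sign v w) (deriv_op w (q v))
        + sp_scale (t v) (c v w) + sp_scale (t w) (c v w)"
      using act_on_c[OF a uvw(2,3)] by (simp add: q_def)
    then have "deriv_op u (br n a (c v w)) = deriv_op u (deriv_op v (q w))
        - sp_scale (coord_sign v w) (deriv_op u (deriv_op w (q v)))
        + sp_scale (t v) (deriv_op u (c v w)) + sp_scale (t w) (deriv_op u (c v w))"
      by (simp add: deriv_op_linear)
    moreover have "deriv_op u (br n a (c v w)) = - sp_scale (t u) (deriv_op u (c v w))"
      using deriv_br_linear[OF a, of "c v w" u] c_in(1)[OF uvw(2,3)] k1 t[OF uvw(1)] buttin_shift(1)[OF uvw(1)]
      by (simp add: buttin_minus buttin_scale)
    ultimately show ?thesis by (simp add: SP.scale_left_distrib algebra_simps)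
  qed
  note comm = deriv_op_commute[of v u "q w"] deriv_op_commute[of w u "q v"] deriv_op_commute[of w v "q u"]
  have T: "t w + t u + t v = t u + t v + t w" "t v + t u + t w = t u + t v + t w" by simp_all
  show ?thesis
    using X[OF uvw] X[OF uvw(3,1,2)] X[OF uvw(2,1,3)] comm unfolding T three_form_def
    by (cases "snd u"; cases "snd v"; cases "snd w"; simp add: parity_sign_def SP.scale_right_distrib SP.scale_right_diff_distrib)
qed

lemma sho_poly_0I:
  assumes "f \<in> homog n 0" "Delta n f = 0"
  shows "f \<in> sho_poly n 0"
  using assms homogD(4)[OF assms(1), of 0 "{1..n}"] homog_const_coeff[OF assms(1)] n by (auto simp: sho_poly_def)

text \<open>The weights of \<open>\<xi>\<^sub>i\<close> and of \<open>x\<^sub>i\<close> under \<open>x\<^sub>i \<xi>\<^sub>i\<close> are opposite.\<close>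

definition coord_weight :: "nat \<times> bit \<Rightarrow> int" where
  "coord_weight u = (if snd u = 1 then - 1 else 1)"

text \<open>The elements \<open>x\<^sub>i \<xi>\<^sub>i - x\<^sub>j \<xi>\<^sub>j\<close> are in the kernel of \<open>\<Delta>\<close>, unlike \<open>x\<^sub>i \<xi>\<^sub>i\<close>, so that only the differences of
  the weights for different indices have to vanish.\<close>

lemma three_form_torus:
  assumes ij: "i \<in> {1..n}" "j \<in> {1..n}" "i \<noteq> j" and uvw: "u \<in> coords n" "v \<in> coords n" "w \<in> coords n"
    and nz: "three_form u v w \<noteq> 0"
  shows "(\<Sum>x\<leftarrow>[u, v, w]. if fst x = i then coord_weight x else 0) = (\<Sum>x\<leftarrow>[u, v, w]. if fst x = j then coord_weight x else 0)"
proof -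
  define a :: super_poly where "a = single (single i 1, {i}) 1
    - single (single j 1, {j}) 1"
  define t where "t u = of_int (coord_weight u) * ((if fst u = i then 1 else 0) - (if fst u = j then 1 else 0) :: complex)" for u
  have xs: "xi_sign l {l} = 1" for l
  proof -
    have e: "{j \<in> {l}. j < l} = {}" by auto
    show ?thesis unfolding xi_sign_def e by simp
  qed
  have d: "d_x l a = sp_scale ((if l = i then 1 else 0) - (if l = j then 1 else 0)) (single (0, {l}) 1)"
    "d_xi l a = sp_scale ((if l = i then 1 else 0) - (if l = j then 1 else 0)) (single (single l 1, {}) 1)" for l
    using ij by (auto simp: a_def d_diff op_single xs lookup_single_not_eq sp_scale_single single_uminus[symmetric])
  have a: "a \<in> homog n 0" "a \<in> has_parity 0"
    unfolding a_def using ij by (intro homog_closed(2) has_parity_closed(2) single_homog single_parity; simp)+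
  have "Delta n a = (\<Sum>l\<in>{1..n}. sp_scale ((if l = i then 1 else 0) - (if l = j then 1 else 0)) (single (0, {}) 1))"
    by (simp add: Delta_def d d_scale op_single)
  also have "\<dots> = sp_scale (\<Sum>l\<in>{1..n}. (if l = i then 1 else 0) - (if l = j then 1 else 0)) (single (0, {}) 1)"
    by (simp only: SP.scale_sum_left)
  also have "\<dots> = 0" using ij by (simp add: sum_subtractf)
  finally have aH: "a \<in> sho_poly n 0" by (rule sho_poly_0I[OF a(1)])
  have "deriv_op u a = - sp_scale (t u) (shift u)" for u
    by (cases u; cases "snd u = 0") (auto simp: deriv_op_def d t_def coord_weight_def shift_def sp_scale_single single_uminus[symmetric])
  then have "sp_scale (t u + t v + t w) (three_form u v w) = 0"
    using three_form_weight[OF aH a(2)] uvw by blast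
  then have "t u + t v + t w = 0" using nz by simp
  then have "of_int ((\<Sum>x\<leftarrow>[u, v, w]. if fst x = i then coord_weight x else 0) - (\<Sum>x\<leftarrow>[u, v, w]. if fst x = j then coord_weight x else 0)) = (0 :: complex)"
    by (simp add: t_def algebra_simps split: if_splits)
  then show ?thesis unfolding of_int_eq_0_iff by simp
qed

text \<open>The bracket with \<open>a = x\<^sub>i \<xi>\<^sub>j\<close> sends \<open>shift V\<close>, \<open>V = (j, 1)\<close>, to a multiple of \<open>shift U\<close>, \<open>U = (i, 1)\<close>, and
  annihilates \<open>shift W\<close>, \<open>W = (l, 1)\<close>.  The 3-form is symmetric in these odd elements, so its invariance
  under \<open>a\<close>, evaluated at \<open>V, V, W\<close>, says that twice its coefficient at \<open>U, V, W\<close> is zero.  As in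
  \<open>three_form_weight\<close>, the invariance comes from \<open>act_on_c\<close>.\<close>

lemma three_form_distinct:
  assumes ijl: "i \<in> {1..n}" "j \<in> {1..n}" "l \<in> {1..n}" "i \<noteq> j" "l \<noteq> j"
  shows "three_form (i, 1) (j, 1) (l, 1) = 0"
proof -
  define U V W where UVW: "U = (i, 1 :: bit)" "V = (j, 1 :: bit)" "W = (l, 1 :: bit)"
  have C: "U \<in> coords n" "V \<in> coords n" "W \<in> coords n" using ijl by (auto simp: UVW coords_def)
  define a :: super_poly where "a = single (single i 1, {j}) 1"
  define q where "q = (\<lambda>v. m 0 (- 1) a (shift v))"
  have xs: "xi_sign l {l} = 1" for l
  proof -
    have e: "{j \<in> {l}. j < l} = {}" by auto
    show ?thesis unfolding xi_sign_def e by simp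
  qed
  have a: "a \<in> homog n 0" "a \<in> has_parity 0"
    unfolding a_def using ijl by (intro single_homog single_parity; simp)+
  have d: "d_x p (d_xi p a) = 0" for p
    using ijl(4) by (cases "p = j") (simp_all add: a_def op_single lookup_single_not_eq d_linear)
  have "Delta n a = 0" unfolding Delta_def d by simp
  then have aH: "a \<in> sho_poly n 0" by (rule sho_poly_0I[OF a(1)])
  have dV: "deriv_op V a = shift U" by (simp add: UVW deriv_op_def a_def op_single xs shift_def)
  have dW: "deriv_op W a = 0" using ijl(5) by (simp add: UVW deriv_op_def a_def op_single)
  have s: "coord_sign V V = - 1" "coord_sign V W = - 1" "coord_sign U V = - 1" "coord_sign U W = - 1"
    by (simp_all add: UVW parity_sign_def)
  have cVU: "c V U = c U V" using c_skew[OF C(2,1)] by (simp add: UVW parity_sign_def)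
  have VV: "br n a (c V V) = deriv_op V (q V) + deriv_op V (q V) - c U V - c U V"
    using act_on_c[OF aH a(2) C(2,2)] by (simp add: s dV c_def[symmetric] cVU q_def)
  have VW: "br n a (c V W) = deriv_op V (q W) + deriv_op W (q V) - c U W"
    using act_on_c[OF aH a(2) C(2,3)] m_0(1)[OF shift_in[OF C(2)]] by (simp add: s dV dW c_def[symmetric] q_def)
  have cH: "c V V \<in> sho_poly n (- 1)" "c V W \<in> sho_poly n (- 1)" using c_in(1) C k1 by auto
  have "deriv_op W (br n a (c V V)) = 0"
    using deriv_br_linear[OF aH a(2) cH(1), of W] by (simp add: dW)
  then have "deriv_op W (deriv_op V (q V)) - deriv_op W (c U V) + (deriv_op W (deriv_op V (q V)) - deriv_op W (c U V)) = 0"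
    unfolding VV by (simp add: deriv_op_linear algebra_simps)
  then have "sp_scale 2 (deriv_op W (deriv_op V (q V)) - deriv_op W (c U V)) = 0"
    using SP.scale_left_distrib[of 1 1 "deriv_op W (deriv_op V (q V)) - deriv_op W (c U V)"] by simp
  then have 1: "deriv_op W (c U V) = deriv_op W (deriv_op V (q V))" by simp
  have "deriv_op V (br n a (c V W)) = deriv_op U (c V W)"
    using deriv_br_linear[OF aH a(2) cH(2), of V] by (simp add: dV buttin_shift(1) C)
  moreover have "deriv_op V (deriv_op V (q W)) = 0"
  proof -
    have "deriv_op V (deriv_op V (q W)) = - deriv_op V (deriv_op V (q W))"
      using deriv_op_commute[of V V "q W"] by (simp add: s)
    then have "sp_scale 2 (deriv_op V (deriv_op V (q W))) = 0"
      using SP.scale_left_distrib[of 1 1 "deriv_op V (deriv_op V (q W))"] by (simp add: eq_neg_iff_add_eq_0)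
    then show ?thesis by simp
  qed
  ultimately have "deriv_op U (c V W) = deriv_op V (deriv_op W (q V)) - deriv_op V (c U W)"
    unfolding VW by (simp add: deriv_op_linear)
  moreover have "deriv_op V (deriv_op W (q V)) = - deriv_op W (deriv_op V (q V))"
    using deriv_op_commute[of V W "q V"] by (simp add: s)
  ultimately show ?thesis
    unfolding UVW(1)[symmetric] UVW(2)[symmetric] UVW(3)[symmetric] three_form_def by (simp add: s 1)
qed

text \<open>A nonzero coefficient is a constant, which is odd, so the triple contains one or three odd coordinates
  and the total weight is \<open>1\<close> or \<open>-3\<close>.  By \<open>three_form_torus\<close> the total weight is \<open>n\<close> times the weight \<open>N 1\<close>
  for the index 1.  As \<open>n \<ge> 3\<close>, this leaves only \<open>n = 3\<close> and \<open>N 1 = -1\<close>, that is, three odd coordinates with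
  different indices.\<close>

lemma three_form_zero:
  assumes uvw: "u \<in> coords n" "v \<in> coords n" "w \<in> coords n"
  shows "three_form u v w = 0"
proof (rule ccontr)
  assume nz: "three_form u v w \<noteq> 0"
  have hom: "deriv_op x (c y z) \<in> homog n (- 2)" if "y \<in> coords n" "z \<in> coords n" for x y z
    using deriv_op_homog[OF c_in(2)[OF that], of x] k1 by simp
  have par: "deriv_op x (c y z) \<in> has_parity (snd y + snd z + snd x)" if "y \<in> coords n" "z \<in> coords n" for x y z
    using deriv_op_parity[OF c_in(3)[OF that] c_in(2)[OF that]] .
  have P: "three_form u v w \<in> has_parity (snd u + snd v + snd w)"
  proof -
    have e: "snd v + snd w + snd u = snd u + snd v + snd w" "snd u + snd w + snd v = snd u + snd v + snd w"
      by (simp_all only: ac_simps)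
    show ?thesis
      unfolding three_form_def using par[OF uvw(2,3), of u] par[OF uvw(1,2), of w] par[OF uvw(1,3), of v] unfolding e
      by (intro has_parity_closed(1-3))
  qed
  have H: "three_form u v w \<in> homog n (- 2)"
    unfolding three_form_def using hom uvw by (intro homog_closed(1-3)) auto
  have odd: "snd u + snd v + snd w = 1"
  proof (rule ccontr)
    assume "snd u + snd v + snd w \<noteq> 1"
    then have "snd u + snd v + snd w = 0" by simp
    then show False using P H homog_minus_2(2) nz by simp
  qed
  define N where "N i = (\<Sum>x\<leftarrow>[u, v, w]. if fst x = i then coord_weight x else 0)" for i
  have N: "N i = N 1" if "i \<in> {1..n}" for i
    using three_form_torus[OF that, of 1 u v w] uvw nz n that unfolding N_def by (cases "i = 1") auto
  have fst: "fst u \<in> {1..n}" "fst v \<in> {1..n}" "fst w \<in> {1..n}" using uvw by (auto simp: coords_def)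
  have "(\<Sum>i\<in>{1..n}. N i) = coord_weight u + coord_weight v + coord_weight w"
    using fst by (simp add: N_def sum.distrib)
  moreover have "(\<Sum>i\<in>{1..n}. N i) = (\<Sum>i\<in>{1..n}. N 1)" by (rule sum.cong[OF refl N])
  moreover have "(\<Sum>i\<in>{1..n}. N 1) = int n * N 1" by simp
  ultimately have tot: "int n * N 1 = coord_weight u + coord_weight v + coord_weight w" by simp
  show False
  proof (cases "snd u = 1 \<and> snd v = 1 \<and> snd w = 1")
    case True
    then have sg: "coord_weight u = - 1" "coord_weight v = - 1" "coord_weight w = - 1" by (auto simp: coord_weight_def)
    have "int n * N 1 = - 3" using tot sg by simp
    then have "N 1 < 0" using mult_nonneg_nonneg[of "int n" "N 1"] by linarith
    moreover have "N 1 \<ge> - 1"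
    proof (rule ccontr)
      assume "\<not> N 1 \<ge> - 1"
      then have "int n * N 1 \<le> int n * (- 2)" by (intro mult_left_mono) auto
      then show False using \<open>int n * N 1 = - 3\<close> n by simp
    qed
    ultimately have "N 1 = - 1" by simp
    then have "N (fst v) = - 1" using N fst by simp
    then have "fst u \<noteq> fst v" "fst w \<noteq> fst v" using sg by (auto simp: N_def split: if_splits)
    then have "three_form (fst u, 1) (fst v, 1) (fst w, 1) = 0" using three_form_distinct fst by blast
    moreover have "(fst u, 1) = u" "(fst v, 1) = v" "(fst w, 1) = w" using True by (metis prod.collapse)+
    ultimately show False using nz by simp
  next
    case False
    then have "int n * N 1 = 1"
      using tot odd by (cases "snd u"; cases "snd v"; cases "snd w"; simp add: coord_weight_def)
    then have "int n dvd 1" by (metis dvd_triv_left)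
    then show False using n by simp
  qed
qed

end

subsection \<open>Primitives in degree \<open>-1\<close>\<close>

text \<open>For \<open>k \<noteq> 1\<close> the derivatives of \<open>c\<close> have no constant terms.\<close>

lemma c_closed:
  assumes uvw: "u \<in> coords n" "v \<in> coords n" "w \<in> coords n"
  shows "deriv_op u (c v w) = sp_scale (coord_sign u v) (deriv_op v (c u w))
    - sp_scale (coord_sign u w * coord_sign v w) (deriv_op w (c u v))"
proof (cases "k = 1")
  case True
  show ?thesis using three_form_zero[OF True uvw] unfolding three_form_def[OF True] by (simp add: algebra_simps)
next
  case False
  have "drop_const (deriv_op x (c y z)) = deriv_op x (c y z)" if "y \<in> coords n" "z \<in> coords n" for x y z
    using drop_const_homog[OF deriv_op_homog[OF c_in(2)[OF that], of x]] False by simp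
  then show ?thesis using c_closed_mod_const[OF uvw] uvw by simp
qed

lemma parity_sign_square: "parity_sign a b * parity_sign a b = 1"
  by (simp add: parity_sign_def)

lemma parity_sign_sym: "parity_sign a b = parity_sign b a"
  by (simp add: parity_sign_def conj_commute)

text \<open>The Poincare lemma for the 2-form \<open>c\<close>.  The factor \<open>k + 2\<close> is the total degree \<open>k\<close> of the coefficients plus
  the degree 2 of the form.\<close>

definition potential :: "nat \<times> bit \<Rightarrow> super_poly" where
  "potential v = primitive n (k + 2) (\<lambda>w. c w v)"

lemma potential_in:
  assumes v: "v \<in> coords n"
  shows "potential v \<in> homog n (k - 1)" "potential v \<in> has_parity (snd v)"
proof -
  show "potential v \<in> homog n (k - 1)"
    using primitive_homog[of n "\<lambda>w. c w v" "k - 2" "k + 2"] c_in(2)[OF _ v] by (simp add: potential_def)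
  have "c w v \<in> has_parity (snd v + snd w)" if "w \<in> coords n" for w
    using c_in(3)[OF that v] by (simp only: add.commute)
  then show "potential v \<in> has_parity (snd v)"
    using primitive_parity[of n "\<lambda>w. c w v" "k - 2" "snd v" "k + 2"] c_in(2)[OF _ v] by (simp add: potential_def)
qed

lemma deriv_op_potential:
  assumes u: "u \<in> coords n" and v: "v \<in> coords n"
  shows "c u v = deriv_op u (potential v) - sp_scale (coord_sign u v) (deriv_op v (potential u))"
proof -
  let ?S = "\<lambda>v. \<Sum>w\<in>coords n. mult_op w (c w v)"
  have D: "deriv_op u (?S v) = c u v + (\<Sum>w\<in>coords n. sp_scale (coord_sign u w) (mult_op w (deriv_op u (c w v))))"
    if u: "u \<in> coords n" for u v
    using u by (simp add: deriv_op_sum deriv_mult_commute sum.distrib sum.delta)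
  have closed: "sp_scale (coord_sign u w) (mult_op w (deriv_op u (c w v))) =
      mult_op w (deriv_op w (c u v)) + sp_scale (coord_sign u v * coord_sign v w) (mult_op w (deriv_op v (c w u)))"
    if w: "w \<in> coords n" for w
  proof -
    have "sp_scale (coord_sign u w) (deriv_op u (c w v)) = deriv_op w (c u v)
        - sp_scale (coord_sign u w * (coord_sign u v * coord_sign w v)) (deriv_op v (c u w))"
      using c_closed[OF u w v] parity_sign_square[of "snd u" "snd w"]
      by (simp add: SP.scale_right_diff_distrib)
    also have "deriv_op v (c u w) = - sp_scale (coord_sign u w) (deriv_op v (c w u))"
      using c_skew[OF u w] by (simp add: deriv_op_linear)
    finally have "sp_scale (coord_sign u w) (deriv_op u (c w v)) = deriv_op w (c u v)
        + sp_scale (coord_sign u v * coord_sign v w) (deriv_op v (c w u))"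
      using parity_sign_square[of "snd u" "snd w"] parity_sign_sym[of "snd w" "snd v"]
      by (simp add: mult.assoc mult.left_commute[of "coord_sign u w"])
    then have "mult_op w (sp_scale (coord_sign u w) (deriv_op u (c w v))) = mult_op w (deriv_op w (c u v)
        + sp_scale (coord_sign u v * coord_sign v w) (deriv_op v (c w u)))" by simp
    then show ?thesis by (simp add: mult_op_linear)
  qed
  have "deriv_op u (?S v) = c u v + sp_scale (of_int k) (c u v)
      + (\<Sum>w\<in>coords n. sp_scale (coord_sign u v * coord_sign v w) (mult_op w (deriv_op v (c w u))))"
  proof -
    have "(\<Sum>w\<in>coords n. sp_scale (coord_sign u w) (mult_op w (deriv_op u (c w v)))) =
        (\<Sum>w\<in>coords n. mult_op w (deriv_op w (c u v))) +
        (\<Sum>w\<in>coords n. sp_scale (coord_sign u v * coord_sign v w) (mult_op w (deriv_op v (c w u))))"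
      unfolding sum.distrib[symmetric] by (rule sum.cong[OF refl closed])
    then show ?thesis unfolding D[OF u] euler_identity[OF c_in(2)[OF u v]] by (simp add: add.assoc)
  qed
  moreover have "sp_scale (coord_sign u v) (deriv_op v (?S u)) = sp_scale (coord_sign u v) (c v u)
      + (\<Sum>w\<in>coords n. sp_scale (coord_sign u v * coord_sign v w) (mult_op w (deriv_op v (c w u))))"
    unfolding D[OF v] by (simp add: SP.scale_right_distrib SP.scale_sum_right)
  moreover have "sp_scale (coord_sign u v) (c v u) = - c u v"
    using c_skew[OF u v] by simp
  ultimately have "deriv_op u (?S v) - sp_scale (coord_sign u v) (deriv_op v (?S u)) =
      c u v + sp_scale (of_int k) (c u v) + c u v"
    by simp
  also have "\<dots> = sp_scale (of_int (k + 2)) (c u v)"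
    using SP.scale_left_distrib[of "of_int k" 2 "c u v"] SP.scale_left_distrib[of 1 1 "c u v"] by simp
  finally have e: "deriv_op u (?S v) - sp_scale (coord_sign u v) (deriv_op v (?S u)) = sp_scale (of_int (k + 2)) (c u v)" .
  have "of_int (k + 2) \<noteq> (0 :: complex)" unfolding of_int_eq_0_iff using k by simp
  then have "c u v = sp_scale (1 / of_int (k + 2)) (sp_scale (of_int (k + 2)) (c u v))" by simp
  also have "\<dots> = deriv_op u (potential v) - sp_scale (coord_sign u v) (deriv_op v (potential u))"
    unfolding e[symmetric] potential_def primitive_def
    by (simp add: deriv_op_linear SP.scale_right_diff_distrib mult.commute)
  finally show ?thesis .
qed

abbreviation odd_sign :: "nat \<times> bit \<Rightarrow> complex" where
  "odd_sign u \<equiv> (if snd u = 1 then - 1 else 1)"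

text \<open>As \<open>\<Delta>\<close> annihilates \<open>c\<close>, its values \<open>\<beta>\<close> on the potentials, with suitable signs, form a closed 1-form.
  The primitive \<open>\<phi>\<close> of \<open>\<beta>\<close> does not contain \<open>\<xi>\<^sub>1 \<dots> \<xi>\<^sub>n\<close>, because the values of the cocycle do not.
  Hence \<open>\<phi> = \<Delta> f\<close>, and the derivatives of \<open>f\<close> correct the potentials.\<close>

lemma harmonic_potential_exists:
  obtains P where "\<And>v. v \<in> coords n \<Longrightarrow> P v \<in> homog n (k - 1)" "\<And>v. v \<in> coords n \<Longrightarrow> P v \<in> has_parity (snd v)"
    "\<And>v. v \<in> coords n \<Longrightarrow> Delta n (P v) = 0"
    "\<And>u v. u \<in> coords n \<Longrightarrow> v \<in> coords n \<Longrightarrow> c u v = deriv_op u (P v) - sp_scale (coord_sign u v) (deriv_op v (P u))"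
proof -
  define \<beta> where "\<beta> v = sp_scale (odd_sign v) (Delta n (potential v))" for v
  define \<phi> where "\<phi> = primitive n k \<beta>"
  have \<beta>_in: "\<beta> v \<in> homog n (k - 3)" "\<beta> v \<in> has_parity (1 + snd v)" if "v \<in> coords n" for v
  proof -
    show "\<beta> v \<in> homog n (k - 3)"
      unfolding \<beta>_def using Delta_homog[OF potential_in(1)[OF that], of "k - 3"] by (intro homog_closed(3)) simp
    have "Delta n (potential v) \<in> has_parity (1 + snd v)"
      using Delta_parity[OF potential_in(2,1)[OF that]] by (simp only: add.commute)
    then show "\<beta> v \<in> has_parity (1 + snd v)" unfolding \<beta>_def by (intro has_parity_closed(3))
  qed
  have comm: "Delta n (deriv_op u f) = sp_scale (odd_sign u) (deriv_op u (Delta n f))" for u f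
    by (simp add: deriv_op_Delta)
  have closed: "deriv_op u (\<beta> v) = sp_scale (coord_sign u v) (deriv_op v (\<beta> u))"
    if u: "u \<in> coords n" and v: "v \<in> coords n" for u v
  proof -
    have "Delta n (c u v) = 0" using sho_polyD(3)[OF c_in(1)[OF u v]] .
    then have "sp_scale (odd_sign u) (deriv_op u (Delta n (potential v))) =
        sp_scale (coord_sign u v) (sp_scale (odd_sign v) (deriv_op v (Delta n (potential u))))"
      unfolding deriv_op_potential[OF u v] by (simp only: Delta_linear comm right_minus_eq)
    then show ?thesis
      unfolding \<beta>_def by (cases "snd u"; cases "snd v"; simp add: deriv_op_linear parity_sign_def; metis minus_minus)
  qed
  have d\<phi>: "deriv_op u \<phi> = \<beta> u" if "u \<in> coords n" for u
    unfolding \<phi>_def by (rule deriv_op_primitive[OF \<beta>_in(1) k closed that])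
  have \<phi>_in: "\<phi> \<in> homog n (k - 2)" "\<phi> \<in> has_parity 1"
    unfolding \<phi>_def using primitive_homog[of n \<beta> "k - 3" k] primitive_parity[of n \<beta> "k - 3" 1 k] \<beta>_in by simp_all
  have "Delta n \<phi> = 0"
  proof (cases "k = 2")
    case True
    \<comment> \<open>Now \<open>\<Delta> \<phi>\<close> is a constant, and nonzero constants are odd.\<close>
    have "Delta n \<phi> \<in> homog n (- 2)" "Delta n \<phi> \<in> has_parity 0"
      using Delta_homog[OF \<phi>_in(1), of "- 2"] Delta_parity[OF \<phi>_in(2,1)] True by simp_all
    then show ?thesis using homog_minus_2(2) by blast
  next
    case False
    show ?thesis
    proof (rule derivatives_zero)
      show "Delta n \<phi> \<in> homog n (k - 4)" using Delta_homog[OF \<phi>_in(1)] by simp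
      fix u assume u: "u \<in> coords n"
      show "deriv_op u (Delta n \<phi>) = 0"
        unfolding deriv_op_Delta d\<phi>[OF u] \<beta>_def by (simp add: Delta_linear Delta_Delta)
    qed (use False in simp)
  qed
  \<comment> \<open>The coefficient of \<open>\<xi>\<^sub>1 \<dots> \<xi>\<^sub>n\<close> in \<open>\<phi>\<close> is that of \<open>\<xi>\<^sub>2 \<dots> \<xi>\<^sub>n\<close> in \<open>\<beta>\<close> for the coordinate \<open>\<xi>\<^sub>1\<close>, hence
    that of \<open>x\<^sub>1 \<xi>\<^sub>1 \<dots> \<xi>\<^sub>n\<close> in the potential for \<open>\<xi>\<^sub>1\<close>, up to sign.  The latter is the coefficient of
    \<open>\<xi>\<^sub>1 \<dots> \<xi>\<^sub>n\<close> in the value of \<open>c\<close> at \<open>x\<^sub>1\<close> and \<open>\<xi>\<^sub>1\<close>, as derivatives along \<open>\<xi>\<^sub>1\<close> do not contribute.\<close>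
  moreover have "lookup \<phi> (0, {1..n}) = 0"
  proof -
    have C: "(1, 0) \<in> coords n" "(1, 1) \<in> coords n" using n by (auto simp: coords_def)
    have "lookup (c (1, 0) (1, 1)) (0, {1..n}) = 0" using sho_polyD(4)[OF c_in(1)[OF C]] .
    then have 0: "lookup (potential (1, 1)) (single 1 1, {1..n}) = 0"
      unfolding deriv_op_potential[OF C] using n by (simp add: deriv_op_def lookup_ops)
    have I: "insert 1 {2..n} = {1..n}" using n by auto
    have "lookup (d_x l (d_xi l (potential (1, 1)))) (0, {2..n}) = 0" if "l \<in> {1..n}" for l
    proof (cases "l = 1")
      case True
      then show ?thesis using 0 I by (simp add: lookup_ops)
    next
      case False
      then show ?thesis using that by (simp add: lookup_ops)
    qed
    then have "lookup (Delta n (potential (1, 1))) (0, {2..n}) = 0"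
      by (simp add: Delta_def lookup_sum)
    then have "lookup (\<beta> (1, 1)) (0, {2..n}) = 0" by (simp add: \<beta>_def lookup_sp_scale)
    then have "lookup (d_xi 1 \<phi>) (0, {2..n}) = 0"
      using d\<phi>[OF C(2)] by (simp add: deriv_op_def)
    then show ?thesis using I by (simp add: lookup_d_xi xi_sign_def)
  qed
  ultimately have "\<exists>f. Delta n f = \<phi> \<and> (\<forall>j. \<phi> \<in> homog n j \<longrightarrow> f \<in> homog n (j + 2)) \<and>
      (\<forall>j p. \<phi> \<in> homog n j \<longrightarrow> \<phi> \<in> has_parity p \<longrightarrow> f \<in> has_parity (p + 1))"
    by (rule Delta_exact[OF homog_Lam[OF \<phi>_in(1)]]) blast
  then obtain f where f0: "Delta n f = \<phi>" "\<And>j. \<phi> \<in> homog n j \<Longrightarrow> f \<in> homog n (j + 2)"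
    "\<And>j p. \<phi> \<in> homog n j \<Longrightarrow> \<phi> \<in> has_parity p \<Longrightarrow> f \<in> has_parity (p + 1)"
    by blast
  then have f: "Delta n f = \<phi>" "f \<in> homog n k" "f \<in> has_parity 0"
    using f0(2)[OF \<phi>_in(1)] f0(3)[OF \<phi>_in] by simp_all
  show ?thesis
  proof
    fix v assume v: "v \<in> coords n"
    show "potential v - deriv_op v f \<in> homog n (k - 1)"
      by (rule homog_closed(2)[OF potential_in(1)[OF v] deriv_op_homog[OF f(2)]])
    show "potential v - deriv_op v f \<in> has_parity (snd v)"
      using deriv_op_parity[OF f(3,2), of v, unfolded add_0] by (intro has_parity_closed(2) potential_in(2) v)
    show "Delta n (potential v - deriv_op v f) = 0"
      by (simp add: Delta_linear comm f(1) d\<phi>[OF v] \<beta>_def)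
    fix u assume u: "u \<in> coords n"
    show "c u v = deriv_op u (potential v - deriv_op v f) - sp_scale (coord_sign u v) (deriv_op v (potential u - deriv_op u f))"
      using deriv_op_potential[OF u v] deriv_op_commute[of u v f]
      by (simp add: deriv_op_linear SP.scale_right_diff_distrib)
  qed
qed

subsection \<open>Primitives in all degrees\<close>

text \<open>The coordinates of an element of degree \<open>-1\<close> in the basis of the \<open>shift u\<close>.\<close>

definition coef :: "nat \<times> bit \<Rightarrow> super_poly \<Rightarrow> complex" where
  "coef u f = (if snd u = 1 then lookup (d_x (fst u) f) (0, {})
     else - lookup (d_xi (fst u) f) (0, {}))"

lemma coef_linear: "coef u (f + g) = coef u f + coef u g" "coef u (sp_scale r f) = r * coef u f"
  by (simp_all add: coef_def d_linear d_scale lookup_add lookup_sp_scale)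

lemma coef_shift: "coef u (shift v) = (if u = v then 1 else 0)"
  by (cases u; cases v; cases "snd u"; simp add: coef_def d_shift lookup_single)

lemma linear_expand:
  assumes f: "f \<in> homog n (- 1)"
  shows "f = (\<Sum>u\<in>coords n. sp_scale (coef u f) (shift u))"
proof -
  have K: "d_x i f = const_sp (lookup (d_x i f) (0, {}))" "d_xi i f = const_sp (lookup (d_xi i f) (0, {}))" for i
    using homog_minus_2(1)[of "d_x i f" n] homog_minus_2(1)[of "d_xi i f" n] d_homog[OF f, of i] by simp_all
  have x: "mul_x i (const_sp r) = sp_scale r (shift (i, 1))" for i r
    by (cases "r = 0") (simp_all add: mul_x_def const_sp_def shift_def sp_scale_single)
  have xi: "mul_xi i (const_sp r) = sp_scale (- r) (shift (i, 0))" for i r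
    by (cases "r = 0") (simp_all add: mul_xi_def const_sp_def shift_def sp_scale_single)
  have "f = (\<Sum>u\<in>coords n. mult_op u (deriv_op u f))" using euler_identity[OF f] by simp
  also have "\<dots> = (\<Sum>i\<in>{1..n}. mul_x i (d_x i f) + mul_xi i (d_xi i f))"
    by (simp add: sum_coords mult_op_def deriv_op_def)
  also have "\<dots> = (\<Sum>i\<in>{1..n}. sp_scale (coef (i, 0) f) (shift (i, 0)) + sp_scale (coef (i, 1) f) (shift (i, 1)))"
  proof (rule sum.cong[OF refl])
    fix i
    have "mul_x i (d_x i f) = sp_scale (coef (i, 1) f) (shift (i, 1))"
      by (subst K(1), subst x) (simp add: coef_def)
    moreover have "mul_xi i (d_xi i f) = sp_scale (coef (i, 0) f) (shift (i, 0))"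
      by (subst K(2), subst xi) (simp add: coef_def)
    ultimately show "mul_x i (d_x i f) + mul_xi i (d_xi i f) =
        sp_scale (coef (i, 0) f) (shift (i, 0)) + sp_scale (coef (i, 1) f) (shift (i, 1))"
      by (simp add: add.commute)
  qed
  finally show ?thesis by (simp add: sum_coords)
qed

lemma primitive_linear:
  "primitive n d (\<lambda>v. F v + G v) = primitive n d F + primitive n d G"
  "primitive n d (\<lambda>v. sp_scale r (F v)) = sp_scale r (primitive n d F)"
  by (simp_all add: primitive_def mult_op_linear sum.distrib SP.scale_right_distrib SP.scale_sum_right mult.commute)

lemma deriv_op_sho_poly':
  assumes y: "y \<in> sho_poly n j" and j: "j \<noteq> - 1" and u: "u \<in> coords n"
  shows "deriv_op u y \<in> sho_poly n (j - 1)"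
  using deriv_op_sho_poly[OF y u] n drop_const_homog[OF deriv_op_homog[OF sho_polyD(1)[OF y], of u]] j by simp

lemma buttin_Delta_0:
  assumes "f \<in> homog n i" "Delta n f = 0" "g \<in> homog n j" "Delta n g = 0"
  shows "Delta n (buttin n f g) = 0" "lookup (buttin n f g) (0, {1..n}) = 0"
  using buttin_eq_Delta[of f n g] assms homog_Lam Delta_Delta Delta_top by metis+

context
  fixes P :: "nat \<times> bit \<Rightarrow> super_poly"
  assumes P_homog: "\<And>v. v \<in> coords n \<Longrightarrow> P v \<in> homog n (k - 1)"
    and P_parity: "\<And>v. v \<in> coords n \<Longrightarrow> P v \<in> has_parity (snd v)"
    and P_Delta: "\<And>v. v \<in> coords n \<Longrightarrow> Delta n (P v) = 0"
    and P_c: "\<And>u v. u \<in> coords n \<Longrightarrow> v \<in> coords n \<Longrightarrow>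
      c u v = deriv_op u (P v) - sp_scale (coord_sign u v) (deriv_op v (P u))"
begin

text \<open>\<open>prim t\<close> is the desired 1-cochain on elements of degree \<open>t - 1\<close>.  On degree \<open>-1\<close> it is given by the
  potentials; after that the coboundary equation for \<open>shift v\<close> and \<open>y\<close> prescribes the derivatives of the
  value at \<open>y\<close>, and the value itself has total degree \<open>t + 2 + k\<close>.\<close>

primrec prim :: "nat \<Rightarrow> super_poly \<Rightarrow> super_poly" where
  "prim 0 y = (\<Sum>u\<in>coords n. sp_scale (coef u y) (P u))"
| "prim (Suc t) y = primitive n (int t + 2 + k)
     (\<lambda>v. m (- 1) (int t) (shift v) y + prim t (deriv_op v y) - buttin n (P v) y)"

text \<open>The cochain in the degree below that of \<open>prim t\<close>; the components of degree less than \<open>-1\<close> are zero.\<close>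

definition prim_pred :: "nat \<Rightarrow> super_poly \<Rightarrow> super_poly" where
  "prim_pred t y = (case t of 0 \<Rightarrow> 0 | Suc s \<Rightarrow> prim s y)"

text \<open>The statement that is proved by induction.  Its last clause is the coboundary equation for \<open>shift u\<close>
  and \<open>y\<close>.\<close>

definition prim_correct :: "nat \<Rightarrow> bool" where
  "prim_correct t \<longleftrightarrow> (\<forall>y\<in>sho_poly n (int t - 1).
     (\<forall>y'\<in>sho_poly n (int t - 1). prim t (y + y') = prim t y + prim t y') \<and>
     (\<forall>r. prim t (sp_scale r y) = sp_scale r (prim t y)) \<and>
     prim t y \<in> homog n (int t - 1 + k) \<and> Delta n (prim t y) = 0 \<and>
     (\<forall>a. y \<in> has_parity a \<longrightarrow> prim t y \<in> has_parity a) \<and>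
     (\<forall>u\<in>coords n. deriv_op u (prim t y) =
        m (- 1) (int t - 1) (shift u) y + prim_pred t (deriv_op u y) - buttin n (P u) y))"

text \<open>On degree \<open>-1\<close> the coboundary equation is \<open>c = dP\<close>, extended by linearity.\<close>

lemma prim_correct_0: "prim_correct 0"
  unfolding prim_correct_def
proof (intro ballI conjI allI impI)
  fix y assume "y \<in> sho_poly n (int 0 - 1)"
  then have y: "y \<in> sho_poly n (- 1)" by simp
  note yh = sho_polyD(1)[OF y]
  show "prim 0 (y + y') = prim 0 y + prim 0 y'" for y'
    by (simp add: coef_linear SP.scale_left_distrib sum.distrib)
  show "prim 0 (sp_scale r y) = sp_scale r (prim 0 y)" for r
    by (simp add: coef_linear SP.scale_sum_right)
  show "prim 0 y \<in> homog n (int 0 - 1 + k)"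
    using P_homog by (auto intro!: homog_closed(3,6) simp: algebra_simps)
  show "Delta n (prim 0 y) = 0"
    by (simp add: Delta_sum Delta_linear P_Delta)
  show "prim 0 y \<in> has_parity a" if a: "y \<in> has_parity a" for a
  proof -
    have "sp_scale (coef u y) (P u) \<in> has_parity a" if u: "u \<in> coords n" for u
    proof (cases "coef u y = 0")
      case False
      have "snd u = a"
      proof (cases "snd u = 1")
        case True
        then have "lookup y (single (fst u) 1, {}) \<noteq> 0"
          using False by (simp add: coef_def lookup_ops)
        then have "of_nat (card ({} :: nat set)) + 1 = a" using a unfolding has_parity_def by blast
        then show ?thesis using True by simp
      next
        case f: False
        then have "lookup y (0, {fst u}) \<noteq> 0"
          using False by (simp add: coef_def lookup_ops)
        then have "of_nat (card {fst u}) + 1 = a" using a unfolding has_parity_def by blast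
        then show ?thesis using f by simp
      qed
      then show ?thesis using P_parity[OF u] has_parity_closed(3) by simp
    qed (simp add: has_parity_closed(4))
    then show ?thesis by (simp add: has_parity_closed(6))
  qed
  fix u assume u: "u \<in> coords n"
  let ?S = "\<lambda>F. \<Sum>v\<in>coords n. sp_scale (coef v y) (F v)"
  have y_eq: "y = ?S shift" by (rule linear_expand[OF yh])
  have "m (- 1) (- 1) (shift u) y = ?S (c u)"
  proof -
    have "m (- 1) (- 1) (shift u) (?S shift) = (\<Sum>v\<in>coords n. m (- 1) (- 1) (shift u) (sp_scale (coef v y) (shift v)))"
      using shift_in sho_poly_closed(3) by (intro m_sum(2) shift_in[OF u]) blast
    also have "\<dots> = ?S (c u)"
      using shift_in u by (intro sum.cong refl) (simp add: m_scale c_def)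
    finally show ?thesis using y_eq by metis
  qed
  moreover have "buttin n (P u) y = - ?S (\<lambda>v. sp_scale (coord_sign u v) (deriv_op v (P u)))"
  proof -
    have s: "buttin n f (sum F A) = (\<Sum>a\<in>A. buttin n f (F a))" for f F and A :: "(nat \<times> bit) set"
      by (induction A rule: infinite_finite_induct) (simp_all add: buttin_add)
    have "buttin n (P u) (?S shift) = (\<Sum>v\<in>coords n. sp_scale (coef v y) (buttin n (P u) (shift v)))"
      by (simp add: s buttin_scale)
    also have "\<dots> = - ?S (\<lambda>v. sp_scale (coord_sign u v) (deriv_op v (P u)))"
      unfolding sum_negf[symmetric] by (intro sum.cong refl) (simp add: buttin_shift(2)[OF _ P_parity[OF u]])
    finally show ?thesis using y_eq by metis
  qed
  moreover have "deriv_op u (prim 0 y) = ?S (\<lambda>v. deriv_op u (P v))"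
    by (simp add: deriv_op_sum deriv_op_linear)
  moreover have "?S (c u) = ?S (\<lambda>v. deriv_op u (P v)) - ?S (\<lambda>v. sp_scale (coord_sign u v) (deriv_op v (P u)))"
    unfolding sum_subtractf[symmetric] by (intro sum.cong refl) (simp add: P_c[OF u] SP.scale_right_diff_distrib)
  ultimately show "deriv_op u (prim 0 y) =
      m (- 1) (int 0 - 1) (shift u) y + prim_pred 0 (deriv_op u y) - buttin n (P u) y"
    by (simp add: prim_pred_def)
qed

lemma prim_pred_scale:
  assumes "\<And>s. s < t \<Longrightarrow> prim_correct s" "y \<in> sho_poly n (int t - 2)"
  shows "prim_pred t (sp_scale r y) = sp_scale r (prim_pred t y)"
  using assms by (cases t) (auto simp: prim_pred_def prim_correct_def)

text \<open>The prescribed derivatives \<open>C y v\<close> form a closed 1-form: by the coboundary equation in the preceding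
  degree, this amounts to the cocycle identity for two elements of degree \<open>-1\<close> and \<open>y\<close>, together with
  \<open>c = dP\<close>.\<close>

lemma prim_correct_Suc:
  assumes IH: "\<And>s. s \<le> t \<Longrightarrow> prim_correct s"
  shows "prim_correct (Suc t)"
proof -
  define C where "C y v = m (- 1) (int t) (shift v) y + prim t (deriv_op v y) - buttin n (P v) y" for y v
  have dH: "deriv_op v y \<in> sho_poly n (int t - 1)" if "y \<in> sho_poly n (int t)" "v \<in> coords n" for y v
    using deriv_op_sho_poly'[OF that(1) _ that(2)] by simp
  note G = IH[OF order.refl, unfolded prim_correct_def, rule_format]
  have G_add: "prim t (x + y) = prim t x + prim t y" if "x \<in> sho_poly n (int t - 1)" "y \<in> sho_poly n (int t - 1)" for x y
    using G that by blast
  have G_scale: "prim t (sp_scale r x) = sp_scale r (prim t x)" if "x \<in> sho_poly n (int t - 1)" for x r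
    using G that by blast
  have G_in: "prim t x \<in> homog n (int t - 1 + k)" "Delta n (prim t x) = 0" if "x \<in> sho_poly n (int t - 1)" for x
    using G that by blast+
  have G_parity: "prim t x \<in> has_parity a" if "x \<in> sho_poly n (int t - 1)" "x \<in> has_parity a" for x a
    using G that by blast
  have G_deriv: "deriv_op u (prim t x) = m (- 1) (int t - 1) (shift u) x + prim_pred t (deriv_op u x) - buttin n (P u) x"
    if "x \<in> sho_poly n (int t - 1)" "u \<in> coords n" for x u
    using G that by blast
  have C_add: "C (x + y) v = C x v + C y v" if "x \<in> sho_poly n (int t)" "y \<in> sho_poly n (int t)" "v \<in> coords n" for x y v
    unfolding C_def using that shift_in
    by (simp add: m_add(2)[OF that(1,2)] deriv_op_linear G_add[OF dH dH] buttin_add)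
  have C_scale: "C (sp_scale r x) v = sp_scale r (C x v)" if "x \<in> sho_poly n (int t)" "v \<in> coords n" for x r v
    unfolding C_def using that shift_in
    by (simp add: m_scale deriv_op_linear G_scale[OF dH] buttin_scale SP.scale_right_distrib SP.scale_right_diff_distrib)
  have m_in': "m (- 1) (int t) (shift v) y \<in> sho_poly n (int t - 1 + k)" if "y \<in> sho_poly n (int t)" "v \<in> coords n" for y v
    using m_in[OF shift_in[OF that(2)] that(1)] by simp
  have C_in: "C y v \<in> homog n (int t - 1 + k)" "Delta n (C y v) = 0" if y: "y \<in> sho_poly n (int t)" and v: "v \<in> coords n" for y v
  proof -
    have "buttin n (P v) y \<in> homog n (int t - 1 + k)"
      by (rule buttin_homog[OF P_homog[OF v] sho_polyD(1)[OF y]]) simp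
    then show "C y v \<in> homog n (int t - 1 + k)"
      unfolding C_def using sho_polyD(1)[OF m_in'[OF y v]] G_in(1)[OF dH[OF y v]] homog_closed(1,2) by blast
    show "Delta n (C y v) = 0"
      unfolding C_def using sho_polyD(3)[OF m_in'[OF y v]] G_in(2)[OF dH[OF y v]]
        buttin_Delta_0(1)[OF P_homog[OF v] P_Delta[OF v] sho_polyD(1,3)[OF y]]
      by (simp add: Delta_linear)
  qed
  have C_parity: "C y v \<in> has_parity (a + snd v)"
    if y: "y \<in> sho_poly n (int t)" "y \<in> has_parity a" and v: "v \<in> coords n" for y v a
  proof -
    have "m (- 1) (int t) (shift v) y \<in> has_parity (a + snd v)"
      using m_parity[OF shift_in[OF v] shift_parity y] by (simp only: add.commute)
    moreover have "prim t (deriv_op v y) \<in> has_parity (a + snd v)"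
      using G_parity[OF dH[OF y(1) v] deriv_op_parity[OF y(2) sho_polyD(1)[OF y(1)]]] .
    moreover have "buttin n (P v) y \<in> has_parity (a + snd v)"
      using buttin_parity[OF P_parity[OF v] P_homog[OF v] y(2) sho_polyD(1)[OF y(1)]] by (simp only: add.commute)
    ultimately show ?thesis unfolding C_def by (intro has_parity_closed(1,2))
  qed
  have closed_pure: "deriv_op u (C y v) = sp_scale (coord_sign u v) (deriv_op v (C y u))"
    if y: "y \<in> sho_poly n (int t)" "y \<in> has_parity a" and u: "u \<in> coords n" and v: "v \<in> coords n" for y a u v
  proof -
    define A where "A u v = deriv_op u (m (- 1) (int t) (shift v) y) + m (- 1) (int t - 1) (shift u) (deriv_op v y)" for u v
    have dm: "drop_const (deriv_op u (m (- 1) (int t) (shift v) y)) = deriv_op u (m (- 1) (int t) (shift v) y)"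
      if "v \<in> coords n" for u v
      using drop_const_homog[OF deriv_op_homog[OF sho_polyD(1)[OF m_in'[OF y(1) that]], of u]] k by simp
    have dy: "drop_const (deriv_op v y) = deriv_op v y" if "v \<in> coords n" for v
      using sho_polyD(6)[OF dH[OF y(1) that]] .
    have "br n (c u v) y = buttin n (c u v) y"
      unfolding br_def using drop_const_homog[OF buttin_homog[OF c_in(2)[OF u v] sho_polyD(1)[OF y(1)] refl]] k by simp
    moreover have "drop_const (deriv_op u (shift v)) = 0"
      using br_shift_shift[OF u v] unfolding br_shift(1)[OF u] .
    ultimately have cc: "A u v = buttin n (c u v) y + sp_scale (coord_sign u v) (A v u)"
      using m_cocycle[OF shift_in[OF u] shift_parity shift_in[OF v] shift_parity y] u v
      by (simp add: A_def c_def[symmetric] br_shift_shift m_0[OF y(1)] br_shift(1) dm dy add.commute[of _ "int t"])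
    have R: "prim_pred t (deriv_op u (deriv_op v y)) = sp_scale (coord_sign u v) (prim_pred t (deriv_op v (deriv_op u y)))"
    proof (cases t)
      case (Suc s)
      have "deriv_op v (deriv_op u y) \<in> sho_poly n (int t - 1 - 1)"
        using Suc by (intro deriv_op_sho_poly' dH y u v) simp
      then show ?thesis
        using deriv_op_commute[of u v y] prim_pred_scale[of t "deriv_op v (deriv_op u y)" "coord_sign u v"] IH
        by (simp add: algebra_simps)
    qed (simp add: prim_pred_def)
    have D: "deriv_op u (C y v) = A u v + prim_pred t (deriv_op u (deriv_op v y)) - buttin n (P u) (deriv_op v y)
        - buttin n (deriv_op u (P v)) y - sp_scale (coord_sign u v) (buttin n (P v) (deriv_op u y))"
      if u: "u \<in> coords n" and v: "v \<in> coords n" for u v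
      unfolding C_def deriv_op_linear G_deriv[OF dH[OF y(1) v] u]
        deriv_op_buttin[OF homog_Lam[OF P_homog[OF v]] P_parity[OF v] sho_polyD(2)[OF y(1)]]
      by (simp add: A_def)
    have s: "coord_sign v u = coord_sign u v" by (rule parity_sign_sym)
    have "deriv_op u (C y v) - sp_scale (coord_sign u v) (deriv_op v (C y u)) =
        buttin n (c u v) y - (buttin n (deriv_op u (P v)) y - sp_scale (coord_sign u v) (buttin n (deriv_op v (P u)) y))"
      unfolding D[OF u v] D[OF v u] cc R s
      using parity_sign_square[of "snd u" "snd v"]
      by (simp add: SP.scale_right_distrib SP.scale_right_diff_distrib)
    also have "\<dots> = 0"
      unfolding P_c[OF u v] by (simp add: buttin_diff buttin_scale)
    finally show ?thesis by simp
  qed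
  have closed: "deriv_op u (C y v) = sp_scale (coord_sign u v) (deriv_op v (C y u))"
    if y: "y \<in> sho_poly n (int t)" and u: "u \<in> coords n" and v: "v \<in> coords n" for y u v
  proof -
    obtain g h where gh: "g \<in> sho_poly n (int t)" "g \<in> has_parity 0" "h \<in> sho_poly n (int t)" "h \<in> has_parity 1" "y = g + h"
      using sho_parity_decompose[OF y] by blast
    show ?thesis
      unfolding gh(5) C_add[OF gh(1,3) u] C_add[OF gh(1,3) v] deriv_op_linear(1)
        closed_pure[OF gh(1,2) u v] closed_pure[OF gh(3,4) u v] SP.scale_right_distrib ..
  qed
  have prim_eq: "prim (Suc t) y = primitive n (int t + 2 + k) (C y)" for y
    unfolding prim.simps C_def ..
  have primitive_cong: "primitive n d F = primitive n d F'" if "\<And>v. v \<in> coords n \<Longrightarrow> F v = F' v" for d F F'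
    unfolding primitive_def using that by (simp cong: sum.cong)
  show ?thesis
    unfolding prim_correct_def
  proof (intro ballI conjI allI impI)
    fix y assume "y \<in> sho_poly n (int (Suc t) - 1)"
    then have y: "y \<in> sho_poly n (int t)" by simp
    show "prim (Suc t) (y + y') = prim (Suc t) y + prim (Suc t) y'" if "y' \<in> sho_poly n (int (Suc t) - 1)" for y'
      unfolding prim_eq primitive_linear(1)[symmetric] using that by (intro primitive_cong C_add y) simp
    show "prim (Suc t) (sp_scale r y) = sp_scale r (prim (Suc t) y)" for r
      unfolding prim_eq primitive_linear(2)[symmetric] by (intro primitive_cong C_scale y)
    have hom: "prim (Suc t) y \<in> homog n (int t - 1 + k + 1)"
      unfolding prim_eq by (rule primitive_homog[OF C_in(1)[OF y]])
    then show "prim (Suc t) y \<in> homog n (int (Suc t) - 1 + k)" by (simp add: algebra_simps)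
    show "prim (Suc t) y \<in> has_parity a" if "y \<in> has_parity a" for a
      unfolding prim_eq by (rule primitive_parity[OF C_in(1)[OF y] C_parity[OF y that]])
    have d: "deriv_op u (prim (Suc t) y) = C y u" if u: "u \<in> coords n" for u
      unfolding prim_eq
    proof (rule deriv_op_primitive[OF _ _ closed[OF y] u])
      fix v assume v: "v \<in> coords n"
      have "int t + 2 + k - 3 = int t - 1 + k" by simp
      then show "C y v \<in> homog n (int t + 2 + k - 3)" using C_in(1)[OF y v] by metis
    qed (use k in auto)
    show "deriv_op u (prim (Suc t) y) =
        m (- 1) (int (Suc t) - 1) (shift u) y + prim_pred (Suc t) (deriv_op u y) - buttin n (P u) y"
      if u: "u \<in> coords n" for u
      using d[OF u] by (simp add: C_def prim_pred_def)
    show "Delta n (prim (Suc t) y) = 0"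
    proof (rule derivatives_zero)
      show "Delta n (prim (Suc t) y) \<in> homog n (int t + k - 2)"
        by (rule Delta_homog[OF hom]) simp
      fix u assume u: "u \<in> coords n"
      show "deriv_op u (Delta n (prim (Suc t) y)) = 0"
        unfolding deriv_op_Delta d[OF u] by (simp add: C_in(2)[OF y u])
    qed (use k in simp)
  qed
qed

lemma prim_correct: "prim_correct t"
proof (induction t rule: less_induct)
  case (less t)
  then show ?case using prim_correct_0 prim_correct_Suc by (cases t) auto
qed

text \<open>It remains to see that \<open>prim t y\<close> does not contain \<open>\<xi>\<^sub>1 \<dots> \<xi>\<^sub>n\<close>.  Write \<open>y\<close> as the derivative of some \<open>w\<close> with
  respect to \<open>x\<^sub>1\<close>; then the coboundary equation for \<open>w\<close> expresses \<open>prim t y\<close> by brackets, which are values of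
  \<open>\<Delta>\<close>, and a value of the cocycle.\<close>

lemma prim_in:
  assumes y: "y \<in> sho_poly n (int t - 1)"
  shows "prim t y \<in> sho_poly n (int t - 1 + k)"
proof -
  obtain w where w: "w \<in> sho_poly n (int t)" "deriv_op (1, 0) w = y"
    using sho_poly_integrate[OF y] n by auto
  have u: "(1, 0) \<in> coords n" using n by (simp add: coords_def)
  have w': "w \<in> sho_poly n (int (Suc t) - 1)" using w by simp
  note G = prim_correct[of "Suc t", unfolded prim_correct_def, rule_format, OF w']
  have "deriv_op (1, 0) (prim (Suc t) w) = m (- 1) (int t) (shift (1, 0)) w + prim t y - buttin n (P (1, 0)) w"
    using G u w(2) by (auto simp: prim_pred_def)
  then have eq: "prim t y = buttin n (shift (1, 0)) (prim (Suc t) w) - m (- 1) (int t) (shift (1, 0)) w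
      + buttin n (P (1, 0)) w"
    unfolding buttin_shift(1)[OF u] by simp
  have "lookup (buttin n (shift (1, 0)) (prim (Suc t) w)) (0, {1..n}) = 0"
  proof -
    have h: "prim (Suc t) w \<in> homog n (int (Suc t) - 1 + k)" "Delta n (prim (Suc t) w) = 0" using G by blast+
    show ?thesis by (rule buttin_Delta_0(2)[OF sho_polyD(1)[OF shift_in[OF u]] sho_polyD(3)[OF shift_in[OF u]] h])
  qed
  moreover have "lookup (m (- 1) (int t) (shift (1, 0)) w) (0, {1..n}) = 0"
    by (rule sho_polyD(4)[OF m_in[OF shift_in[OF u] w(1)]])
  moreover have "lookup (buttin n (P (1, 0)) w) (0, {1..n}) = 0"
    by (rule buttin_Delta_0(2)[OF P_homog[OF u] P_Delta[OF u] sho_polyD(1,3)[OF w(1)]])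
  ultimately have "lookup (prim t y) (0, {1..n}) = 0"
    unfolding eq by (simp add: lookup_add lookup_minus)
  moreover have h: "prim t y \<in> homog n (int t - 1 + k)" "Delta n (prim t y) = 0"
    using prim_correct[of t, unfolded prim_correct_def, rule_format, OF y] by blast+
  moreover have "lookup (prim t y) (0, {}) = 0"
    by (rule homog_const_coeff[OF h(1)]) (use k in simp)
  ultimately show ?thesis by (simp add: sho_poly_def)
qed

text \<open>The 1-cochain, indexed by degrees.  It is zero on elements of degree less than \<open>-1\<close> because these are
  zero.\<close>

definition psi :: "int \<Rightarrow> super_poly \<Rightarrow> super_poly" where
  "psi j y = prim (nat (j + 1)) y"

lemma psi_zero [simp]: "psi j 0 = 0"
proof -
  have "prim t (sp_scale 0 0) = sp_scale 0 (prim t 0)" for t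
    using prim_correct[of t, unfolded prim_correct_def, rule_format, OF sho_poly_closed(4)] by blast
  then show ?thesis by (simp add: psi_def)
qed

lemma psi_correct:
  assumes y: "y \<in> sho_poly n j"
  shows "psi j y \<in> sho_poly n (j + k)"
    and "\<And>y'. y' \<in> sho_poly n j \<Longrightarrow> psi j (y + y') = psi j y + psi j y'"
    and "\<And>r. psi j (sp_scale r y) = sp_scale r (psi j y)"
    and "\<And>a. y \<in> has_parity a \<Longrightarrow> psi j y \<in> has_parity a"
    and "\<And>u. u \<in> coords n \<Longrightarrow> j \<ge> - 1 \<Longrightarrow> drop_const (deriv_op u (psi j y)) =
      m (- 1) j (shift u) y + psi (j - 1) (drop_const (deriv_op u y)) - br n (P u) y"
proof -
  have "psi j y \<in> sho_poly n (j + k) \<and> (\<forall>y'\<in>sho_poly n j. psi j (y + y') = psi j y + psi j y') \<and>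
      (\<forall>r. psi j (sp_scale r y) = sp_scale r (psi j y)) \<and> (\<forall>a. y \<in> has_parity a \<longrightarrow> psi j y \<in> has_parity a) \<and>
      (\<forall>u\<in>coords n. j \<ge> - 1 \<longrightarrow> drop_const (deriv_op u (psi j y)) =
        m (- 1) j (shift u) y + psi (j - 1) (drop_const (deriv_op u y)) - br n (P u) y)"
  proof (cases "j \<ge> - 1")
    case False
    have zero: "x = 0" if "x \<in> sho_poly n j" for x using sho_poly_low[OF that] False by simp
    show ?thesis
      unfolding zero[OF y] using zero False by (auto simp: sho_poly_closed(4) has_parity_closed(4))
  next
    case True
    define t where "t = nat (j + 1)"
    have j: "j = int t - 1" using True by (simp add: t_def)
    have y': "y \<in> sho_poly n (int t - 1)" using y j by simp
    note G = prim_correct[of t, unfolded prim_correct_def, rule_format, OF y']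
    have psi: "psi j = prim t" by (rule ext) (simp add: psi_def t_def)
    have "drop_const (deriv_op u (prim t y)) =
        m (- 1) j (shift u) y + psi (j - 1) (drop_const (deriv_op u y)) - br n (P u) y" if u: "u \<in> coords n" for u
    proof -
      have "deriv_op u (prim t y) = m (- 1) j (shift u) y + prim_pred t (deriv_op u y) - buttin n (P u) y"
        using G u j by blast
      moreover have "deriv_op u (prim t y) \<in> homog n (j + k - 1)"
        using G j deriv_op_homog by blast
      then have "drop_const (deriv_op u (prim t y)) = deriv_op u (prim t y)"
        by (rule drop_const_homog) (use True k in simp)
      moreover have "buttin n (P u) y \<in> homog n (k - 1 + j)"
        by (rule buttin_homog[OF P_homog[OF u] sho_polyD(1)[OF y] refl])
      then have "br n (P u) y = buttin n (P u) y"
        unfolding br_def by (rule drop_const_homog) (use True k in simp)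
      moreover have "prim_pred t (deriv_op u y) = psi (j - 1) (drop_const (deriv_op u y))"
      proof (cases t)
        case 0
        then have "deriv_op u y \<in> homog n (- 2)" using deriv_op_homog[OF sho_polyD(1)[OF y], of u] j by simp
        then show ?thesis using 0 homog_minus_2(3) by (simp add: prim_pred_def)
      next
        case (Suc s)
        then have "drop_const (deriv_op u y) = deriv_op u y"
          using drop_const_homog[OF deriv_op_homog[OF sho_polyD(1)[OF y], of u]] j by simp
        then show ?thesis using Suc j by (simp add: prim_pred_def psi_def)
      qed
      ultimately show ?thesis by simp
    qed
    moreover have "prim t y \<in> sho_poly n (j + k)" using prim_in[OF y'] j by simp
    ultimately show ?thesis unfolding psi using G j by blast
  qed
  then show "psi j y \<in> sho_poly n (j + k)"
    and "\<And>y'. y' \<in> sho_poly n j \<Longrightarrow> psi j (y + y') = psi j y + psi j y'"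
    and "\<And>r. psi j (sp_scale r y) = sp_scale r (psi j y)"
    and "\<And>a. y \<in> has_parity a \<Longrightarrow> psi j y \<in> has_parity a"
    and "\<And>u. u \<in> coords n \<Longrightarrow> j \<ge> - 1 \<Longrightarrow> drop_const (deriv_op u (psi j y)) =
      m (- 1) j (shift u) y + psi (j - 1) (drop_const (deriv_op u y)) - br n (P u) y"
    by blast+
qed

lemma psi_sum: "(\<And>x. x \<in> A \<Longrightarrow> f x \<in> sho_poly n j) \<Longrightarrow> psi j (sum f A) = (\<Sum>x\<in>A. psi j (f x))"
  by (induction A rule: infinite_finite_induct) (auto simp: psi_correct(2) sho_poly_closed)

lemma psi_shift: "u \<in> coords n \<Longrightarrow> psi (- 1) (shift u) = P u"
proof -
  assume u: "u \<in> coords n"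
  have "psi (- 1) (shift u) = (\<Sum>v\<in>coords n. if v = u then P u else 0)"
  proof -
    have "psi (- 1) (shift u) = (\<Sum>v\<in>coords n. sp_scale (coef v (shift u)) (P v))"
      by (simp only: psi_def add.left_inverse nat_zero_as_int[symmetric] of_nat_0 prim.simps)
    also have "\<dots> = (\<Sum>v\<in>coords n. if v = u then P u else 0)"
      by (rule sum.cong[OF refl]) (auto simp: coef_shift u)
    finally show ?thesis .
  qed
  then show ?thesis using u by simp
qed

subsection \<open>The cocycle is a coboundary\<close>

definition remainder :: "int \<Rightarrow> int \<Rightarrow> super_poly \<Rightarrow> super_poly \<Rightarrow> super_poly" where
  "remainder i j y z = m i j y z - (br n y (psi j z) + br n (psi i y) z - psi (i + j) (br n y z))"

lemma remainder_linear_part: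
  assumes y: "y \<in> sho_poly n (- 1)" and z: "z \<in> sho_poly n j" and j: "j \<ge> - 1"
  shows "remainder (- 1) j y z = 0"
proof -
  let ?S = "\<lambda>F. \<Sum>u\<in>coords n. sp_scale (coef u y) (F u)"
  have y_eq: "y = ?S shift" by (rule linear_expand[OF sho_polyD(1)[OF y]])
  have n1: "n \<ge> 1" using n by simp
  have sh: "sp_scale r (shift u) \<in> sho_poly n (- 1)" if "u \<in> coords n" for u r
    using shift_in[OF that] sho_poly_closed(3) by blast
  have 1: "m (- 1) j y z = ?S (\<lambda>u. m (- 1) j (shift u) z)"
  proof -
    have "m (- 1) j (?S shift) z = (\<Sum>u\<in>coords n. m (- 1) j (sp_scale (coef u y) (shift u)) z)"
      by (rule m_sum(1)[OF sh z])
    also have "\<dots> = ?S (\<lambda>u. m (- 1) j (shift u) z)"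
      by (intro sum.cong refl m_scale(1) shift_in z)
    finally show ?thesis using y_eq by metis
  qed
  have 2: "br n y x = ?S (\<lambda>u. br n (shift u) x)" for x
  proof -
    have "br n (?S shift) x = ?S (\<lambda>u. br n (shift u) x)" by (simp add: br_sum br_linear)
    then show ?thesis using y_eq by metis
  qed
  have 3: "br n (psi (- 1) y) z = ?S (\<lambda>u. br n (P u) z)"
  proof -
    have "psi (- 1) (?S shift) = (\<Sum>u\<in>coords n. psi (- 1) (sp_scale (coef u y) (shift u)))"
      by (rule psi_sum[OF sh])
    also have "\<dots> = ?S P" by (intro sum.cong refl) (simp add: psi_correct(3)[OF shift_in] psi_shift)
    finally have "psi (- 1) y = ?S P" using y_eq by metis
    then show ?thesis by (simp add: br_sum br_linear)
  qed
  have brs: "br n (shift u) z \<in> sho_poly n (- 1 + j)" if "u \<in> coords n" for u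
    by (rule br_sho_poly'[OF shift_in[OF that] z refl n1])
  have 4: "psi (- 1 + j) (br n y z) = ?S (\<lambda>u. psi (- 1 + j) (br n (shift u) z))"
  proof -
    have "psi (- 1 + j) (?S (\<lambda>u. br n (shift u) z)) = (\<Sum>u\<in>coords n. psi (- 1 + j) (sp_scale (coef u y) (br n (shift u) z)))"
      by (rule psi_sum) (use brs sho_poly_closed(3) in blast)
    also have "\<dots> = ?S (\<lambda>u. psi (- 1 + j) (br n (shift u) z))"
      by (intro sum.cong refl psi_correct(3)[OF brs])
    finally show ?thesis unfolding 2 .
  qed
  have "m (- 1) j (shift u) z = br n (shift u) (psi j z) + br n (P u) z - psi (- 1 + j) (br n (shift u) z)"
    if u: "u \<in> coords n" for u
    using psi_correct(5)[OF z u j] unfolding br_shift(1)[OF u] by (simp add: algebra_simps)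
  then have "?S (\<lambda>u. m (- 1) j (shift u) z) =
      ?S (\<lambda>u. br n (shift u) (psi j z) + br n (P u) z - psi (- 1 + j) (br n (shift u) z))"
    by (intro sum.cong refl) simp
  also have "\<dots> = ?S (\<lambda>u. br n (shift u) (psi j z)) + ?S (\<lambda>u. br n (P u) z) - ?S (\<lambda>u. psi (- 1 + j) (br n (shift u) z))"
    by (simp add: SP.scale_right_distrib SP.scale_right_diff_distrib sum.distrib sum_subtractf)
  finally show ?thesis unfolding remainder_def 1 3 4 2[of "psi j z"] by simp
qed

text \<open>As a difference of cocycles the remainder is a cocycle.  It vanishes if the first argument has degree
  \<open>-1\<close>, so its cocycle identity for \<open>shift u\<close>, \<open>y\<close> and \<open>z\<close> becomes a Leibniz rule.\<close>

lemma deriv_remainder: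
  assumes y: "y \<in> sho_poly n i" "y \<in> has_parity a" and z: "z \<in> sho_poly n j" "z \<in> has_parity b"
    and ij: "i \<ge> 0" "j \<ge> - 1" and u: "u \<in> coords n"
  defines "dy \<equiv> drop_const (deriv_op u y)" and "dz \<equiv> drop_const (deriv_op u z)"
  shows "drop_const (deriv_op u (remainder i j y z)) =
    remainder (i - 1) j dy z + sp_scale (parity_sign (snd u) a) (remainder i (j - 1) y dz)"
proof -
  let ?s = "parity_sign (snd u) a"
  let ?d = "\<lambda>f. drop_const (deriv_op u f)"
  have n1: "n \<ge> 1" "n \<ge> 2" using n by auto
  have dH: "dy \<in> sho_poly n (i - 1)" "dz \<in> sho_poly n (j - 1)"
    unfolding dy_def dz_def using deriv_op_sho_poly[OF y(1) u n1(2)] deriv_op_sho_poly[OF z(1) u n1(2)] by auto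
  have brH: "br n y z \<in> sho_poly n (i + j)" by (rule br_sho_poly'[OF y(1) z(1) refl n1(1)])
  have brdH: "br n dy z \<in> sho_poly n (i + j - 1)" "br n y dz \<in> sho_poly n (i + j - 1)"
    using br_sho_poly'[OF dH(1) z(1) _ n1(1), of "i + j - 1"] br_sho_poly'[OF y(1) dH(2) _ n1(1), of "i + j - 1"] by auto
  have PH: "P u \<in> sho_poly n (k - 1)" using psi_correct(1)[OF shift_in[OF u]] psi_shift[OF u] by simp
  have d_lin: "?d (f - g) = ?d f - ?d g" "?d (f + g) = ?d f + ?d g" for f g
    by (simp_all add: deriv_op_linear drop_const_linear)
  have idx: "- 1 + i = i - 1" "- 1 + j = j - 1" "i + (j - 1) = i + j - 1" "i - 1 + j = i + j - 1" by simp_all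
  have i: "?d (m i j y z) = br n (m (- 1) i (shift u) y) z + m (i - 1) j dy z
      + sp_scale ?s (br n y (m (- 1) j (shift u) z) + m i (j - 1) y dz) - m (- 1) (i + j) (shift u) (br n y z)"
    using m_cocycle[OF shift_in[OF u] shift_parity y z] unfolding br_shift(1)[OF u] idx dy_def[symmetric] dz_def[symmetric]
    by (simp add: algebra_simps)
  have dbr: "?d (br n y z) = br n dy z + sp_scale ?s (br n y dz)"
    unfolding dy_def dz_def by (rule drop_const_deriv_br[OF sho_polyD(2)[OF y(1)] y(2) sho_polyD(2)[OF z(1)]])
  have ii: "?d (br n y (psi j z)) = br n dy (psi j z) + sp_scale ?s (br n y (?d (psi j z)))"
    unfolding dy_def
    by (rule drop_const_deriv_br[OF sho_polyD(2)[OF y(1)] y(2) sho_polyD(2)[OF psi_correct(1)[OF z(1)]]])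
  have iii: "?d (br n (psi i y) z) = br n (?d (psi i y)) z + sp_scale ?s (br n (psi i y) dz)"
    unfolding dz_def
    by (rule drop_const_deriv_br[OF sho_polyD(2)[OF psi_correct(1)[OF y(1)]] psi_correct(4)[OF y] sho_polyD(2)[OF z(1)]])
  have iv: "?d (psi (i + j) (br n y z)) = m (- 1) (i + j) (shift u) (br n y z)
      + (psi (i + j - 1) (br n dy z) + sp_scale ?s (psi (i + j - 1) (br n y dz))) - br n (P u) (br n y z)"
  proof -
    have "psi (i + j - 1) (?d (br n y z)) = psi (i + j - 1) (br n dy z) + sp_scale ?s (psi (i + j - 1) (br n y dz))"
      unfolding dbr psi_correct(2)[OF brdH(1) sho_poly_closed(3)[OF brdH(2)]] psi_correct(3)[OF brdH(2)] ..
    then show ?thesis using psi_correct(5)[OF brH u] ij by simp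
  qed
  have v: "?d (psi j z) = m (- 1) j (shift u) z + psi (j - 1) dz - br n (P u) z"
    "?d (psi i y) = m (- 1) i (shift u) y + psi (i - 1) dy - br n (P u) y"
    unfolding dy_def dz_def using psi_correct(5)[OF z(1) u] psi_correct(5)[OF y(1) u] ij by auto
  have vi: "br n (P u) (br n y z) = br n (br n (P u) y) z + sp_scale ?s (br n y (br n (P u) z))"
    by (rule jacobi[OF PH P_parity[OF u] y z])
  show ?thesis
    unfolding remainder_def d_lin i ii iii iv v vi idx
    by (simp add: br_linear SP.scale_right_distrib SP.scale_right_diff_distrib)
qed

text \<open>By induction on the sum of the degrees all derivatives of the remainder vanish, and its degree
  excludes constants.\<close>

lemma remainder_zero:
  assumes "y \<in> sho_poly n i" "y \<in> has_parity a" "z \<in> sho_poly n j" "z \<in> has_parity b" "i \<ge> - 1" "j \<ge> - 1"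
  shows "remainder i j y z = 0"
  using assms
proof (induction "nat (i + j + 2)" arbitrary: i j y z a b rule: less_induct)
  case less
  note y = less.prems(1,2) and z = less.prems(3,4)
  show ?case
  proof (cases "i = - 1")
    case True
    then show ?thesis using remainder_linear_part y(1) z(1) less.prems(6) by blast
  next
    case False
    then have i: "i \<ge> 0" using less.prems(5) by simp
    have n1: "n \<ge> 1" "n \<ge> 2" using n by auto
    have R: "remainder i j y z \<in> homog n (i + j + k)"
    proof -
      have "br n y (psi j z) \<in> sho_poly n (i + j + k)" "br n (psi i y) z \<in> sho_poly n (i + j + k)"
        using br_sho_poly'[OF y(1) psi_correct(1)[OF z(1)] _ n1(1), of "i + j + k"]
          br_sho_poly'[OF psi_correct(1)[OF y(1)] z(1) _ n1(1), of "i + j + k"] by auto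
      moreover have "psi (i + j) (br n y z) \<in> sho_poly n (i + j + k)"
        by (rule psi_correct(1)[OF br_sho_poly'[OF y(1) z(1) refl n1(1)]])
      moreover have "m i j y z \<in> sho_poly n (i + j + k)" by (rule m_in[OF y(1) z(1)])
      ultimately have "remainder i j y z \<in> sho_poly n (i + j + k)"
        unfolding remainder_def by (intro sho_poly_closed(1,2))
      then show ?thesis by (rule sho_polyD(1))
    qed
    show ?thesis
    proof (rule derivatives_zero[OF R])
      show "i + j + k \<noteq> - 2" using i less.prems(6) k by simp
      fix u assume u: "u \<in> coords n"
      let ?dy = "drop_const (deriv_op u y)" and ?dz = "drop_const (deriv_op u z)"
      have dy: "?dy \<in> sho_poly n (i - 1)" "?dy \<in> has_parity (a + snd u)"
        using deriv_op_sho_poly[OF y(1) u n1(2)] drop_const_closed(2)[OF deriv_op_parity[OF y(2) sho_polyD(1)[OF y(1)]]] by auto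
      have dz: "?dz \<in> sho_poly n (j - 1)" "?dz \<in> has_parity (b + snd u)"
        using deriv_op_sho_poly[OF z(1) u n1(2)] drop_const_closed(2)[OF deriv_op_parity[OF z(2) sho_polyD(1)[OF z(1)]]] by auto
      have "remainder (i - 1) j ?dy z = 0"
        using less.hyps[OF _ dy z] i less.prems(6) by simp
      moreover have "remainder i (j - 1) y ?dz = 0"
      proof (cases "j = - 1")
        case True
        then have "?dz = 0" using sho_poly_low[OF dz(1)] by simp
        then show ?thesis using m_0(1)[OF y(1)] by (simp add: remainder_def br_linear)
      next
        case False
        then show ?thesis using less.hyps[OF _ y dz] i less.prems(6) by simp
      qed
      ultimately have "drop_const (deriv_op u (remainder i j y z)) = 0"
        using deriv_remainder[OF y z i less.prems(6) u] by simp
      moreover have "drop_const (deriv_op u (remainder i j y z)) = deriv_op u (remainder i j y z)"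
        by (rule drop_const_homog[OF deriv_op_homog[OF R]]) (use i less.prems(6) k in simp)
      ultimately show "deriv_op u (remainder i j y z) = 0" by simp
    qed
  qed
qed

lemma coboundary:
  assumes y: "y \<in> sho_poly n i" "y \<in> has_parity a" and z: "z \<in> sho_poly n j" "z \<in> has_parity b"
  shows "m i j y z = br n y (psi j z) + br n (psi i y) z - psi (i + j) (br n y z)"
proof (cases "i \<ge> - 1 \<and> j \<ge> - 1")
  case True
  then show ?thesis using remainder_zero[OF y z] by (simp add: remainder_def)
next
  case False
  then have "y = 0 \<or> z = 0" using sho_poly_low[OF y(1)] sho_poly_low[OF z(1)] by auto
  then show ?thesis using m_0(1)[OF y(1)] m_0(2)[OF z(1)] by (auto simp: br_linear)
qed

end

theorem cocycle_trivial:
  obtains \<psi> where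
    "\<And>j y y'. y \<in> sho_poly n j \<Longrightarrow> y' \<in> sho_poly n j \<Longrightarrow> \<psi> j (y + y') = \<psi> j y + \<psi> j y'"
    "\<And>j y r. y \<in> sho_poly n j \<Longrightarrow> \<psi> j (sp_scale r y) = sp_scale r (\<psi> j y)"
    "\<And>j y. y \<in> sho_poly n j \<Longrightarrow> \<psi> j y \<in> sho_poly n (j + k)"
    "\<And>j y a. y \<in> sho_poly n j \<Longrightarrow> y \<in> has_parity a \<Longrightarrow> \<psi> j y \<in> has_parity a"
    "\<And>i j y z a b. y \<in> sho_poly n i \<Longrightarrow> y \<in> has_parity a \<Longrightarrow> z \<in> sho_poly n j \<Longrightarrow> z \<in> has_parity b \<Longrightarrow>
      m i j y z = br n y (\<psi> j z) + br n (\<psi> i y) z - \<psi> (i + j) (br n y z)"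
proof -
  obtain P where P: "\<And>v. v \<in> coords n \<Longrightarrow> P v \<in> homog n (k - 1)" "\<And>v. v \<in> coords n \<Longrightarrow> P v \<in> has_parity (snd v)"
    "\<And>v. v \<in> coords n \<Longrightarrow> Delta n (P v) = 0"
    "\<And>u v. u \<in> coords n \<Longrightarrow> v \<in> coords n \<Longrightarrow> c u v = deriv_op u (P v) - sp_scale (coord_sign u v) (deriv_op v (P u))"
    using harmonic_potential_exists by blast
  show ?thesis
  proof (rule that[of "psi P"])
    show "psi P j (y + y') = psi P j y + psi P j y'" if "y \<in> sho_poly n j" "y' \<in> sho_poly n j" for j y y'
      by (rule psi_correct(2)[OF P that])
    show "psi P j (sp_scale r y) = sp_scale r (psi P j y)" if "y \<in> sho_poly n j" for j y r
      by (rule psi_correct(3)[OF P that])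
    show "psi P j y \<in> sho_poly n (j + k)" if "y \<in> sho_poly n j" for j y
      by (rule psi_correct(1)[OF P that])
    show "psi P j y \<in> has_parity a" if "y \<in> sho_poly n j" "y \<in> has_parity a" for j y a
      by (rule psi_correct(4)[OF P that])
    show "m i j y z = br n y (psi P j z) + br n (psi P i y) z - psi P (i + j) (br n y z)"
      if "y \<in> sho_poly n i" "y \<in> has_parity a" "z \<in> sho_poly n j" "z \<in> has_parity b" for i j y z a b
      by (rule coboundary[OF P that])
  qed
qed

end

section \<open>Cohomology and deformations of \<open>SHO(n,n)\<close>\<close>

lemma SHO_simps [simp]: "lie_scale (SHO n) = mod_scale" "lie_bracket (SHO n) = mod_buttin n"
  by (simp_all add: SHO_def)

lemma repr_grade:
  assumes "n \<ge> 2" "u \<in> grade (SHO n) j"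
  shows "repr u \<in> sho_poly n j"
  using assms by (auto simp: SHO_grade repr_mod_class sho_polyD(6))

lemma repr_component:
  assumes "n \<ge> 2" "u \<in> grade (SHO n) j \<inter> lie_part (SHO n) a"
  shows "repr u \<in> sho_poly n j" "repr u \<in> has_parity a"
proof -
  obtain f where "f \<in> sho_poly n j" "f \<in> has_parity a" "u = mod_class f"
    using assms(2) unfolding SHO_component[OF assms(1)] by blast
  then show "repr u \<in> sho_poly n j" "repr u \<in> has_parity a"
    by (simp_all add: repr_mod_class sho_polyD(6))
qed

lemma mod_class_component:
  "n \<ge> 2 \<Longrightarrow> f \<in> sho_poly n j \<Longrightarrow> f \<in> has_parity a \<Longrightarrow> mod_class f \<in> grade (SHO n) j \<inter> lie_part (SHO n) a"
  using SHO_component by blast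

lemma repr_bracket: "repr (mod_buttin n u v) = br n (repr u) (repr v)"
proof -
  have "repr (mod_class (br n (repr u) (repr v))) = br n (repr u) (repr v)"
    unfolding repr_mod_class br_def by (simp add: drop_const_eq lookup_drop_const)
  then show ?thesis unfolding mod_class_ops(5)[symmetric] mod_class_repr .
qed

lemma repr_sho_poly: "f \<in> sho_poly n j \<Longrightarrow> repr (mod_class f) = f"
  by (simp add: repr_mod_class sho_polyD(6))

text \<open>The cocycle is transported to representatives without constant term and the resulting 1-cochain is
  transported back.\<close>

theorem SHO_no_cohomology:
  assumes n: "n \<ge> 3" and jac: "graded_jacobi (SHO n)" and k: "k > 0" and \<mu>: "even_2_cocycle (SHO n) k \<mu>"
  shows "\<exists>\<psi>. even_1_cochain (SHO n) k \<psi> \<and> is_coboundary_of (SHO n) \<mu> \<psi>"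
proof -
  have n2: "n \<ge> 2" using n by simp
  let ?c = "mod_class"
  define m where "m i j f g = repr (\<mu> i j (?c f) (?c g))" for i j f g
  note gr = SHO_grade[OF n2]
  note comp = mod_class_component[OF n2]
  note M = \<mu>[unfolded even_2_cocycle_def SHO_simps]
  note add = M[THEN conjunct1, rule_format, THEN conjunct1] M[THEN conjunct1, rule_format, THEN conjunct2]
  note scale = M[THEN conjunct2, THEN conjunct1, rule_format, THEN conjunct1]
    M[THEN conjunct2, THEN conjunct1, rule_format, THEN conjunct2]
  note pure = M[THEN conjunct2, THEN conjunct2, THEN conjunct1, rule_format, THEN conjunct1]
    M[THEN conjunct2, THEN conjunct2, THEN conjunct1, rule_format, THEN conjunct2]
  note cocycle = M[THEN conjunct2, THEN conjunct2, THEN conjunct2, rule_format]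
  have m_add: "m i j (f + f') g = m i j f g + m i j f' g" "m j i g (f + f') = m j i g f + m j i g f'"
    if "f \<in> sho_poly n i" "f' \<in> sho_poly n i" "g \<in> sho_poly n j" for i j f f' g
    unfolding m_def mod_class_ops(1) using that by (simp_all add: add gr repr_linear)
  have m_pure: "m i j f g \<in> sho_poly n (i + j + k)" "m i j f g \<in> has_parity (a + b)"
    if "f \<in> sho_poly n i" "f \<in> has_parity a" "g \<in> sho_poly n j" "g \<in> has_parity b" for i j f g a b
    unfolding m_def using repr_component[OF n2 pure(1)[OF comp[OF that(1,2)] comp[OF that(3,4)]]] by blast+
  interpret sho_cocycle n k m
  proof
    show "n \<ge> 3" "k > 0" by (fact n k)+
    show "m i j f g \<in> sho_poly n (i + j + k)" if f: "f \<in> sho_poly n i" and g: "g \<in> sho_poly n j" for i j f g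
    proof -
      obtain f0 f1 where f': "f0 \<in> sho_poly n i" "f0 \<in> has_parity 0" "f1 \<in> sho_poly n i" "f1 \<in> has_parity 1" "f = f0 + f1"
        using sho_parity_decompose[OF f] by blast
      obtain g0 g1 where g': "g0 \<in> sho_poly n j" "g0 \<in> has_parity 0" "g1 \<in> sho_poly n j" "g1 \<in> has_parity 1" "g = g0 + g1"
        using sho_parity_decompose[OF g] by blast
      have "m i j f g = (m i j f0 g0 + m i j f0 g1) + (m i j f1 g0 + m i j f1 g1)"
        unfolding f'(5) using g by (simp only: m_add(1)[OF f'(1,3)] g'(5) m_add(2)[OF g'(1,3)] f'(1,3))
      then show ?thesis
        using m_pure(1)[OF f'(1,2) g'(1,2)] m_pure(1)[OF f'(1,2) g'(3,4)]
          m_pure(1)[OF f'(3,4) g'(1,2)] m_pure(1)[OF f'(3,4) g'(3,4)]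
        by (simp add: sho_poly_closed(1))
    qed
    show "m i j f g \<in> has_parity (a + b)"
      if "f \<in> sho_poly n i" "f \<in> has_parity a" "g \<in> sho_poly n j" "g \<in> has_parity b" for i j f g a b
      by (rule m_pure(2)[OF that])
    show "m i j (f + f') g = m i j f g + m i j f' g" "m j i g (f + f') = m j i g f + m j i g f'"
      if "f \<in> sho_poly n i" "f' \<in> sho_poly n i" "g \<in> sho_poly n j" for i j f f' g
      by (rule m_add[OF that])+
    show "m i j (sp_scale c f) g = sp_scale c (m i j f g)" "m i j f (sp_scale c g) = sp_scale c (m i j f g)"
      if "f \<in> sho_poly n i" "g \<in> sho_poly n j" for i j f g c
      unfolding m_def mod_class_ops(4)[symmetric] using that by (simp_all add: scale gr repr_linear)
    show "m i j f g = - sp_scale (parity_sign a b) (m j i g f)"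
      if "f \<in> sho_poly n i" "f \<in> has_parity a" "g \<in> sho_poly n j" "g \<in> has_parity b" for i j f g a b
      unfolding m_def pure(2)[OF comp[OF that(1,2)] comp[OF that(3,4)]] by (simp add: repr_linear)
    show "br n f (m j l g h) + m i (j + l) f (br n g h) = br n (m i j f g) h + m (i + j) l (br n f g) h
        + sp_scale (parity_sign a b) (br n g (m i l f h) + m j (i + l) g (br n f h))"
      if "f \<in> sho_poly n i" "f \<in> has_parity a" "g \<in> sho_poly n j" "g \<in> has_parity b"
        "h \<in> sho_poly n l" "h \<in> has_parity c" for i j l f g h a b c
      using arg_cong[OF cocycle[OF comp[OF that(1,2)] comp[OF that(3,4)] comp[OF that(5,6)]], of repr]
      unfolding m_def mod_class_ops(5)[symmetric] repr_linear repr_bracket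
        repr_sho_poly[OF that(1)] repr_sho_poly[OF that(3)] repr_sho_poly[OF that(5)] .
    show "br n f (br n g h) = br n (br n f g) h + sp_scale (parity_sign a b) (br n g (br n f h))"
      if "f \<in> sho_poly n i" "f \<in> has_parity a" "g \<in> sho_poly n j" "g \<in> has_parity b"
        "h \<in> sho_poly n l" "h \<in> has_parity c" for i j l f g h a b c
    proof -
      have "mod_buttin n (?c f) (mod_buttin n (?c g) (?c h)) = mod_buttin n (mod_buttin n (?c f) (?c g)) (?c h)
          + mod_scale (parity_sign a b) (mod_buttin n (?c g) (mod_buttin n (?c f) (?c h)))"
        using jac comp[OF that(1,2)] comp[OF that(3,4)] comp[OF that(5,6)]
        unfolding graded_jacobi_def SHO_simps by blast
      from arg_cong[OF this, of repr] show ?thesis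
        unfolding repr_linear repr_bracket
          repr_sho_poly[OF that(1)] repr_sho_poly[OF that(3)] repr_sho_poly[OF that(5)] .
    qed
  qed
  obtain \<psi> where \<psi>:
    "\<And>j y y'. y \<in> sho_poly n j \<Longrightarrow> y' \<in> sho_poly n j \<Longrightarrow> \<psi> j (y + y') = \<psi> j y + \<psi> j y'"
    "\<And>j y r. y \<in> sho_poly n j \<Longrightarrow> \<psi> j (sp_scale r y) = sp_scale r (\<psi> j y)"
    "\<And>j y. y \<in> sho_poly n j \<Longrightarrow> \<psi> j y \<in> sho_poly n (j + k)"
    "\<And>j y a. y \<in> sho_poly n j \<Longrightarrow> y \<in> has_parity a \<Longrightarrow> \<psi> j y \<in> has_parity a"
    "\<And>i j y z a b. y \<in> sho_poly n i \<Longrightarrow> y \<in> has_parity a \<Longrightarrow> z \<in> sho_poly n j \<Longrightarrow> z \<in> has_parity b \<Longrightarrow>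
      m i j y z = br n y (\<psi> j z) + br n (\<psi> i y) z - \<psi> (i + j) (br n y z)"
    by (rule cocycle_trivial) blast
  define \<Psi> where "\<Psi> j u = ?c (\<psi> j (repr u))" for j u
  have lin: "grade_linear (SHO n) (lie_scale (SHO n)) \<Psi>"
    unfolding grade_linear_def SHO_simps \<Psi>_def
    by (auto simp: repr_linear \<psi>(1,2) repr_grade[OF n2] mod_class_ops)
  have "even_1_cochain (SHO n) k \<Psi>"
    unfolding even_1_cochain_def
  proof (intro conjI lin allI ballI)
    fix j a y assume "y \<in> grade (SHO n) j \<inter> lie_part (SHO n) a"
    note y = repr_component[OF n2 this]
    show "\<Psi> j y \<in> grade (SHO n) (j + k) \<inter> lie_part (SHO n) a"
      unfolding \<Psi>_def by (rule comp[OF \<psi>(3)[OF y(1)] \<psi>(4)[OF y]])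
  qed
  moreover have "is_coboundary_of (SHO n) \<mu> \<Psi>"
    unfolding is_coboundary_of_def SHO_simps
  proof (intro allI ballI)
    fix i j a b x y
    assume "x \<in> grade (SHO n) i \<inter> lie_part (SHO n) a" "y \<in> grade (SHO n) j \<inter> lie_part (SHO n) b"
    note x = repr_component[OF n2 this(1)] and y = repr_component[OF n2 this(2)]
    have "\<mu> i j x y = ?c (m i j (repr x) (repr y))" by (simp add: m_def)
    also have "\<dots> = ?c (br n (repr x) (\<psi> j (repr y)) + br n (\<psi> i (repr x)) (repr y) - \<psi> (i + j) (br n (repr x) (repr y)))"
      by (simp only: \<psi>(5)[OF x y])
    also have "\<dots> = mod_buttin n x (\<Psi> j y) + mod_buttin n (\<Psi> i x) y - \<Psi> (i + j) (mod_buttin n x y)"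
      unfolding \<Psi>_def repr_bracket mod_class_ops(1,3) mod_class_ops(5)[symmetric] mod_class_repr ..
    finally show "\<mu> i j x y = mod_buttin n x (\<Psi> j y) + mod_buttin n (\<Psi> i x) y - \<Psi> (i + j) (mod_buttin n x y)" .
  qed
  ultimately show ?thesis by blast
qed

theorem theorem4p1:
  fixes n :: nat and L :: "('a::ab_group_add) filtered_superalgebra"
  assumes "n \<ge> 3"
    and "filtered_deformation 1 (SHO n) L"
  shows "trivial_deformation 1 (SHO n) L"
proof (rule trivial_deformation_if_no_cohomology[OF assms(2)])
  show "vector_space (lie_scale (SHO n))" by (simp add: vector_space_mod_scale)
qed (rule SHO_no_cohomology[OF assms(1)])

end
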